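(* If $O$ is an lsp-operation, then $O_{lopsp}$ is a lopsp-operation, and $O(G)=O_{lopsp}(G)$ (up to isomorphism of embedded graphs) for any embedded graph $G$. Moreover, the Delaney–Dress symbols $\mathcal D(O)$ and $\mathcal D(O_{lopsp})$ are Delaney–Dress symbols of combinatorially isomorphic tilings.
   Context: **Embedded graphs.** Graphs are finite and may have loops and multiple edges. Every edge with endpoints $v,w$ yields two mutually inverse oriented edges $e,e^{-1}$, one starting at $v$, the other at $w$ (for a loop both start at $v$). An embedded graph $G$ is a connected graph with at least one edge together with, for every vertex $v$, a cyclic order (the rotational order, drawn clockwise) of the oriented edges starting at $v$; $\sigma_G(e)$ is the successor of $e$. Oriented edges $e$ and $\sigma_G(e^{-1})$ form an angle; a face is a cyclic sequence of oriented edges in which any two consecutive ones form an angle; its facial walk is the corresponding closed walk. The genus is $(2-|V_G|+|E_G|-|F_G|)/2$; plane means genus 0. **Barycentric subdivision.** $B_G$ is the embedded graph with one vertex of type 0, 1, 2 for every vertex, edge, face of $G$, respectively. Edges of $B_G$ join incident vertices and edges, vertices and faces, edges and faces of $G$, with multiplicity (one 0–1 edge per oriented edge, one 0–2 edge per angle, one 1–2 edge per occurrence of an edge in a facial walk). The rotational order at a type-0 vertex follows the alternating sequence of edges and angles around it in $G$, similarly at type-1 vertices (which have degree 4); at a type-2 vertex it is the inverse of the order of vertices and edges along the facial walk. An edge is of type $i$ (an $i$-edge) if it is not incident with a vertex of type $i$ (an $i$-vertex). Every face of $B_G$ is a triangle with one vertex and one edge of each type, called a chamber. The double chamber system $D_G$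 is the embedded subgraph of $B_G$ containing only the edges of types 1 and 2; its faces, the double chambers, have facial walks of length four through one 2-vertex, a 0-vertex, one 1-vertex and a 0-vertex (the two 0-vertices may coincide). **lsp-operations.** An lsp-operation is a 2-connected plane embedded graph $O$ with a labelling $t:V_O\to\{0,1,2\}$ (types) and an outer face containing three distinct special vertices $v_0,v_1,v_2$ such that: every inner face (chamber) is a triangle; no edge joins vertices of the same type; every vertex of type 1 not in the outer face has degree 4; every vertex of type 1 in the outer face different from $v_0,v_1,v_2$ has degree 3; $t(v_0),t(v_2)\neq1$; if $t(v_1)=1$ then $\deg(v_1)=2$. Application: in $B_G$ replace every 0-edge by a copy of the boundary path of $O$ from $v_2$ to $v_1$ not containing $v_0$, every 1-edge by a copy of the boundary path from $v_2$ to $v_0$ not containing $v_1$, every 2-edge by a copy of the boundary path from $v_1$ to $v_0$ not containing $v_2$ (copies of $v_i$ at $i$-vertices), and glue into every chamber a copy of $O$ or of its mirror image, depending on the orientation of the chamber. The result is a labelled triangulation that is the barycentric subdivision of an embedded graph, denoted $O(G)$. **lopsp-operations.** A lopsp-operation is a 2-connected plane embedded graph $O$ with a labelling $t:V_O\to\{0,1,2\}$ and three distinct special vertices $v_0,v_1,v_2$ such that: every face (chamber) is a triangle; no edge joins vertices of the same type; every vertex of type 1 different from $v_0,v_1,v_2$ has degree 4; $t(v_0),t(v_2)\ne1$; if $t(v_1)=1$ then $\deg(v_1)=2$. A cut-path is a path $P$ in $O$ from $v_1$ to $v_2$ through $v_0$ (cut-paths exist); $P_{a,b}$ denotes the subpath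 between $a$ and $b$. Cutting $O$ open along $P$ (each vertex of $P$ other than $v_1,v_2$ and each edge of $P$ is split into two copies, one per side) gives the double chamber patch $O_P$, a plane graph whose outer boundary consists of two copies of $P$ sharing $v_1$ and $v_2$, passing through $v_2,v_{0,L},v_1,v_{0,R}$ in cyclic order, where $v_{0,L},v_{0,R}$ are the copies of $v_0$. Application: in $D_G$ replace every 2-edge by a copy of $P_{v_0,v_1}$ and every 1-edge by a copy of $P_{v_0,v_2}$ (copies of $v_i$ at $i$-vertices), and glue a copy of $O_P$, preserving orientation, into every face. The result $O_P(G)$ is the barycentric subdivision of an embedded graph, which up to isomorphism does not depend on $P$ and is denoted $O(G)$. **$O_{lopsp}$.** For an lsp-operation $O$ with outer face boundary $c$, $O_{lopsp}$ is the labelled embedded graph obtained by gluing a mirrored copy of the inside of $c$ (i.e. of $O$) into the outer face of $O$, identifying the vertices and edges on $c$ with their copies. The special vertices of $O_{lopsp}$ are the special vertices $v_0,v_1,v_2$ of $O$. **Delaney–Dress symbols.** Let $\Sigma=\langle\sigma_0,\sigma_1,\sigma_2\mid\sigma_i^2=1\rangle$. For an lsp- or lopsp-operation $O$ let $\mathcal D_O$ be its set of chambers, with right $\Sigma$-action: $C\sigma_i=C'$ if $C\ne C'$ share their $i$-edge (an $i$-edge being one not incident with a vertex of type $i$), and $C\sigma_i=C$ if (lsp case) the $i$-edge of $C$ is on the outer face. For $i<j$ let $v^{ij}(C)$ be the vertex of $C$ of type different from $i,j$ and let $n_{ij}(C)$ be the size of the $\langle\sigma_i,\sigma_j\rangle$-orbit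 of $C$. For an lsp-operation $m_{ij}(C)=2n_{ij}(C),3n_{ij}(C),6n_{ij}(C)$ if $v^{ij}(C)=v_1,v_0,v_2$ respectively, $m_{ij}(C)=n_{ij}(C)/2$ if $v^{ij}(C)$ is not in the outer face, and $m_{ij}(C)=n_{ij}(C)$ for the other vertices in the outer face. For a lopsp-operation $m_{ij}(C)=\frac{n_{ij}(C)}2\cdot c$ with $c=2,3,6$ if $v^{ij}(C)=v_1,v_0,v_2$ respectively and $c=1$ otherwise. $\mathcal D(O)=(\mathcal D_O,m_{01},m_{02},m_{12})$. The tiling encoded by such a symbol is: fixing $C\in\mathcal D_O$ and letting $N\le\Sigma$ be the subgroup generated by all $w(\sigma_i\sigma_j)^{m_{ij}(Cw)}w^{-1}$ ($w\in\Sigma$, $i<j$), its chambers are the cosets $Nw$, with $\Sigma$ acting by right multiplication; its vertices, edges, faces are the $\langle\sigma_1,\sigma_2\rangle$-, $\langle\sigma_0,\sigma_2\rangle$-, $\langle\sigma_0,\sigma_1\rangle$-orbits of chambers. Two tilings are combinatorially isomorphic if there is a bijection between their chamber sets commuting with the action of $\Sigma$. *)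

theory Defs
  imports
    "HOL-Combinatorics.Orbits"
    "HOL-Algebra.Generated_Groups"
    Complex_Main
begin

section \<open>Embedded graphs\<close>

text \<open>
  An embedded graph is given by its oriented edges (darts), the map taking an oriented edge to the
  inverse oriented edge, and the clockwise successor \<^term>\<open>rot\<close>. As embedded graphs are connected
  with at least one edge, every vertex is the start of some oriented edge; a vertex is
  therefore identified with the set of oriented edges starting at it, which is one cycle of
  \<^term>\<open>rot\<close>. Likewise a face is identified with the set of oriented edges of its facial walk.
  The values of the maps outside \<^term>\<open>darts\<close> are irrelevant.
\<close>

record 'd emb =
  darts :: "'d set"
  oinv :: "'d \<Rightarrow> 'd"
  rot :: "'d \<Rightarrow> 'd"

definition vertex :: "('d, 'z) emb_scheme \<Rightarrow> 'd \<Rightarrow> 'd set" where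
  "vertex M d = orbit (rot M) d"

definition end_vertex :: "('d, 'z) emb_scheme \<Rightarrow> 'd \<Rightarrow> 'd set" where
  "end_vertex M d = vertex M (oinv M d)"

text \<open>With clockwise rotation, the face that a facial walk follows lies to the left of its oriented edges.\<close>

definition face_next :: "('d, 'z) emb_scheme \<Rightarrow> 'd \<Rightarrow> 'd" where
  "face_next M d = rot M (oinv M d)"

definition face :: "('d, 'z) emb_scheme \<Rightarrow> 'd \<Rightarrow> 'd set" where
  "face M d = orbit (face_next M) d"

definition vertices :: "('d, 'z) emb_scheme \<Rightarrow> 'd set set" where
  "vertices M = vertex M ` darts M"

definition edges :: "('d, 'z) emb_scheme \<Rightarrow> 'd set set" where
  "edges M = (\<lambda>d. {d, oinv M d}) ` darts M"

definition faces :: "('d, 'z) emb_scheme \<Rightarrow> 'd set set" where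
  "faces M = face M ` darts M"

text \<open>Connectedness of the subgraph induced by a set \<open>W\<close> of vertices.\<close>

definition connected_on :: "('d, 'z) emb_scheme \<Rightarrow> 'd set set \<Rightarrow> bool" where
  "connected_on M W \<longleftrightarrow>
     (\<forall>u\<in>W. \<forall>v\<in>W.
        (u, v) \<in> {(vertex M d, end_vertex M d) | d.
                    d \<in> darts M \<and> vertex M d \<in> W \<and> end_vertex M d \<in> W}\<^sup>*)"

definition embedded_graph :: "('d, 'z) emb_scheme \<Rightarrow> bool" where
  "embedded_graph M \<longleftrightarrow>
     finite (darts M) \<and> darts M \<noteq> {} \<and>
     (\<forall>d\<in>darts M. oinv M d \<in> darts M \<and> oinv M d \<noteq> d \<and> oinv M (oinv M d) = d) \<and>
     bij_betw (rot M) (darts M) (darts M) \<and>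
     connected_on M (vertices M)"

definition two_connected :: "('d, 'z) emb_scheme \<Rightarrow> bool" where
  "two_connected M \<longleftrightarrow>
     3 \<le> card (vertices M) \<and> connected_on M (vertices M) \<and>
     (\<forall>x\<in>vertices M. connected_on M (vertices M - {x}))"

definition genus :: "('d, 'z) emb_scheme \<Rightarrow> real" where
  "genus M = (2 - real (card (vertices M)) + real (card (edges M)) - real (card (faces M))) / 2"

definition plane :: "('d, 'z) emb_scheme \<Rightarrow> bool" where
  "plane M \<longleftrightarrow> genus M = 0"

definition emb_isomorphic :: "('d, 'y) emb_scheme \<Rightarrow> ('e, 'z) emb_scheme \<Rightarrow> bool" where
  "emb_isomorphic M N \<longleftrightarrow>
     (\<exists>f. bij_betw f (darts M) (darts N) \<and>
          (\<forall>d\<in>darts M. f (oinv M d) = oinv N (f d) \<and> f (rot M d) = rot N (f d)))"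


section \<open>Labelled embedded graphs and barycentric subdivisions\<close>

record 'd lemb = "'d emb" +
  vtype :: "'d set \<Rightarrow> nat"

definition start_type :: "('d, 'z) lemb_scheme \<Rightarrow> 'd \<Rightarrow> nat" where
  "start_type M d = vtype M (vertex M d)"

definition end_type :: "('d, 'z) lemb_scheme \<Rightarrow> 'd \<Rightarrow> nat" where
  "end_type M d = vtype M (end_vertex M d)"

definition has_edge_type :: "('d, 'z) lemb_scheme \<Rightarrow> nat \<Rightarrow> 'd \<Rightarrow> bool" where
  "has_edge_type M i d \<longleftrightarrow> start_type M d \<noteq> i \<and> end_type M d \<noteq> i"

text \<open>
  In \<open>barycentric G\<close> every oriented edge \<open>e\<close> of \<open>G\<close> gives three edges: the 0--1 edge joining
  the start of \<open>e\<close> to the edge of \<open>e\<close>, the 1--2 edge joining the edge of \<open>e\<close> to the face of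
  \<open>e\<close>, and the 0--2 edge of the angle formed by the predecessor of \<open>e\<close> in the facial walk and \<open>e\<close>,
  which joins the start of \<open>e\<close> to the face of \<open>e\<close>. The triple \<open>(e, i, j)\<close> is the \<open>i\<close>--\<open>j\<close> edge
  given by \<open>e\<close>, oriented from its endpoint of type \<open>i\<close> to its endpoint of type \<open>j\<close>.
\<close>

fun bary_rot :: "('d, 'z) emb_scheme \<Rightarrow> 'd \<times> nat \<times> nat \<Rightarrow> 'd \<times> nat \<times> nat" where
  "bary_rot G (e, i, j) =
     (if (i, j) = (0, 1) then (rot G e, 0, 2)
      else if (i, j) = (0, 2) then (e, 0, 1)
      else if (i, j) = (1, 0) then (e, 1, 2)
      else if (i, j) = (1, 2) then (oinv G e, 1, 0)
      else if (i, j) = (2, 1) then (e, 2, 0)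
      else (inv_into (darts G) (face_next G) e, 2, 1))"

definition barycentric :: "('d, 'z) emb_scheme \<Rightarrow> ('d \<times> nat \<times> nat) lemb" where
  "barycentric G =
     \<lparr> darts = {(e, i, j). e \<in> darts G \<and> i < 3 \<and> j < 3 \<and> i \<noteq> j},
       oinv = (\<lambda>(e, i, j). (e, j, i)),
       rot = bary_rot G,
       vtype = (\<lambda>V. the_elem ((\<lambda>(e, i, j). i) ` V)) \<rparr>"

text \<open>The embedded graph \<open>H\<close> that has the given labelled triangulation as its barycentric
  subdivision: an oriented edge of \<open>H\<close> is represented by its initial half, a 2-edge directed from
  a 0-vertex to a 1-vertex. Around a 0-vertex, and around a 1-vertex (of degree 4), every second
  oriented edge belongs to a 2-edge.\<close>

definition underlying_graph :: "('d, 'z) lemb_scheme \<Rightarrow> 'd emb" where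
  "underlying_graph T =
     \<lparr> darts = {d \<in> darts T. start_type T d = 0 \<and> end_type T d = 1},
       oinv = (\<lambda>d. oinv T (rot T (rot T (oinv T d)))),
       rot = (\<lambda>d. rot T (rot T d)) \<rparr>"

lemma barycentric_simps:
  "oinv (barycentric G) (e, i, j) = (e, j, i)"
  "rot (barycentric G) = bary_rot G"
  "(e, i, j) \<in> darts (barycentric G) \<longleftrightarrow> e \<in> darts G \<and> i < 3 \<and> j < 3 \<and> i \<noteq> j"
  by (auto simp: barycentric_def)

lemma bary_rot_type:
  assumes "i < 3" "j < 3" "i \<noteq> j"
  shows "\<exists>e' j'. bary_rot G (e, i, j) = (e', i, j') \<and> j' < 3 \<and> i \<noteq> j'"
proof -
  have "i \<in> {0, 1, 2}" "j \<in> {0, 1, 2}" using assms by auto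
  then show ?thesis using assms(3) by auto
qed

lemma start_type_barycentric:
  assumes "i < 3" "j < 3" "i \<noteq> j"
  shows "start_type (barycentric G) (e, i, j) = i"
proof -
  have *: "\<exists>e' j'. y = (e', i, j') \<and> j' < 3 \<and> i \<noteq> j'" if "y \<in> orbit (bary_rot G) (e, i, j)" for y
    using that
  proof induction
    case base
    show ?case using bary_rot_type[OF assms] .
  next
    case (step y)
    then obtain e' j' where "y = (e', i, j')" "j' < 3" "i \<noteq> j'" by blast
    then show ?case using bary_rot_type[of i j' G e'] assms(1) by metis
  qed
  have "(\<lambda>(e, i, j). i) y = i" if "y \<in> orbit (bary_rot G) (e, i, j)" for y
    using *[OF that] by auto
  moreover have "bary_rot G (e, i, j) \<in> orbit (bary_rot G) (e, i, j)" by (rule orbit.base)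
  ultimately have "(\<lambda>(e, i, j). i) ` orbit (bary_rot G) (e, i, j) = (\<lambda>_. i) ` orbit (bary_rot G) (e, i, j)"
    and "orbit (bary_rot G) (e, i, j) \<noteq> {}"
    by (auto simp del: bary_rot.simps intro!: image_cong)
  then have "(\<lambda>(e, i, j). i) ` orbit (bary_rot G) (e, i, j) = {i}"
    by (simp add: image_constant_conv)
  then show ?thesis
    by (simp add: start_type_def vertex_def barycentric_def)
qed

lemma end_type_barycentric:
  assumes "i < 3" "j < 3" "i \<noteq> j"
  shows "end_type (barycentric G) (e, i, j) = j"
  using start_type_barycentric[of j i G e] assms
  by (simp add: start_type_def end_type_def end_vertex_def barycentric_simps)

lemma underlying_graph_barycentric:
  assumes "embedded_graph G"
  shows "emb_isomorphic (underlying_graph (barycentric G)) G"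
proof -
  have D: "darts (underlying_graph (barycentric G)) = (\<lambda>e. (e, 0, 1)) ` darts G"
    by (auto simp: underlying_graph_def barycentric_simps start_type_barycentric end_type_barycentric)
  show ?thesis
    unfolding emb_isomorphic_def
  proof (intro exI conjI)
    show "bij_betw fst (darts (underlying_graph (barycentric G))) (darts G)"
      unfolding D by (rule bij_betwI[where g = "\<lambda>e. (e, 0, 1)"]) auto
  qed (auto simp: D, auto simp: underlying_graph_def barycentric_simps)
qed

definition sub_emb :: "('d, 'z) emb_scheme \<Rightarrow> 'd set \<Rightarrow> 'd emb" where
  "sub_emb M S =
     \<lparr> darts = S, oinv = oinv M,
       rot = (\<lambda>d. (rot M ^^ (LEAST k. 0 < k \<and> (rot M ^^ k) d \<in> S)) d) \<rparr>"

definition double_chamber_system :: "('d, 'z) emb_scheme \<Rightarrow> ('d \<times> nat \<times> nat) emb" where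
  "double_chamber_system G =
     sub_emb (barycentric G)
       {d \<in> darts (barycentric G).
          has_edge_type (barycentric G) 1 d \<or> has_edge_type (barycentric G) 2 d}"


section \<open>Gluing copies of a patch\<close>

text \<open>
  \<open>glue_copies M I X pos nb\<close> glues copies \<open>x \<in> X\<close> of the part of \<open>M\<close> consisting of the faces
  whose facial walks make up \<open>I \<subseteq> darts M\<close>; the copy \<open>x\<close> is a mirror image if \<open>pos x\<close> is
  false. In the result every oriented edge lies in the facial walk of exactly one face, and every
  face lies in exactly one copy: \<open>(x, d)\<close> is the oriented edge \<open>d\<close> with the face to its left
  in the copy \<open>x\<close>. In a mirror image the left face of \<open>d\<close> is the image of the right face of \<open>d\<close>,
  which is the left face of the inverse of \<open>d\<close>. The face to the right of \<open>(x, d)\<close> lies in the copy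
  \<open>nb x d\<close>: this is \<open>x\<close> itself if \<open>d\<close> is not on the boundary of the patch, and otherwise the copy
  to which \<open>x\<close> is glued along \<open>d\<close>. The clockwise successor of \<open>(x, d)\<close> is the
  next side of that right face, and is thus the clockwise successor of \<open>d\<close> in the copy \<open>nb x d\<close>.
\<close>

definition glue_copies ::
  "('d, 'z) lemb_scheme \<Rightarrow> 'd set \<Rightarrow> 'c set \<Rightarrow> ('c \<Rightarrow> bool) \<Rightarrow> ('c \<Rightarrow> 'd \<Rightarrow> 'c) \<Rightarrow> ('c \<times> 'd) lemb" where
  "glue_copies M I X pos nb =
     \<lparr> darts = {(x, d). x \<in> X \<and> d \<in> darts M \<and> (if pos x then d \<in> I else oinv M d \<in> I)},
       oinv = (\<lambda>(x, d). (nb x d, oinv M d)),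
       rot = (\<lambda>(x, d). (nb x d,
                if pos (nb x d) then rot M d else inv_into (darts M) (rot M) d)),
       vtype = (\<lambda>V. the_elem ((\<lambda>(x, d). vtype M (vertex M d)) ` V)) \<rparr>"


section \<open>Lsp- and lopsp-operations\<close>

text \<open>Only the special vertices \<open>special Q i\<close> with \<open>i < 3\<close> are relevant.\<close>

record 'd lopsp = "'d lemb" +
  special :: "nat \<Rightarrow> 'd set"

record 'd lsp = "'d lopsp" +
  outer :: "'d set"

definition lopsp_operation :: "('d, 'z) lopsp_scheme \<Rightarrow> bool" where
  "lopsp_operation Q \<longleftrightarrow>
     embedded_graph Q \<and> two_connected Q \<and> plane Q \<and>
     (\<forall>v\<in>vertices Q. vtype Q v \<in> {0, 1, 2}) \<and>
     special Q ` {0, 1, 2} \<subseteq> vertices Q \<and> inj_on (special Q) {0, 1, 2} \<and>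
     (\<forall>C\<in>faces Q. card C = 3) \<and>
     (\<forall>d\<in>darts Q. start_type Q d \<noteq> end_type Q d) \<and>
     (\<forall>v\<in>vertices Q. vtype Q v = 1 \<and> v \<notin> special Q ` {0, 1, 2} \<longrightarrow> card v = 4) \<and>
     vtype Q (special Q 0) \<noteq> 1 \<and> vtype Q (special Q 2) \<noteq> 1 \<and>
     (vtype Q (special Q 1) = 1 \<longrightarrow> card (special Q 1) = 2)"

text \<open>A vertex \<open>v\<close> is in the outer face iff some oriented edge starting at \<open>v\<close> is in its facial walk.\<close>

definition lsp_operation :: "('d, 'z) lsp_scheme \<Rightarrow> bool" where
  "lsp_operation Q \<longleftrightarrow>
     embedded_graph Q \<and> two_connected Q \<and> plane Q \<and>
     (\<forall>v\<in>vertices Q. vtype Q v \<in> {0, 1, 2}) \<and>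
     outer Q \<in> faces Q \<and>
     special Q ` {0, 1, 2} \<subseteq> vertices Q \<and> inj_on (special Q) {0, 1, 2} \<and>
     (\<forall>i\<in>{0, 1, 2}. special Q i \<inter> outer Q \<noteq> {}) \<and>
     (\<forall>C\<in>faces Q - {outer Q}. card C = 3) \<and>
     (\<forall>d\<in>darts Q. start_type Q d \<noteq> end_type Q d) \<and>
     (\<forall>v\<in>vertices Q. vtype Q v = 1 \<and> v \<inter> outer Q = {} \<longrightarrow> card v = 4) \<and>
     (\<forall>v\<in>vertices Q. vtype Q v = 1 \<and> v \<inter> outer Q \<noteq> {} \<and> v \<notin> special Q ` {0, 1, 2}
        \<longrightarrow> card v = 3) \<and>
     vtype Q (special Q 0) \<noteq> 1 \<and> vtype Q (special Q 2) \<noteq> 1 \<and>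
     (vtype Q (special Q 1) = 1 \<longrightarrow> card (special Q 1) = 2)"

text \<open>The chamber \<open>C\<sigma>\<^sub>i\<close>, where \<open>Cs\<close> is the set of all chambers: if the face on the other side of
  the \<open>i\<close>-edge of \<open>C\<close> is not in \<open>Cs\<close>, then \<open>C\<close> is fixed.\<close>

definition chamber_adj :: "('d, 'z) lemb_scheme \<Rightarrow> 'd set set \<Rightarrow> nat \<Rightarrow> 'd set \<Rightarrow> 'd set" where
  "chamber_adj M Cs i C =
     (let C' = face M (oinv M (THE d. d \<in> C \<and> has_edge_type M i d))
      in if C' \<in> Cs then C' else C)"


subsection \<open>Application of lsp-operations\<close>

definition inner_darts :: "('d, 'z) lsp_scheme \<Rightarrow> 'd set" where
  "inner_darts Q = darts Q - outer Q"

text \<open>The oriented edges of the outer facial walk on its part from \<open>v\<^sub>a\<close> to \<open>v\<^sub>b\<close>, provided that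
  this part avoids \<open>v\<^sub>c\<close> (and the empty set otherwise).\<close>

definition outer_walk :: "('d, 'z) lsp_scheme \<Rightarrow> nat \<Rightarrow> nat \<Rightarrow> nat \<Rightarrow> 'd set" where
  "outer_walk Q a b c =
     {(face_next Q ^^ k) d | d k n.
        d \<in> outer Q \<and> vertex Q d = special Q a \<and> k < n \<and>
        vertex Q ((face_next Q ^^ n) d) = special Q b \<and>
        (\<forall>l\<le>n. vertex Q ((face_next Q ^^ l) d) \<noteq> special Q c)}"

text \<open>The edges (with both orientations) of the boundary path between the two special vertices
  other than \<open>v\<^sub>i\<close> that does not contain \<open>v\<^sub>i\<close>.\<close>

definition boundary_side :: "('d, 'z) lsp_scheme \<Rightarrow> nat \<Rightarrow> 'd set" where
  "boundary_side Q i =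
     (\<Union>(a, b) \<in> {(a, b). {a, b, i} = {0, 1, 2}}.
        outer_walk Q a b i \<union> oinv Q ` outer_walk Q a b i)"

text \<open>In the boundary of the union of the inner faces of \<open>Q\<close>, traversed with these
  faces to the left, \<open>v\<^sub>0, v\<^sub>1, v\<^sub>2\<close> appear in this cyclic order iff the outer
  facial walk, which traverses it in the opposite direction, goes from \<open>v\<^sub>1\<close> to \<open>v\<^sub>0\<close> without
  visiting \<open>v\<^sub>2\<close>. The chambers of a barycentric subdivision with this orientation are those
  whose facial walk goes from the 0-vertex directly to the 1-vertex.\<close>

definition lsp_orientation :: "('d, 'z) lsp_scheme \<Rightarrow> bool" where
  "lsp_orientation Q \<longleftrightarrow> outer_walk Q 1 0 2 \<noteq> {}"

definition chamber_orientation :: "('d, 'z) lemb_scheme \<Rightarrow> 'd set \<Rightarrow> bool" where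
  "chamber_orientation M C \<longleftrightarrow> (\<exists>d\<in>C. start_type M d = 0 \<and> end_type M d = 1)"

definition lsp_neighbour ::
  "('d, 'z) lsp_scheme \<Rightarrow> ('e, 'y) emb_scheme \<Rightarrow> ('e \<times> nat \<times> nat) set \<Rightarrow> 'd \<Rightarrow> ('e \<times> nat \<times> nat) set" where
  "lsp_neighbour Q G C d =
     (if \<exists>i<3. d \<in> boundary_side Q i
      then chamber_adj (barycentric G) (faces (barycentric G)) (THE i. i < 3 \<and> d \<in> boundary_side Q i) C
      else C)"

definition lsp_subdivision ::
  "('d, 'z) lsp_scheme \<Rightarrow> ('e, 'y) emb_scheme \<Rightarrow> (('e \<times> nat \<times> nat) set \<times> 'd) lemb" where
  "lsp_subdivision Q G =
     glue_copies Q (inner_darts Q) (faces (barycentric G))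
       (\<lambda>C. chamber_orientation (barycentric G) C \<longleftrightarrow> lsp_orientation Q)
       (lsp_neighbour Q G)"

definition apply_lsp ::
  "('d, 'z) lsp_scheme \<Rightarrow> ('e, 'y) emb_scheme \<Rightarrow> (('e \<times> nat \<times> nat) set \<times> 'd) emb" where
  "apply_lsp Q G = underlying_graph (lsp_subdivision Q G)"


subsection \<open>Application of lopsp-operations\<close>

text \<open>A cut-path is represented by the list of its oriented edges, directed from \<open>v\<^sub>1\<close> to \<open>v\<^sub>2\<close>.\<close>

definition cut_path :: "('d, 'z) lopsp_scheme \<Rightarrow> 'd list \<Rightarrow> bool" where
  "cut_path Q P \<longleftrightarrow>
     P \<noteq> [] \<and> set P \<subseteq> darts Q \<and>
     (\<forall>k. Suc k < length P \<longrightarrow> end_vertex Q (P ! k) = vertex Q (P ! Suc k)) \<and>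
     vertex Q (hd P) = special Q 1 \<and> end_vertex Q (last P) = special Q 2 \<and>
     special Q 0 \<in> vertex Q ` set P \<and>
     distinct (map (vertex Q) P @ [end_vertex Q (last P)])"

text \<open>\<open>cut_segment Q P a b\<close>: the oriented edges of \<open>P\<^bsub>v\<^sub>a,v\<^sub>b\<^esub>\<close>, directed from \<open>v\<^sub>a\<close> to \<open>v\<^sub>b\<close>,
  for \<open>{a, b} = {0, 1}\<close> and \<open>{a, b} = {0, 2}\<close>.\<close>

definition cut_segment :: "('d, 'z) lopsp_scheme \<Rightarrow> 'd list \<Rightarrow> nat \<Rightarrow> nat \<Rightarrow> 'd set" where
  "cut_segment Q P a b =
     (let A = set (takeWhile (\<lambda>d. vertex Q d \<noteq> special Q 0) P);
          B = set (dropWhile (\<lambda>d. vertex Q d \<noteq> special Q 0) P)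
      in if (a, b) = (1, 0) then A
         else if (a, b) = (0, 1) then oinv Q ` A
         else if (a, b) = (0, 2) then B
         else if (a, b) = (2, 0) then oinv Q ` B
         else {})"

text \<open>
  Traversed with the interior to its left, the boundary of the patch obtained by cutting along \<open>P\<close>
  consists of the paths \<open>v\<^sub>1 \<rightarrow> v\<^sub>0\<close>, \<open>v\<^sub>0 \<rightarrow> v\<^sub>2\<close>, \<open>v\<^sub>2 \<rightarrow> v\<^sub>0\<close>, \<open>v\<^sub>0 \<rightarrow> v\<^sub>1\<close>,
  the first two along \<open>P\<close> and the last two along its other copy. They replace
  the four edges in the facial walk of the double chamber \<open>\<delta>\<close>, which are, in this order, directed
  from type 1 to 0, from 0 to 2, from 2 to 0 and from 0 to 1.
\<close>

definition lopsp_neighbour ::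
  "('d, 'z) lopsp_scheme \<Rightarrow> 'd list \<Rightarrow> ('e, 'y) emb_scheme \<Rightarrow> ('e \<times> nat \<times> nat) set \<Rightarrow> 'd
     \<Rightarrow> ('e \<times> nat \<times> nat) set" where
  "lopsp_neighbour Q P G \<delta> d =
     (if \<exists>a b. d \<in> cut_segment Q P a b
      then face (double_chamber_system G)
             (oinv (double_chamber_system G)
               (THE x. x \<in> \<delta> \<and>
                  d \<in> cut_segment Q P (start_type (barycentric G) x) (end_type (barycentric G) x)))
      else \<delta>)"

definition lopsp_subdivision ::
  "('d, 'z) lopsp_scheme \<Rightarrow> 'd list \<Rightarrow> ('e, 'y) emb_scheme \<Rightarrow> (('e \<times> nat \<times> nat) set \<times> 'd) lemb" where
  "lopsp_subdivision Q P G =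
     glue_copies Q (darts Q) (faces (double_chamber_system G)) (\<lambda>\<delta>. True) (lopsp_neighbour Q P G)"

definition apply_lopsp ::
  "('d, 'z) lopsp_scheme \<Rightarrow> 'd list \<Rightarrow> ('e, 'y) emb_scheme \<Rightarrow> (('e \<times> nat \<times> nat) set \<times> 'd) emb" where
  "apply_lopsp Q P G = underlying_graph (lopsp_subdivision Q P G)"


subsection \<open>The lopsp-operation of an lsp-operation\<close>

text \<open>The copy \<open>True\<close> is \<open>Q\<close> without its outer face, the copy \<open>False\<close> is its mirror image; the
  oriented edges of both copies of a vertex on the boundary form a single vertex of the result.\<close>

definition lopsp_of_lsp :: "('d, 'z) lsp_scheme \<Rightarrow> (bool \<times> 'd) lopsp" where
  "lopsp_of_lsp Q =
     (let M = glue_copies Q (inner_darts Q) UNIV (\<lambda>x. x)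
                (\<lambda>x d. if d \<in> outer Q \<or> oinv Q d \<in> outer Q then \<not> x else x)
      in \<lparr> darts = darts M, oinv = oinv M, rot = rot M, vtype = vtype M,
           special = (\<lambda>i. {(x, d) \<in> darts M. d \<in> special Q i}) \<rparr>)"


section \<open>Delaney--Dress symbols\<close>

subsection \<open>The group \<open>\<Sigma>\<close>\<close>

text \<open>\<open>\<Sigma> = \<langle>\<sigma>\<^sub>0, \<sigma>\<^sub>1, \<sigma>\<^sub>2 | \<sigma>\<^sub>i\<^sup>2 = 1\<rangle>\<close>, a free product of three groups of order two, is represented by
  normal forms: the words over \<open>{0, 1, 2}\<close> without two equal consecutive letters.\<close>

fun sigma_cons :: "nat \<Rightarrow> nat list \<Rightarrow> nat list" where
  "sigma_cons i [] = [i]"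
| "sigma_cons i (j # w) = (if i = j then w else i # j # w)"

definition Sigma_group :: "nat list monoid" (\<open>\<Sigma>\<close>) where
  "\<Sigma> = \<lparr> carrier = {w. set w \<subseteq> {0, 1, 2} \<and> distinct_adj w},
         mult = (\<lambda>u v. foldr sigma_cons u v),
         one = [] \<rparr>"

abbreviation (input) sigma_gen :: "nat \<Rightarrow> nat list" (\<open>\<sigma>\<close>) where
  "\<sigma> i \<equiv> [i]"

lemma sigma_cons_reduced:
  assumes "distinct_adj w" shows "distinct_adj (sigma_cons i w)"
  using assms by (cases w) (auto simp: distinct_adj_Cons)

lemma sigma_cons_twice:
  assumes "distinct_adj w" shows "sigma_cons i (sigma_cons i w) = w"
  using assms by (cases w rule: remdups_adj.cases) (auto simp: distinct_adj_Cons)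

lemma foldr_sigma_cons_reduced:
  assumes "distinct_adj w" shows "distinct_adj (foldr sigma_cons u w)"
  using assms by (induction u) (auto intro: sigma_cons_reduced)

lemma foldr_sigma_cons_sigma_cons:
  assumes "distinct_adj w"
  shows "foldr sigma_cons (sigma_cons i x) w = sigma_cons i (foldr sigma_cons x w)"
  using assms by (cases x) (auto simp: sigma_cons_twice foldr_sigma_cons_reduced)

lemma foldr_sigma_cons_assoc:
  assumes "distinct_adj w"
  shows "foldr sigma_cons (foldr sigma_cons u v) w = foldr sigma_cons u (foldr sigma_cons v w)"
  using assms by (induction u) (auto simp: foldr_sigma_cons_sigma_cons)

lemma foldr_sigma_cons_Nil:
  assumes "distinct_adj w" shows "foldr sigma_cons w [] = w"
  using assms
proof (induction w)
  case (Cons i w)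
  then show ?case by (cases w) auto
qed auto

lemma foldr_sigma_cons_rev:
  assumes "distinct_adj v" shows "foldr sigma_cons (rev u) (foldr sigma_cons u v) = v"
  using assms by (induction u arbitrary: v) (auto simp: sigma_cons_twice foldr_sigma_cons_reduced)

lemma set_sigma_cons: "set (sigma_cons i w) \<subseteq> insert i (set w)"
  by (cases w) auto

lemma set_foldr_sigma_cons: "set (foldr sigma_cons u w) \<subseteq> set u \<union> set w"
proof (induction u)
  case (Cons i u)
  then show ?case using set_sigma_cons[of i "foldr sigma_cons u w"] by auto
qed auto

lemma group_Sigma: "group \<Sigma>"
proof (rule groupI)
  fix x y assume "x \<in> carrier \<Sigma>" "y \<in> carrier \<Sigma>"
  then show "x \<otimes>\<^bsub>\<Sigma>\<^esub> y \<in> carrier \<Sigma>"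
    using set_foldr_sigma_cons[of x y]
    by (auto simp: Sigma_group_def foldr_sigma_cons_reduced)
next
  fix x assume x: "x \<in> carrier \<Sigma>"
  have "foldr sigma_cons (rev x) x = []"
    using foldr_sigma_cons_rev[of "[]" x] foldr_sigma_cons_Nil[of x] x
    by (simp add: Sigma_group_def)
  moreover have "rev x \<in> carrier \<Sigma>" using x by (auto simp: Sigma_group_def)
  ultimately show "\<exists>y\<in>carrier \<Sigma>. y \<otimes>\<^bsub>\<Sigma>\<^esub> x = \<one>\<^bsub>\<Sigma>\<^esub>"
    by (intro bexI[of _ "rev x"]) (simp_all add: Sigma_group_def)
qed (auto simp: Sigma_group_def foldr_sigma_cons_assoc)


subsection \<open>Symbols and the tilings they encode\<close>

record 'c dd_symbol =
  chambers :: "'c set"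
  sigma_act :: "nat \<Rightarrow> 'c \<Rightarrow> 'c"
  dd_m :: "nat \<Rightarrow> nat \<Rightarrow> 'c \<Rightarrow> nat"

definition dihedral_orbit_size :: "(nat \<Rightarrow> 'c \<Rightarrow> 'c) \<Rightarrow> nat \<Rightarrow> nat \<Rightarrow> 'c \<Rightarrow> nat" where
  "dihedral_orbit_size act i j C =
     card {D. (C, D) \<in> {(A, act k A) | A k. k \<in> {i, j}}\<^sup>*}"

definition opposite_vertex :: "('d, 'z) lemb_scheme \<Rightarrow> nat \<Rightarrow> nat \<Rightarrow> 'd set \<Rightarrow> 'd set" where
  "opposite_vertex M i j C =
     (THE v. v \<in> vertices M \<and> v \<inter> C \<noteq> {} \<and> vtype M v \<notin> {i, j})"

text \<open>Around a vertex that is not in the outer face chambers of both orientations alternate, so that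
  the orbit size \<open>n\<close> is even and \<open>n div 2\<close> is exact.\<close>

definition dd_lsp :: "('d, 'z) lsp_scheme \<Rightarrow> 'd set dd_symbol" where
  "dd_lsp Q =
     (let Cs = faces Q - {outer Q}; act = chamber_adj Q Cs in
      \<lparr> chambers = Cs, sigma_act = act,
        dd_m = (\<lambda>i j C.
          let n = dihedral_orbit_size act i j C; v = opposite_vertex Q i j C in
          if v = special Q 1 then 2 * n
          else if v = special Q 0 then 3 * n
          else if v = special Q 2 then 6 * n
          else if v \<inter> outer Q = {} then n div 2
          else n) \<rparr>)"

definition dd_lopsp :: "('d, 'z) lopsp_scheme \<Rightarrow> 'd set dd_symbol" where
  "dd_lopsp Q =
     (let Cs = faces Q; act = chamber_adj Q Cs in
      \<lparr> chambers = Cs, sigma_act = act,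
        dd_m = (\<lambda>i j C.
          let n = dihedral_orbit_size act i j C; v = opposite_vertex Q i j C in
          n div 2 * (if v = special Q 1 then 2
                     else if v = special Q 0 then 3
                     else if v = special Q 2 then 6
                     else 1)) \<rparr>)"

definition act_word :: "'c dd_symbol \<Rightarrow> 'c \<Rightarrow> nat list \<Rightarrow> 'c" where
  "act_word D C w = foldl (\<lambda>A i. sigma_act D i A) C w"

definition tiling_subgroup :: "'c dd_symbol \<Rightarrow> 'c \<Rightarrow> nat list set" where
  "tiling_subgroup D C =
     generate \<Sigma>
       {w \<otimes>\<^bsub>\<Sigma>\<^esub> (\<sigma> i \<otimes>\<^bsub>\<Sigma>\<^esub> \<sigma> j) [^]\<^bsub>\<Sigma>\<^esub> (dd_m D i j (act_word D C w)) \<otimes>\<^bsub>\<Sigma>\<^esub> inv\<^bsub>\<Sigma>\<^esub> w | w i j.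
          w \<in> carrier \<Sigma> \<and> i < j \<and> j < 3}"

definition tiling_chambers :: "'c dd_symbol \<Rightarrow> 'c \<Rightarrow> nat list set set" where
  "tiling_chambers D C = rcosets\<^bsub>\<Sigma>\<^esub> (tiling_subgroup D C)"

text \<open>\<open>\<Sigma>\<close> acts on the chambers \<open>Nw\<close> of a tiling by right multiplication.\<close>

definition isomorphic_tilings :: "nat list set set \<Rightarrow> nat list set set \<Rightarrow> bool" where
  "isomorphic_tilings T T' \<longleftrightarrow>
     (\<exists>f. bij_betw f T T' \<and>
          (\<forall>X\<in>T. \<forall>g\<in>carrier \<Sigma>. f (X #>\<^bsub>\<Sigma>\<^esub> g) = f X #>\<^bsub>\<Sigma>\<^esub> g))"

end

theory Submission
  imports Defs
begin

text \<open>
  Both results of applying the operations are coverings of the double \<open>M\<close> of \<open>O\<close>, branched at the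
  special vertices, and each is given by the permutation of (double) chambers for the crossing of every
  edge of \<open>M\<close>: for \<open>O\<close> the reflection \<open>\<sigma>\<^sub>i\<close> if the edge is on the side opposite to \<open>v\<^sub>i\<close> of the outer
  face, and for a cut-path a rotation \<open>\<sigma>\<^sub>0\<sigma>\<^sub>2\<close> or \<open>\<sigma>\<^sub>0\<sigma>\<^sub>1\<close>, or its inverse, if the edge is on the path.
  Hence it suffices that the two cocycles with values in the free product \<open>\<langle>\<sigma>\<^sub>0, \<sigma>\<^sub>1, \<sigma>\<^sub>2 | \<sigma>\<^sub>i\<^sup>2 = 1\<rangle>\<close> are
  cohomologous. The first one is flat off the special vertices. As \<open>M\<close> is plane, it is cohomologous to a
  cocycle that is trivial off the cut-path, and this one is constant along each half of the path. Its
  holonomies at the special vertices determine the two constants up to conjugation, which in the free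
  product is only possible for simultaneous conjugates of \<open>\<sigma>\<^sub>0\<sigma>\<^sub>2\<close> and \<open>\<sigma>\<^sub>0\<sigma>\<^sub>1\<close>.

  For the tilings, the projection of the chambers of \<open>M\<close> to those of \<open>O\<close> commutes with \<open>\<Sigma>\<close> and
  preserves the numbers \<open>m\<^sub>i\<^sub>j\<close>, since the orbits around the vertices of the outer face double in size.
\<close>

section \<open>Orbits of a bijection of a finite set\<close>

text \<open>The obstacle is that the cut-path is arbitrary. It need not follow the cycle along which
  the two copies of \<open>O\<close> meet, so double chambers cannot simply be matched with pairs of
  filled chambers. The two gluings are instead related by a word for each face of the double: a face
  glued into the chamber \<open>C\<close> goes to the double chamber that contains \<open>C\<close>
  moved by this word. A double chamber is represented by its only positively oriented chamber.
  Passing to its 0-neighbour and then across a 2-edge or a 1-edge leads to the representative of an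
  adjacent double chamber; this is the origin of the two rotations. Since only positive chambers
  represent double chambers, the words must have the right parity on each copy, and every
  conjugating word is therefore controlled modulo 2. The comparison is made once with abstract
  words, where reduced forms are available, and only at the end do these words act on the chambers
  of \<open>G\<close>. Two-connectedness makes the outer facial walk a simple cycle, so that a
  vertex of the outer face meets exactly two crossings and its holonomy is a product of two
  reflections.\<close>

locale finite_bij =
  fixes f :: "'a \<Rightarrow> 'a" and S :: "'a set"
  assumes finite_S: "finite S" and bij: "bij_betw f S S"
begin

lemma f_in: "x \<in> S \<Longrightarrow> f x \<in> S"
  using bij by (auto simp: bij_betw_def)

lemma funpow_in: "x \<in> S \<Longrightarrow> (f ^^ n) x \<in> S"
  by (induction n) (auto simp: f_in)

lemma f_eq_iff: "x \<in> S \<Longrightarrow> y \<in> S \<Longrightarrow> f x = f y \<longleftrightarrow> x = y"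
  using bij by (auto simp: bij_betw_def inj_on_def)

lemma inv_into_in: "x \<in> S \<Longrightarrow> inv_into S f x \<in> S"
  using bij by (metis bij_betw_def inv_into_into)

lemma f_inv_into: "x \<in> S \<Longrightarrow> f (inv_into S f x) = x"
  using bij by (metis bij_betw_def f_inv_into_f)

lemma inv_into_f: "x \<in> S \<Longrightarrow> inv_into S f (f x) = x"
  using bij by (metis bij_betw_def inv_into_f_f)

lemma self_in_orbit: "x \<in> S \<Longrightarrow> x \<in> orbit f x"
proof -
  assume x: "x \<in> S"
  \<comment> \<open>Outside \<open>S\<close> nothing is known of \<open>f\<close>; \<open>p\<close>
    agrees with it on \<open>S\<close> and is a permutation of the whole type.\<close>
  define p where "p = (\<lambda>y. if y \<in> S then f y else y)"
  have "bij_betw p S S"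
    using bij by (rule bij_betw_cong[THEN iffD1, rotated]) (auto simp: p_def)
  then have "p permutes S" by (rule bij_imp_permutes) (auto simp: p_def)
  then have "permutation p" using finite_S by (auto simp: permutation_permutes)
  then have "x \<in> orbit p x" by (rule permutation_self_in_orbit)
  moreover have "orbit f x = orbit p x"
    using x by (rule orbit_cong0) (auto simp: p_def f_in)
  ultimately show ?thesis by simp
qed

lemma orbit_subset_S: "x \<in> S \<Longrightarrow> orbit f x \<subseteq> S"
  by (auto simp: orbit_altdef funpow_in)

lemma orbit_in_S: "y \<in> orbit f x \<Longrightarrow> x \<in> S \<Longrightarrow> y \<in> S"
  using orbit_subset_S by auto

lemma finite_orbit: "x \<in> S \<Longrightarrow> finite (orbit f x)"
  by (rule finite_subset[OF orbit_subset_S finite_S])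

lemma card_orbit_pos: "x \<in> S \<Longrightarrow> 0 < card (orbit f x)"
  using finite_orbit self_in_orbit by (auto simp: card_gt_0_iff)

lemma orbit_eqI: "x \<in> S \<Longrightarrow> y \<in> orbit f x \<Longrightarrow> orbit f y = orbit f x"
  using orbit_swap[OF self_in_orbit, of x y] orbit_trans[of _ f y x] orbit_trans[of _ f x y] by blast

lemma orbit_eq_iff: "x \<in> S \<Longrightarrow> y \<in> S \<Longrightarrow> orbit f x = orbit f y \<longleftrightarrow> x \<in> orbit f y"
  using orbit_eqI[of y x] self_in_orbit[of x] by blast

lemma orbit_f: "x \<in> S \<Longrightarrow> orbit f (f x) = orbit f x"
  by (rule orbit_eqI) (auto intro: orbit.base)

lemma orbit_funpow: "x \<in> S \<Longrightarrow> orbit f ((f ^^ n) x) = orbit f x"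
  by (induction n) (auto simp: orbit_f funpow_in)

lemma f_in_orbit_iff: "x \<in> S \<Longrightarrow> f x \<in> orbit f y \<longleftrightarrow> x \<in> orbit f y" if "y \<in> S"
  using that orbit_f[of x] orbit_eq_iff[of x y] orbit_eq_iff[of "f x" y] f_in[of x] by simp

lemma orbit_period:
  assumes "x \<in> S"
  shows "(f ^^ card (orbit f x)) x = x"
    and "inj_on (\<lambda>i. (f ^^ i) x) {..<card (orbit f x)}"
    and "orbit f x = (\<lambda>i. (f ^^ i) x) ` {..<card (orbit f x)}"
proof -
  define n where "n = funpow_dist1 f x x"
  have x: "x \<in> orbit f x" using assms by (rule self_in_orbit)
  have 1: "inj_on (\<lambda>i. (f ^^ i) x) {0..<n}" unfolding n_def using x by (rule inj_on_funpow_dist1)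
  have 2: "orbit f x = (\<lambda>i. (f ^^ i) x) ` {0..<n}" unfolding n_def using x by (rule orbit_conv_funpow_dist1)
  have "card (orbit f x) = n" unfolding 2 using 1 by (simp add: card_image)
  moreover have "(f ^^ n) x = x" unfolding n_def using x by (rule funpow_dist1_prop)
  ultimately show "(f ^^ card (orbit f x)) x = x"
    "inj_on (\<lambda>i. (f ^^ i) x) {..<card (orbit f x)}"
    "orbit f x = (\<lambda>i. (f ^^ i) x) ` {..<card (orbit f x)}"
    using 1 2 by (auto simp: lessThan_atLeast0)
qed

lemma funpow_ne: "x \<in> S \<Longrightarrow> 0 < i \<Longrightarrow> i < card (orbit f x) \<Longrightarrow> (f ^^ i) x \<noteq> x"
  using inj_onD[OF orbit_period(2)[of x], of i 0] by auto

lemma orbitE_funpow: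
  assumes "x \<in> S" "y \<in> orbit f x"
  obtains i where "i < card (orbit f x)" "y = (f ^^ i) x"
  using assms orbit_period(3)[of x] by blast

text \<open>The way round the cycle from \<open>f x\<close> back to \<open>x\<close> uses every step
  except the one at \<open>x\<close>. Applied to rotations, it replaces one crossing at a vertex by
  all the others.\<close>

lemma orbit_const_except:
  assumes "x \<in> S" and "\<And>y. y \<in> orbit f x \<Longrightarrow> y \<noteq> x \<Longrightarrow> g (f y) = g y"
  shows "g (f x) = g x"
proof -
  have *: "Suc i \<le> card (orbit f x) \<Longrightarrow> g ((f ^^ Suc i) x) = g (f x)" for i
  proof (induction i)
    case (Suc i)
    have "(f ^^ Suc i) x \<in> orbit f x"
      using assms(1) self_in_orbit funpow_in_orbit by metis
    moreover have "(f ^^ Suc i) x \<noteq> x" using Suc.prems assms(1) by (intro funpow_ne) auto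
    ultimately have "g (f ((f ^^ Suc i) x)) = g ((f ^^ Suc i) x)" by (rule assms(2))
    with Suc show ?case by simp
  qed simp
  show ?thesis
    using *[of "card (orbit f x) - 1"] card_orbit_pos[OF assms(1)] orbit_period(1)[OF assms(1)] by simp
qed

lemma orbit_induct_f [consumes 2, case_names self step]:
  assumes "x \<in> S" "y \<in> orbit f x" and "P x" and "\<And>y. y \<in> orbit f x \<Longrightarrow> P y \<Longrightarrow> P (f y)"
  shows "P y"
  using assms(2)
proof induction
  case base
  then show ?case using assms(3,4) self_in_orbit[OF assms(1)] by blast
next
  case (step y)
  then show ?case using assms(4) by blast
qed

end

section \<open>Sums along orbits with values in a non-commutative group\<close>

primrec path_sum :: "('a \<Rightarrow> 'a) \<Rightarrow> ('a \<Rightarrow> 'g::group_add) \<Rightarrow> 'a \<Rightarrow> nat \<Rightarrow> 'g" where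
  "path_sum f c x 0 = 0"
| "path_sum f c x (Suc m) = path_sum f c x m + c ((f ^^ m) x)"

text \<open>This is the monodromy of the cochain \<open>c\<close> around a vertex or face. The class
  \<open>group_add\<close> is not commutative, so a change of the starting point conjugates the
  value.\<close>

definition holonomy :: "('a \<Rightarrow> 'a) \<Rightarrow> ('a \<Rightarrow> 'g::group_add) \<Rightarrow> 'a \<Rightarrow> 'g" where
  "holonomy f c x = path_sum f c x (card (orbit f x))"

lemma path_sum_add: "path_sum f c x (j + m) = path_sum f c x j + path_sum f c ((f ^^ j) x) m"
proof (induction m)
  case (Suc m)
  have "(f ^^ (j + m)) x = (f ^^ m) ((f ^^ j) x)" by (metis add.commute comp_apply funpow_add)
  then show ?case using Suc by (simp add: add.assoc)
qed simp

text \<open>Telescoping: the \<open>h\<close> at the end of each step cancels the \<open>- h\<close>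
  at the start of the next one.\<close>

lemma path_sum_gauge:
  assumes "\<And>i. i < m \<Longrightarrow> c' ((f ^^ i) x) = - h ((f ^^ i) x) + c ((f ^^ i) x) + h (f ((f ^^ i) x))"
  shows "path_sum f c' x m = - h x + path_sum f c x m + h ((f ^^ m) x)"
  using assms by (induction m) (auto simp: add.assoc)

context finite_bij
begin

lemma holonomy_gauge:
  assumes "x \<in> S" and "\<And>y. y \<in> orbit f x \<Longrightarrow> c' y = - h y + c y + h (f y)"
  shows "holonomy f c' x = - h x + holonomy f c x + h x"
  unfolding holonomy_def
  using path_sum_gauge[of "card (orbit f x)" c' f x h c] assms orbit_period(1)[OF assms(1)]
    funpow_in_orbit[OF self_in_orbit[OF assms(1)]]
  by simp

text \<open>The walk that goes \<open>j\<close> steps and then once round is also the walk that goes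
  once round and then \<open>j\<close> steps; comparing the two sums gives the conjugation.\<close>

lemma holonomy_conj:
  assumes "x \<in> S"
  shows "holonomy f c ((f ^^ j) x) = - path_sum f c x j + holonomy f c x + path_sum f c x j"
proof -
  let ?n = "card (orbit f x)"
  have "path_sum f c x (?n + j) = path_sum f c x (j + ?n)" by (simp add: add.commute)
  then have "path_sum f c x j + holonomy f c ((f ^^ j) x) = holonomy f c x + path_sum f c x j"
    unfolding path_sum_add holonomy_def orbit_funpow[OF assms] orbit_period(1)[OF assms] by simp
  then show ?thesis by (metis add.assoc minus_add_cancel)
qed

lemma holonomy_eq_single:
  assumes "x \<in> S" and "\<And>y. y \<in> orbit f x \<Longrightarrow> y \<noteq> x \<Longrightarrow> c y = 0"
  shows "holonomy f c x = c x"
proof -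
  have "Suc i \<le> card (orbit f x) \<Longrightarrow> path_sum f c x (Suc i) = c x" for i
  proof (induction i)
    case (Suc i)
    have "(f ^^ Suc i) x \<in> orbit f x"
      using assms(1) self_in_orbit funpow_in_orbit by metis
    moreover have "(f ^^ Suc i) x \<noteq> x" using Suc.prems assms(1) by (intro funpow_ne) auto
    ultimately have "c ((f ^^ Suc i) x) = 0" by (rule assms(2))
    with Suc show ?case by simp
  qed simp
  from this[of "card (orbit f x) - 1"] show ?thesis
    unfolding holonomy_def using card_orbit_pos[OF assms(1)] by simp
qed

lemma holonomy_eq_pair:
  assumes "x \<in> S" and "z \<in> orbit f x" "z \<noteq> x"
    and "\<And>y. y \<in> orbit f x \<Longrightarrow> y \<noteq> x \<Longrightarrow> y \<noteq> z \<Longrightarrow> c y = 0"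
  shows "holonomy f c x = c x + c z"
proof -
  obtain j where j: "j < card (orbit f x)" "z = (f ^^ j) x" using assms(1,2) by (rule orbitE_funpow)
  then have j0: "j \<noteq> 0" using assms(3) by (metis funpow_0)
  have "Suc i \<le> card (orbit f x) \<Longrightarrow> path_sum f c x (Suc i) = (if Suc i \<le> j then c x else c x + c z)" for i
  proof (induction i)
    case (Suc i)
    have 1: "(f ^^ Suc i) x \<in> orbit f x"
      using assms(1) self_in_orbit funpow_in_orbit by metis
    have 2: "(f ^^ Suc i) x \<noteq> x" using Suc.prems assms(1) by (intro funpow_ne) auto
    have 3: "(f ^^ Suc i) x = z \<longleftrightarrow> Suc i = j"
      using orbit_period(2)[OF assms(1)] Suc.prems j unfolding inj_on_def by auto
    show ?case
    proof (cases "Suc i = j")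
      case True
      then show ?thesis using Suc 3 by simp
    next
      case False
      then have "c ((f ^^ Suc i) x) = 0" using 1 2 3 assms(4) by blast
      then have "path_sum f c x (Suc (Suc i)) = path_sum f c x (Suc i)" by simp
      moreover have "Suc (Suc i) \<le> j \<longleftrightarrow> Suc i \<le> j" using False by auto
      ultimately show ?thesis using Suc by (simp del: path_sum.simps)
    qed
  qed (use j0 in auto)
  from this[of "card (orbit f x) - 1"] show ?thesis
    unfolding holonomy_def using card_orbit_pos[OF assms(1)] j by simp
qed

end

section \<open>Trees in embedded graphs\<close>

text \<open>Connectedness is left out: the double is first shown to satisfy only these axioms, and
  its connectedness is derived with their help.\<close>

locale emap =
  fixes M :: "('d, 'z) emb_scheme"
  assumes finite_darts: "finite (darts M)"
    and oinv_in: "d \<in> darts M \<Longrightarrow> oinv M d \<in> darts M"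
    and oinv_ne: "d \<in> darts M \<Longrightarrow> oinv M d \<noteq> d"
    and oinv_oinv: "d \<in> darts M \<Longrightarrow> oinv M (oinv M d) = d"
    and rot_bij: "bij_betw (rot M) (darts M) (darts M)"
begin

lemma oinv_bij: "bij_betw (oinv M) (darts M) (darts M)"
  by (rule bij_betwI[where g = "oinv M"]) (auto simp: oinv_in oinv_oinv)

lemma face_next_bij: "bij_betw (face_next M) (darts M) (darts M)"
proof -
  have "face_next M = rot M \<circ> oinv M" by (auto simp: face_next_def)
  then show ?thesis using bij_betw_trans[OF oinv_bij rot_bij] by simp
qed

sublocale rot: finite_bij "rot M" "darts M"
  by unfold_locales (auto simp: finite_darts rot_bij)

sublocale fn: finite_bij "face_next M" "darts M"
  by unfold_locales (auto simp: finite_darts face_next_bij)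

lemma rot_eq: "d \<in> darts M \<Longrightarrow> rot M d = face_next M (oinv M d)"
  by (simp add: face_next_def oinv_oinv)

lemma vertex_eq_iff: "d \<in> darts M \<Longrightarrow> e \<in> darts M \<Longrightarrow> vertex M d = vertex M e \<longleftrightarrow> d \<in> vertex M e"
  unfolding vertex_def by (rule rot.orbit_eq_iff)

lemma face_eq_iff: "d \<in> darts M \<Longrightarrow> e \<in> darts M \<Longrightarrow> face M d = face M e \<longleftrightarrow> d \<in> face M e"
  unfolding face_def by (rule fn.orbit_eq_iff)

lemma vertex_self: "d \<in> darts M \<Longrightarrow> d \<in> vertex M d"
  unfolding vertex_def by (rule rot.self_in_orbit)

lemma face_self: "d \<in> darts M \<Longrightarrow> d \<in> face M d"
  unfolding face_def by (rule fn.self_in_orbit)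

lemma vertex_rot: "d \<in> darts M \<Longrightarrow> vertex M (rot M d) = vertex M d"
  unfolding vertex_def by (rule rot.orbit_f)

lemma face_face_next: "d \<in> darts M \<Longrightarrow> face M (face_next M d) = face M d"
  unfolding face_def by (rule fn.orbit_f)

lemma face_rot: "d \<in> darts M \<Longrightarrow> face M (rot M d) = face M (oinv M d)"
  by (simp add: rot_eq face_face_next oinv_in)

lemma vertex_face_next: "d \<in> darts M \<Longrightarrow> vertex M (face_next M d) = end_vertex M d"
  by (simp add: face_next_def vertex_rot oinv_in end_vertex_def)

lemma end_vertex_oinv: "d \<in> darts M \<Longrightarrow> end_vertex M (oinv M d) = vertex M d"
  by (simp add: end_vertex_def oinv_oinv)

lemma vertex_subset: "d \<in> darts M \<Longrightarrow> vertex M d \<subseteq> darts M"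
  unfolding vertex_def by (rule rot.orbit_subset_S)

lemma face_subset: "d \<in> darts M \<Longrightarrow> face M d \<subseteq> darts M"
  unfolding face_def by (rule fn.orbit_subset_S)

lemma verticesE:
  assumes "v \<in> vertices M"
  obtains d where "d \<in> darts M" "v = vertex M d"
  using assms by (auto simp: vertices_def)

lemma vertex_in_vertices: "d \<in> darts M \<Longrightarrow> vertex M d \<in> vertices M"
  by (auto simp: vertices_def)

lemma end_vertex_in_vertices: "d \<in> darts M \<Longrightarrow> end_vertex M d \<in> vertices M"
  by (auto simp: vertices_def end_vertex_def oinv_in)

lemma face_in_faces: "d \<in> darts M \<Longrightarrow> face M d \<in> faces M"
  by (auto simp: faces_def)

lemma vertex_eqI: "v \<in> vertices M \<Longrightarrow> d \<in> v \<Longrightarrow> vertex M d = v"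
  by (metis verticesE vertex_def rot.orbit_eqI)

lemma face_eqI: "C \<in> faces M \<Longrightarrow> d \<in> C \<Longrightarrow> face M d = C"
  by (auto simp: faces_def face_def fn.orbit_eqI)

lemma vertices_subset: "v \<in> vertices M \<Longrightarrow> v \<subseteq> darts M"
  using vertex_subset by (auto simp: vertices_def)

lemma faces_subset: "C \<in> faces M \<Longrightarrow> C \<subseteq> darts M"
  using face_subset by (auto simp: faces_def)

lemma vertices_nonempty: "v \<in> vertices M \<Longrightarrow> v \<noteq> {}"
  using vertex_self by (auto simp: vertices_def)

lemma faces_nonempty: "C \<in> faces M \<Longrightarrow> C \<noteq> {}"
  using face_self by (auto simp: faces_def)

lemma finite_vertices: "finite (vertices M)"
  by (simp add: vertices_def finite_darts)

lemma finite_faces: "finite (faces M)"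
  by (simp add: faces_def finite_darts)

lemma card_edges: "2 * card (edges M) = card (darts M)"
proof -
  have U: "\<Union>(edges M) = darts M" by (auto simp: edges_def oinv_in)
  have "2 * card (edges M) = card (\<Union>(edges M))"
  proof (rule card_partition)
    show "finite (edges M)" by (simp add: edges_def finite_darts)
    show "finite (\<Union>(edges M))" unfolding U by (rule finite_darts)
    show "card c = 2" if "c \<in> edges M" for c
      using that oinv_ne by (fastforce simp: edges_def)
    have "c = {x, oinv M x}" if "c \<in> edges M" "x \<in> c" for c x
      using that by (auto simp: edges_def oinv_oinv)
    then show "c1 \<inter> c2 = {}" if "c1 \<in> edges M" "c2 \<in> edges M" "c1 \<noteq> c2" for c1 c2
      using that by blast
  qed
  then show ?thesis by (simp add: U)
qed

end

text \<open>Faces become vertices. Duality turns every result on trees and cochains into one with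
  vertices and faces exchanged.\<close>

definition dual_map :: "('d, 'z) emb_scheme \<Rightarrow> 'd emb" where
  "dual_map M = \<lparr> darts = darts M, oinv = oinv M, rot = face_next M \<rparr>"

text \<open>The graph whose edges are those in \<open>E\<close> is connected; \<open>A\<close> is a union of vertices.\<close>

definition connected_via :: "('d, 'z) emb_scheme \<Rightarrow> 'd set \<Rightarrow> bool" where
  "connected_via M E \<longleftrightarrow>
     (\<forall>A. (\<forall>e\<in>darts M. rot M e \<in> A \<longleftrightarrow> e \<in> A) \<longrightarrow> (\<forall>e\<in>E. oinv M e \<in> A \<longleftrightarrow> e \<in> A) \<longrightarrow>
        darts M \<inter> A = {} \<or> darts M \<subseteq> A)"

text \<open>A tree grown by leaves, with both orientations of its edges in \<open>T\<close>; the
  dart \<open>d\<close> starts at the new leaf. The starting pair is arbitrary so that a spanning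
  tree can extend a given path.\<close>

inductive grows :: "('d, 'z) emb_scheme \<Rightarrow> 'd set \<Rightarrow> 'd set set \<Rightarrow> 'd set \<Rightarrow> 'd set set \<Rightarrow> 'd set \<Rightarrow> bool"
  for M E U0 T0 where
  grows_refl: "grows M E U0 T0 U0 T0"
| grows_step: "grows M E U0 T0 U T \<Longrightarrow> d \<in> E \<Longrightarrow> vertex M d \<notin> U \<Longrightarrow> end_vertex M d \<in> U \<Longrightarrow>
    grows M E U0 T0 (insert (vertex M d) U) (insert d (insert (oinv M d) T))"

lemma grows_trans:
  assumes "grows M E U1 T1 U2 T2" "grows M E U0 T0 U1 T1"
  shows "grows M E U0 T0 U2 T2"
  using assms by induction (auto intro: grows.intros)

context emap
begin

lemma emap_dual_map: "emap (dual_map M)"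
  by unfold_locales (auto simp: dual_map_def finite_darts oinv_in oinv_ne oinv_oinv face_next_bij)

lemma dual_map_simps [simp]:
  "darts (dual_map M) = darts M" "oinv (dual_map M) = oinv M" "rot (dual_map M) = face_next M"
  "vertex (dual_map M) d = face M d" "vertices (dual_map M) = faces M"
  by (auto simp: dual_map_def vertex_def face_def vertices_def faces_def)

lemma end_vertex_dual_map: "end_vertex (dual_map M) d = face M (oinv M d)"
  by (simp add: end_vertex_def)

text \<open>In the dual, \<open>face_next\<close> applies \<open>oinv\<close> twice before
  \<open>rot\<close>, so it is the original rotation.\<close>

lemma face_dual_map: "d \<in> darts M \<Longrightarrow> face (dual_map M) d = vertex M d"
  unfolding face_def vertex_def
  by (rule orbit_cong0[where A = "darts M"])
    (auto simp: face_next_def oinv_in oinv_oinv rot.f_in)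

lemma faces_dual_map: "faces (dual_map M) = vertices M"
  by (simp add: faces_def vertices_def face_dual_map)

lemma in_Union_vertices: "U \<subseteq> vertices M \<Longrightarrow> d \<in> darts M \<Longrightarrow> d \<in> \<Union>U \<longleftrightarrow> vertex M d \<in> U"
  using vertex_eqI vertex_self by blast

lemma connected_on_closed:
  assumes "connected_on M W" and "u \<in> W" "v \<in> W" and "P u"
    and "\<And>d. d \<in> darts M \<Longrightarrow> vertex M d \<in> W \<Longrightarrow> end_vertex M d \<in> W \<Longrightarrow> P (vertex M d) \<Longrightarrow> P (end_vertex M d)"
  shows "P v"
proof -
  have "(u, v) \<in> {(vertex M d, end_vertex M d) | d.
                    d \<in> darts M \<and> vertex M d \<in> W \<and> end_vertex M d \<in> W}\<^sup>*"
    using assms(1-3) by (auto simp: connected_on_def)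
  then show ?thesis using assms(4) by induction (auto intro: assms(5))
qed

text \<open>Reachability from \<open>u\<close> is itself such a property \<open>P\<close>; it is
  symmetric because every edge has both orientations.\<close>

lemma connected_onI:
  assumes "W \<subseteq> vertices M"
    and "\<And>P u v. u \<in> W \<Longrightarrow> v \<in> W \<Longrightarrow> P u \<Longrightarrow>
      (\<And>d. d \<in> darts M \<Longrightarrow> vertex M d \<in> W \<Longrightarrow> end_vertex M d \<in> W \<Longrightarrow>
         P (vertex M d) \<longleftrightarrow> P (end_vertex M d)) \<Longrightarrow> P v"
  shows "connected_on M W"
  unfolding connected_on_def
proof (intro ballI)
  fix u v assume u: "u \<in> W" and v: "v \<in> W"
  let ?R = "{(vertex M d, end_vertex M d) | d.
                    d \<in> darts M \<and> vertex M d \<in> W \<and> end_vertex M d \<in> W}"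
  show "(u, v) \<in> ?R\<^sup>*"
  proof (rule assms(2)[OF u v, where P = "\<lambda>w. (u, w) \<in> ?R\<^sup>*"])
    fix d assume d: "d \<in> darts M" "vertex M d \<in> W" "end_vertex M d \<in> W"
    then have 1: "(vertex M d, end_vertex M d) \<in> ?R" by blast
    have "oinv M d \<in> darts M" "vertex M (oinv M d) = end_vertex M d"
      "end_vertex M (oinv M d) = vertex M d"
      using d by (auto simp: oinv_in end_vertex_def oinv_oinv)
    then have 2: "(end_vertex M d, vertex M d) \<in> ?R" using d by force
    show "(u, vertex M d) \<in> ?R\<^sup>* \<longleftrightarrow> (u, end_vertex M d) \<in> ?R\<^sup>*"
      using 1 2 by (meson rtrancl.rtrancl_into_rtrancl)
  qed simp
qed

text \<open>A set closed under the rotation is a union of vertices, hence the same thing as a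
  property of vertices.\<close>

lemma connected_via_iff: "connected_via M (darts M) \<longleftrightarrow> connected_on M (vertices M)"
proof
  assume *: "connected_via M (darts M)"
  show "connected_on M (vertices M)"
  proof (rule connected_onI)
    fix P u v
    assume u: "u \<in> vertices M" and v: "v \<in> vertices M" and P: "P u"
      and step: "\<And>d. d \<in> darts M \<Longrightarrow> vertex M d \<in> vertices M \<Longrightarrow> end_vertex M d \<in> vertices M \<Longrightarrow>
         P (vertex M d) \<longleftrightarrow> P (end_vertex M d)"
    let ?A = "{d. P (vertex M d)}"
    have "darts M \<inter> ?A = {} \<or> darts M \<subseteq> ?A"
    proof (rule *[unfolded connected_via_def, rule_format])
      show "rot M e \<in> ?A \<longleftrightarrow> e \<in> ?A" if "e \<in> darts M" for e
        using that by (simp add: vertex_rot)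
      show "oinv M e \<in> ?A \<longleftrightarrow> e \<in> ?A" if "e \<in> darts M" for e
        using step[OF that] that by (simp add: vertex_in_vertices end_vertex_in_vertices flip: end_vertex_def)
    qed
    then show "P v" using P u v by (auto elim!: verticesE)
  qed simp
next
  assume *: "connected_on M (vertices M)"
  show "connected_via M (darts M)"
    unfolding connected_via_def
  proof (intro allI impI)
    fix A
    assume r: "\<forall>e\<in>darts M. rot M e \<in> A \<longleftrightarrow> e \<in> A" and o: "\<forall>e\<in>darts M. oinv M e \<in> A \<longleftrightarrow> e \<in> A"
    have v: "e \<in> A \<longleftrightarrow> d \<in> A" if "d \<in> darts M" "e \<in> vertex M d" for d e
      using that unfolding vertex_def
    proof (induction rule: rot.orbit_induct_f)
      case (step y)
      then show ?case using r rot.orbit_in_S[OF step.hyps that(1)] by blast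
    qed simp
    have "e \<in> A" if "d \<in> darts M" "e \<in> darts M" "d \<in> A" for d e
    proof -
      have "\<forall>e\<in>vertex M e. e \<in> A"
      proof (rule connected_on_closed[OF *, where u = "vertex M d" and P = "\<lambda>v. \<forall>e\<in>v. e \<in> A"])
        show "vertex M d \<in> vertices M" "vertex M e \<in> vertices M"
          using that by (auto simp: vertex_in_vertices)
        show "\<forall>e\<in>vertex M d. e \<in> A" using v that by blast
        fix c assume c: "c \<in> darts M" "\<forall>e\<in>vertex M c. e \<in> A"
        then have "oinv M c \<in> A" using vertex_self o by blast
        then show "\<forall>e\<in>end_vertex M c. e \<in> A"
          using v c oinv_in unfolding end_vertex_def by blast
      qed
      then show ?thesis using vertex_self that by blast
    qed
    then show "darts M \<inter> A = {} \<or> darts M \<subseteq> A" by blast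
  qed
qed

text \<open>Each leaf contributes one vertex and two darts. The last equation is the edge count of a
  tree, which later meets Euler's formula.\<close>

lemma grows_invariant:
  assumes "grows M E {v} {} U T" "E \<subseteq> darts M" "v \<in> vertices M"
  shows "U \<subseteq> vertices M" "T \<subseteq> E \<union> oinv M ` E" "T \<subseteq> darts M" "v \<in> U"
    "\<And>e. e \<in> T \<Longrightarrow> vertex M e \<in> U" "\<And>e. e \<in> T \<Longrightarrow> oinv M e \<in> T"
    "card T + 2 = 2 * card U"
proof -
  have "U \<subseteq> vertices M \<and> T \<subseteq> E \<union> oinv M ` E \<and> T \<subseteq> darts M \<and> v \<in> U \<and>
    (\<forall>e\<in>T. vertex M e \<in> U) \<and> (\<forall>e\<in>T. oinv M e \<in> T) \<and> card T + 2 = 2 * card U"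
    using assms
  proof induction
    case (grows_step U T d)
    then have IH: "U \<subseteq> vertices M" "T \<subseteq> E \<union> oinv M ` E" "T \<subseteq> darts M" "v \<in> U"
      "\<forall>e\<in>T. vertex M e \<in> U" "\<forall>e\<in>T. oinv M e \<in> T" "card T + 2 = 2 * card U" by auto
    have d: "d \<in> darts M" using grows_step by auto
    have fin: "finite T" "finite U"
      using IH finite_darts finite_vertices by (auto intro: finite_subset)
    have "d \<notin> T" using grows_step IH by auto
    moreover have "oinv M d \<notin> T"
      using IH(6) oinv_oinv[OF d] \<open>d \<notin> T\<close> by force
    moreover have "d \<noteq> oinv M d" using oinv_ne[OF d] by simp
    ultimately have "card (insert d (insert (oinv M d) T)) = card T + 2" using fin by simp
    moreover have "card (insert (vertex M d) U) = card U + 1" using fin grows_step by simp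
    ultimately show ?case
      using IH d grows_step
      by (auto simp: vertex_in_vertices oinv_in oinv_oinv end_vertex_def)
  qed auto
  then show "U \<subseteq> vertices M" "T \<subseteq> E \<union> oinv M ` E" "T \<subseteq> darts M" "v \<in> U"
    "\<And>e. e \<in> T \<Longrightarrow> vertex M e \<in> U" "\<And>e. e \<in> T \<Longrightarrow> oinv M e \<in> T"
    "card T + 2 = 2 * card U" by auto
qed

text \<open>If no edge of \<open>E\<close> left the current set of vertices, its union would
  contradict \<open>connected_via\<close>; so there is always another leaf to attach.\<close>

lemma grows_all:
  assumes "connected_via M E" "E \<subseteq> darts M" "\<And>e. e \<in> E \<Longrightarrow> oinv M e \<in> E"
    and "U0 \<subseteq> vertices M" "U0 \<noteq> {}"
  shows "\<exists>T. grows M E U0 T0 (vertices M) T"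
proof -
  have "\<exists>T. grows M E U0 T0 (vertices M) T"
    if "grows M E U0 T0 U T" "U \<subseteq> vertices M" "U \<noteq> {}" for U T
    using that
  proof (induction "card (vertices M - U)" arbitrary: U T rule: less_induct)
    case less
    show ?case
    proof (cases "U = vertices M")
      case True
      then show ?thesis using less by auto
    next
      case False
      have mem: "d \<in> \<Union>U \<longleftrightarrow> vertex M d \<in> U" if "d \<in> darts M" for d
        using less.prems(2) that by (rule in_Union_vertices)
      have "\<exists>e\<in>E. \<not> (oinv M e \<in> \<Union>U \<longleftrightarrow> e \<in> \<Union>U)"
      proof (rule ccontr)
        assume "\<not> ?thesis"
        then have "\<forall>e\<in>E. oinv M e \<in> \<Union>U \<longleftrightarrow> e \<in> \<Union>U" by blast
        moreover have "\<forall>e\<in>darts M. rot M e \<in> \<Union>U \<longleftrightarrow> e \<in> \<Union>U"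
          using mem rot.f_in vertex_rot by metis
        ultimately have "darts M \<inter> \<Union>U = {} \<or> darts M \<subseteq> \<Union>U"
          using assms(1) unfolding connected_via_def by blast
        moreover have "darts M \<inter> \<Union>U \<noteq> {}"
          using less.prems(2,3) vertices_subset vertices_nonempty by blast
        moreover obtain d where "d \<in> darts M" "vertex M d \<notin> U"
          using False less.prems(2) by (auto simp: vertices_def)
        then have "\<not> darts M \<subseteq> \<Union>U" using mem by blast
        ultimately show False by blast
      qed
      then obtain e where e: "e \<in> E" "\<not> (oinv M e \<in> \<Union>U \<longleftrightarrow> e \<in> \<Union>U)" by blast
      \<comment> \<open>Of the two orientations of the leaving edge, the one that starts at the new
        vertex.\<close>
      define d where "d = (if e \<in> \<Union>U then oinv M e else e)"
      have eD: "e \<in> darts M" using e assms(2) by auto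
      have d: "d \<in> E" "d \<in> darts M" "d \<notin> \<Union>U" "oinv M d \<in> \<Union>U"
        using e assms(2,3) eD oinv_in by (auto simp: d_def oinv_oinv)
      have dU: "vertex M d \<notin> U" "end_vertex M d \<in> U"
        using d mem oinv_in unfolding end_vertex_def by blast+
      let ?U = "insert (vertex M d) U"
      have "grows M E U0 T0 ?U (insert d (insert (oinv M d) T))"
        using less.prems(1) d(1) dU by (rule grows.intros)
      moreover have "?U \<subseteq> vertices M" using less.prems(2) d(2) vertex_in_vertices by auto
      moreover have "card (vertices M - ?U) < card (vertices M - U)"
        using finite_vertices vertex_in_vertices d(2) dU by (intro psubset_card_mono) auto
      ultimately show ?thesis using less.hyps by blast
    qed
  qed
  then show ?thesis using assms(4,5) grows.grows_refl by blast
qed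

text \<open>When a leaf is added, the crossing of its edge is replaced by the way round the new vertex.\<close>

lemma grows_dual_connected:
  assumes "connected_via M (darts M)" "grows M (darts M) {v} {} U T" "v \<in> vertices M"
  shows "connected_via (dual_map M) (darts M - T)"
  using assms(2)
proof induction
  case grows_refl
  show ?case unfolding connected_via_def dual_map_simps
  proof (intro allI impI)
    fix A
    assume f: "\<forall>e\<in>darts M. face_next M e \<in> A \<longleftrightarrow> e \<in> A"
      and o: "\<forall>e\<in>darts M - {}. oinv M e \<in> A \<longleftrightarrow> e \<in> A"
    have "\<forall>e\<in>darts M. rot M e \<in> A \<longleftrightarrow> e \<in> A"
      using f o by (simp add: rot_eq oinv_in)
    then show "darts M \<inter> A = {} \<or> darts M \<subseteq> A"
      using assms(1) o unfolding connected_via_def by blast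
  qed
next
  case (grows_step U T d)
  note inv = grows_invariant[OF grows_step.hyps(1) subset_refl assms(3)]
  have d: "d \<in> darts M" using grows_step by auto
  show ?case unfolding connected_via_def dual_map_simps
  proof (intro allI impI)
    fix A
    assume f: "\<forall>e\<in>darts M. face_next M e \<in> A \<longleftrightarrow> e \<in> A"
      and o: "\<forall>e\<in>darts M - insert d (insert (oinv M d) T). oinv M e \<in> A \<longleftrightarrow> e \<in> A"
    have "(rot M d \<in> A) = (d \<in> A)"
    proof (rule rot.orbit_const_except[OF d])
      fix e assume e: "e \<in> orbit (rot M) d" "e \<noteq> d"
      have eD: "e \<in> darts M" using e d by (simp add: rot.orbit_in_S)
      have ev: "vertex M e = vertex M d" using e d unfolding vertex_def by (simp add: rot.orbit_eqI)
      have "e \<notin> T" using ev grows_step.hyps inv(5)[of e] by auto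
      moreover have "e \<noteq> oinv M d" using ev grows_step.hyps by (auto simp: end_vertex_def)
      ultimately have "oinv M e \<in> A \<longleftrightarrow> e \<in> A" using o e eD by auto
      then show "(rot M e \<in> A) = (e \<in> A)" using f eD by (simp add: rot_eq oinv_in)
    qed
    then have 1: "oinv M d \<in> A \<longleftrightarrow> d \<in> A" using f d by (simp add: rot_eq oinv_in)
    have "\<forall>e\<in>darts M - T. oinv M e \<in> A \<longleftrightarrow> e \<in> A"
    proof
      fix e assume "e \<in> darts M - T"
      then show "oinv M e \<in> A \<longleftrightarrow> e \<in> A"
        using 1 o d by (cases "e = d \<or> e = oinv M d") (auto simp: oinv_oinv)
    qed
    then show "darts M \<inter> A = {} \<or> darts M \<subseteq> A"
      using grows_step.IH f unfolding connected_via_def by simp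
  qed
qed

text \<open>The potential at a new leaf is determined by the potential of its neighbour, and in a
  tree no cycle can make these choices inconsistent.\<close>

lemma grows_trivialization:
  fixes c :: "'d \<Rightarrow> 'g::group_add"
  assumes "grows M E {v} {} U T" "E \<subseteq> darts M" "v \<in> vertices M"
    and c: "\<And>e. e \<in> darts M \<Longrightarrow> c (oinv M e) = - c e"
  shows "\<exists>h. \<forall>e\<in>T. - h (vertex M e) + c e + h (end_vertex M e) = 0"
  using assms(1)
proof induction
  case (grows_step U T d)
  note inv = grows_invariant[OF grows_step.hyps(1) assms(2,3)]
  have d: "d \<in> darts M" using grows_step assms(2) by auto
  obtain h where h: "\<forall>e\<in>T. - h (vertex M e) + c e + h (end_vertex M e) = 0"
    using grows_step.IH by auto
  \<comment> \<open>Solved from the equation for \<open>d\<close>; the equations of the old tree do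
    not mention the new vertex.\<close>
  let ?h = "h(vertex M d := c d + h (end_vertex M d))"
  have ne: "end_vertex M d \<noteq> vertex M d" using grows_step by auto
  show ?case
  proof (intro exI[of _ ?h] ballI)
    fix e assume e: "e \<in> insert d (insert (oinv M d) T)"
    consider "e = d" | "e = oinv M d" | "e \<in> T" using e by auto
    then show "- ?h (vertex M e) + c e + ?h (end_vertex M e) = 0"
    proof cases
      case 1
      then show ?thesis using ne by (simp add: minus_add add.assoc)
    next
      case 2
      have "vertex M (oinv M d) = end_vertex M d" by (simp add: end_vertex_def)
      with 2 show ?thesis using ne d by (simp add: end_vertex_oinv c add.assoc diff_conv_add_uminus del: add_uminus_conv_diff)
    next
      case 3
      have "vertex M e \<in> U" "end_vertex M e \<in> U"
        using inv(5,6) 3 by (auto simp: end_vertex_def)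
      then have "vertex M e \<noteq> vertex M d" "end_vertex M e \<noteq> vertex M d"
        using grows_step.hyps by auto
      then show ?thesis using h 3 by simp
    qed
  qed
qed simp

text \<open>Flatness at a leaf forces the value on its edge to vanish, so that leaves can be stripped.\<close>

lemma grows_strip_leaves:
  fixes c :: "'d \<Rightarrow> 'g::group_add"
  assumes "grows M (darts M) U0 T0 U T" "grows M (darts M) {v} {} U0 T0" "v \<in> vertices M"
    and c: "\<And>e. e \<in> darts M \<Longrightarrow> c (oinv M e) = - c e"
    and flat: "\<And>e. e \<in> darts M \<Longrightarrow> vertex M e \<notin> U0 \<Longrightarrow> holonomy (rot M) c e = 0"
    and off: "\<And>e. e \<in> darts M - T \<Longrightarrow> c e = 0"
  shows "\<forall>e\<in>darts M - T0. c e = 0"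
  using assms(1) off
proof induction
  case (grows_step U T d)
  have g: "grows M (darts M) {v} {} U T" using grows_step assms(2) grows_trans by metis
  note inv = grows_invariant[OF g subset_refl assms(3)]
  have d: "d \<in> darts M" using grows_step by auto
  have "U0 \<subseteq> U" using grows_step.hyps(1) by induction auto
  then have "holonomy (rot M) c d = 0" using flat[of d] d grows_step by auto
  moreover have "holonomy (rot M) c d = c d"
  proof (rule rot.holonomy_eq_single[OF d])
    fix e assume e: "e \<in> orbit (rot M) d" "e \<noteq> d"
    have eD: "e \<in> darts M" using e d by (simp add: rot.orbit_in_S)
    have ev: "vertex M e = vertex M d" using e d unfolding vertex_def by (simp add: rot.orbit_eqI)
    have "e \<notin> T" using ev grows_step.hyps inv(5)[of e] by auto
      moreover have "e \<noteq> oinv M d" using ev grows_step.hyps by (auto simp: end_vertex_def)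
      ultimately show "c e = 0" using grows_step.prems e eD by auto
  qed
  ultimately have "c d = 0" "c (oinv M d) = 0" using c d by auto
  then have "\<And>e. e \<in> darts M - T \<Longrightarrow> c e = 0" using grows_step.prems by blast
  then show ?case by (rule grows_step.IH)
qed auto

end

section \<open>Flat cochains on plane maps\<close>

locale plane_map = emap M for M :: "('d, 'z) emb_scheme" +
  assumes connected: "connected_via M (darts M)"
    and euler: "2 * card (vertices M) + 2 * card (faces M) = card (darts M) + 4"
begin

lemma plane_map_dual_map: "plane_map (dual_map M)"
proof -
  interpret dual: emap "dual_map M" by (rule emap_dual_map)
  have "connected_via (dual_map M) (darts (dual_map M))"
    unfolding connected_via_def dual_map_simps
  proof (intro allI impI)
    fix A
    assume f: "\<forall>e\<in>darts M. face_next M e \<in> A \<longleftrightarrow> e \<in> A"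
      and o: "\<forall>e\<in>darts M. oinv M e \<in> A \<longleftrightarrow> e \<in> A"
    have "\<forall>e\<in>darts M. rot M e \<in> A \<longleftrightarrow> e \<in> A"
      using f o by (simp add: rot_eq oinv_in)
    then show "darts M \<inter> A = {} \<or> darts M \<subseteq> A"
      using connected o unfolding connected_via_def by blast
  qed
  then show ?thesis
    using euler by unfold_locales (auto simp: faces_dual_map)
qed

text \<open>The dual edges off a spanning tree \<open>T\<close> connect all faces, and by Euler's formula there is one
  less of them than there are faces, so they form a spanning tree of the dual graph.\<close>

theorem trivialization:
  fixes c :: "'d \<Rightarrow> 'g::group_add"
  assumes "grows M (darts M) {v} {} U0 T0" "v \<in> vertices M"
    and c: "\<And>e. e \<in> darts M \<Longrightarrow> c (oinv M e) = - c e"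
    and flat: "\<And>e. e \<in> darts M \<Longrightarrow> vertex M e \<notin> U0 \<Longrightarrow> holonomy (rot M) c e = 0"
  shows "\<exists>h. \<forall>e\<in>darts M - T0. - h (face M e) + c e + h (face M (oinv M e)) = 0"
proof -
  interpret dual: emap "dual_map M" by (rule emap_dual_map)
  note inv0 = grows_invariant[OF assms(1) subset_refl assms(2)]
  obtain T where T: "grows M (darts M) U0 T0 (vertices M) T"
    using grows_all[OF connected subset_refl oinv_in inv0(1)] inv0(4) by auto
  have vT: "grows M (darts M) {v} {} (vertices M) T" using T assms(1) by (rule grows_trans)
  note invT = grows_invariant[OF vT subset_refl assms(2)]
  define E where "E = darts M - T"
  have E: "E \<subseteq> darts M" "\<And>e. e \<in> E \<Longrightarrow> oinv M e \<in> E"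
  proof -
    show "oinv M e \<in> E" if "e \<in> E" for e
      using that invT(6)[of "oinv M e"] by (auto simp: E_def oinv_in oinv_oinv)
  qed (auto simp: E_def)
  have conn: "connected_via (dual_map M) E"
    unfolding E_def using connected vT assms(2) by (rule grows_dual_connected)
  obtain d0 where d0: "d0 \<in> darts M" using assms(2) by (rule verticesE)
  have f0: "face M d0 \<in> vertices (dual_map M)" using d0 by (simp add: face_in_faces)
  obtain T' where T': "grows (dual_map M) E {face M d0} {} (faces M) T'"
    using dual.grows_all[OF conn, of "{face M d0}" "{}"] E f0 by auto
  have "E \<subseteq> darts (dual_map M)" using E by simp
  note invT' = dual.grows_invariant[OF T' this f0]
  have "T' = E"
  proof (rule card_subset_eq)
    show "finite E" using E finite_darts finite_subset by auto
    show "T' \<subseteq> E" using invT'(2) E(2) by auto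
    have "card E = card (darts M) - card T"
      unfolding E_def using invT(3) finite_darts finite_subset by (metis card_Diff_subset)
    moreover have "card T \<le> card (darts M)" using invT(3) finite_darts by (rule card_mono[rotated])
    ultimately show "card T' = card E" using invT(7) invT'(7) euler by linarith
  qed
  moreover obtain h where h: "\<forall>e\<in>T'. - h (face M e) + c e + h (face M (oinv M e)) = 0"
    using dual.grows_trivialization[OF T' _ f0, of c] E c
    by (auto simp: end_vertex_dual_map)
  ultimately have hE: "\<forall>e\<in>E. - h (face M e) + c e + h (face M (oinv M e)) = 0" by simp
  \<comment> \<open>After this change the cochain vanishes off the spanning tree \<open>T\<close>;
    what remains on \<open>T\<close> is removed leaf by leaf down to the given tree
    \<open>T0\<close>.\<close>
  let ?c = "\<lambda>e. - h (face M e) + c e + h (face M (oinv M e))"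
  have "\<forall>e\<in>darts M - T0. ?c e = 0"
  proof (rule grows_strip_leaves[OF T assms(1,2)])
    show "?c (oinv M e) = - ?c e" if "e \<in> darts M" for e
      using that by (simp add: c oinv_oinv minus_add add.assoc diff_conv_add_uminus del: add_uminus_conv_diff)
    show "?c e = 0" if "e \<in> darts M - T" for e using hE that by (simp add: E_def)
    show "holonomy (rot M) ?c e = 0" if e: "e \<in> darts M" "vertex M e \<notin> U0" for e
    proof -
      \<comment> \<open>The dart \<open>rot M e\<close> has the left face of
        \<open>oinv M e\<close>, so the values of \<open>h\<close> telescope around the vertex and
        flatness is preserved.\<close>
      have "holonomy (rot M) ?c e = - h (face M e) + holonomy (rot M) c e + h (face M e)"
        by (rule rot.holonomy_gauge[OF e(1)]) (simp add: face_rot rot.orbit_in_S[OF _ e(1)])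
      then show ?thesis using flat[OF e] by simp
    qed
  qed
  then show ?thesis by blast
qed

end

section \<open>Facial walks of 2-connected plane graphs\<close>

text \<open>If a face had two corners at a vertex, they would bound a sector at this vertex whose indicator
  gives a closed, hence exact, 1-cochain; its potential is constant off the vertex by 2-connectedness,
  which forces the same value on all edges at the vertex.\<close>

lemma (in plane_map) face_vertex_inj:
  assumes conn: "\<And>x. x \<in> vertices M \<Longrightarrow> connected_on M (vertices M - {x})"
    and noloop: "\<And>d. d \<in> darts M \<Longrightarrow> vertex M d \<noteq> end_vertex M d"
    and d: "d1 \<in> darts M" "d2 \<in> darts M" "vertex M d1 = vertex M d2" "face M d1 = face M d2"
  shows "d1 = d2"
proof (rule ccontr)
  assume ne: "d1 \<noteq> d2"
  let ?v = "vertex M d1"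
  define n where "n = card (orbit (rot M) d1)"
  have "d2 \<in> orbit (rot M) d1" using vertex_self[OF d(2)] d(3) by (simp add: vertex_def)
  then obtain j where j: "j < n" "d2 = (rot M ^^ j) d1"
    unfolding n_def by (rule rot.orbitE_funpow[OF d(1)])
  have j0: "0 < j" using ne j by (cases j) auto
  \<comment> \<open>The sector from \<open>d1\<close> inclusive to \<open>d2\<close> exclusive in
    the rotational order.\<close>
  define S where "S = (\<lambda>i. (rot M ^^ i) d1) ` {..<j}"
  have inj: "(rot M ^^ i) d1 = (rot M ^^ k) d1 \<longleftrightarrow> i = k" if "i < n" "k < n" for i k
    using rot.orbit_period(2)[OF d(1)] that unfolding n_def inj_on_def by auto
  have S_iff: "(rot M ^^ i) d1 \<in> S \<longleftrightarrow> i < j" if "i < n" for i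
  proof -
    have "(rot M ^^ i) d1 \<in> S \<longleftrightarrow> (\<exists>k<j. (rot M ^^ i) d1 = (rot M ^^ k) d1)"
      unfolding S_def by blast
    also have "\<dots> \<longleftrightarrow> i < j"
    proof
      assume "\<exists>k<j. (rot M ^^ i) d1 = (rot M ^^ k) d1"
      then obtain k where "k < j" "(rot M ^^ i) d1 = (rot M ^^ k) d1" by blast
      then show "i < j" using inj[OF that, of k] j(1) by simp
    qed blast
    finally show ?thesis .
  qed
  have SV: "S \<subseteq> ?v"
    unfolding S_def vertex_def using funpow_in_orbit[OF rot.self_in_orbit[OF d(1)]] by auto
  have period: "(rot M ^^ n) d1 = d1" unfolding n_def using rot.orbit_period(1)[OF d(1)] .
  text \<open>Only the two corners at \<^term>\<open>d1\<close> and \<^term>\<open>d2\<close> separate the sector \<^term>\<open>S\<close> from the rest of the vertex.\<close>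
  have corner: "(rot M e = d1 \<longrightarrow> e \<notin> S) \<and> (rot M e = d2 \<longrightarrow> e \<in> S) \<and>
      (rot M e \<noteq> d1 \<longrightarrow> rot M e \<noteq> d2 \<longrightarrow> (rot M e \<in> S \<longleftrightarrow> e \<in> S))" if "e \<in> ?v" for e
  proof -
    have "e \<in> orbit (rot M) d1" using that by (simp add: vertex_def)
    then obtain i where i: "i < n" "e = (rot M ^^ i) d1"
      unfolding n_def by (rule rot.orbitE_funpow[OF d(1)])
    have r: "rot M e = (rot M ^^ Suc i) d1" using i by simp
    show ?thesis
    proof (cases "Suc i = n")
      case True
      then have "rot M e = d1" using r period by simp
      moreover have "e \<notin> S" using S_iff[OF i(1)] i True j by auto
      ultimately show ?thesis using ne by simp
    next
      case False
      then have "Suc i < n" using i by simp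
      have 1: "rot M e \<noteq> d1" using inj[of "Suc i" 0] \<open>Suc i < n\<close> r by simp
      have 2: "rot M e = d2 \<longleftrightarrow> Suc i = j" using inj[of "Suc i" j] \<open>Suc i < n\<close> r j by simp
      show ?thesis
        using 1 2 S_iff[OF i(1)] S_iff[OF \<open>Suc i < n\<close>] i(2) r by auto
    qed
  qed
  define s :: "_ \<Rightarrow> int" where "s e = (if e \<in> S then 1 else 0)" for e
  define c where "c e = s e - s (oinv M e)" for e
  \<comment> \<open>The jump of the indicator \<open>s\<close> at one corner of a facial walk: the
    sector is entered at \<open>d1\<close> and left at \<open>d2\<close>.\<close>
  define u :: "_ \<Rightarrow> int" where
    "u e = (if face_next M e = d1 then 1 else if face_next M e = d2 then - 1 else 0)" for e
  have d1S: "d1 \<in> S" using S_iff[of 0] j j0 by simp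
  have d2S: "d2 \<notin> S" using S_iff[of j] j by simp
  have su: "s (face_next M e) = s (oinv M e) + u e" if e: "e \<in> darts M" for e
  proof (cases "oinv M e \<in> ?v")
    case True
    then show ?thesis
      using corner[OF True] ne d1S d2S unfolding s_def u_def face_next_def by auto
  next
    case False
    have "face_next M e \<notin> ?v"
      using False rot.f_in_orbit_iff[OF d(1) oinv_in[OF e]] by (simp add: face_next_def vertex_def)
    moreover have "d1 \<in> ?v" "d2 \<in> ?v" using vertex_self[OF d(1)] vertex_self[OF d(2)] d(3) by auto
    ultimately show ?thesis using False SV unfolding s_def u_def by auto
  qed
  interpret dual: plane_map "dual_map M" by (rule plane_map_dual_map)
  \<comment> \<open>Both corners lie in the same face, where the jumps 1 and -1 cancel.\<close>
  have u0: "holonomy (face_next M) u x = 0" if x: "x \<in> darts M" for x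
  proof (cases "face M x = face M d1")
    case False
    have "u y = 0" if y: "y \<in> face M x" for y
    proof -
      have "y \<in> darts M" using x y face_subset by auto
      then have "face M (face_next M y) = face M x"
        using x y face_face_next[of y] face_eqI[OF face_in_faces[OF x] y] by simp
      then show ?thesis using False d unfolding u_def by auto
    qed
    then show ?thesis
      using fn.holonomy_eq_single[OF x, of u] face_self[OF x] by (auto simp: face_def)
  next
    case True
    define p1 p2 where "p1 = inv_into (darts M) (face_next M) d1" and "p2 = inv_into (darts M) (face_next M) d2"
    have p: "p1 \<in> darts M" "face_next M p1 = d1" "p2 \<in> darts M" "face_next M p2 = d2"
      unfolding p1_def p2_def using d by (auto simp: fn.inv_into_in fn.f_inv_into)
    have pF: "face M p1 = face M d1" "face M p2 = face M d1"
      using p d(4) face_face_next[of p1] face_face_next[of p2] by auto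
    have "holonomy (face_next M) u p1 = u p1 + u p2"
    proof (rule fn.holonomy_eq_pair)
      show "p2 \<in> orbit (face_next M) p1" using pF p face_eq_iff[of p2 p1] by (simp add: face_def)
      show "p2 \<noteq> p1" using p ne by auto
      show "u y = 0" if "y \<in> orbit (face_next M) p1" "y \<noteq> p1" "y \<noteq> p2" for y
      proof -
        have "y \<in> darts M" using that p fn.orbit_in_S by auto
        then show ?thesis using that(2,3) p fn.f_eq_iff[of y p1] fn.f_eq_iff[of y p2] unfolding u_def by auto
      qed
    qed (use p in auto)
    then have h1: "holonomy (face_next M) u p1 = 0" using p ne by (simp add: u_def)
    have "x \<in> orbit (face_next M) p1" using True pF x p face_eq_iff[of x p1] by (simp add: face_def)
    then obtain i where "x = (face_next M ^^ i) p1" by (rule fn.orbitE_funpow[OF p(1)])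
    then show ?thesis using fn.holonomy_conj[OF p(1), of u i] h1 by simp
  qed
  \<comment> \<open>Trivialization in the dual, with the one-vertex tree: the potential lives on
    faces of the dual, that is, on vertices of \<open>M\<close>.\<close>
  have "\<exists>h. \<forall>e\<in>darts (dual_map M) - {}. - h (face (dual_map M) e) + c e + h (face (dual_map M) (oinv (dual_map M) e)) = 0"
  proof (rule dual.trivialization[OF grows_refl])
    show "face M d1 \<in> vertices (dual_map M)" using d(1) by (simp add: face_in_faces)
    show "c (oinv (dual_map M) e) = - c e" if "e \<in> darts (dual_map M)" for e
      using that by (simp add: c_def oinv_oinv)
    show "holonomy (rot (dual_map M)) c e = 0" if "e \<in> darts (dual_map M)" for e
    proof -
      have e: "e \<in> darts M" using that by simp
      have "holonomy (face_next M) c e = - (- s e) + holonomy (face_next M) u e + (- s e)"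
      proof (rule fn.holonomy_gauge[OF e])
        fix y assume "y \<in> orbit (face_next M) e"
        then have "y \<in> darts M" using e fn.orbit_in_S by auto
        then show "c y = - (- s y) + u y + - s (face_next M y)" using su[of y] by (simp add: c_def)
      qed
      then show ?thesis using u0[OF e] by simp
    qed
  qed
  then obtain h where "\<forall>e\<in>darts M. - h (vertex M e) + c e + h (vertex M (oinv M e)) = 0"
    by (auto simp: face_dual_map oinv_in)
  then have h: "c e = h (vertex M e) - h (end_vertex M e)" if "e \<in> darts M" for e
    using that by (force simp: end_vertex_def)
  have off: "oinv M e \<notin> S \<and> end_vertex M e \<in> vertices M - {?v}" if e: "e \<in> darts M" "vertex M e = ?v" for e
  proof -
    have "end_vertex M e \<noteq> ?v" using noloop[OF e(1)] e by simp
    moreover have "oinv M e \<notin> ?v"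
      using calculation vertex_eq_iff[OF oinv_in[OF e(1)] d(1)] by (simp add: end_vertex_def)
    ultimately show ?thesis using SV e end_vertex_in_vertices by auto
  qed
  have "h (end_vertex M d1) = h (end_vertex M d2)"
  proof (rule connected_on_closed[OF conn[of ?v], where u = "end_vertex M d2" and P = "\<lambda>w. h w = h (end_vertex M d2)"])
    fix e assume e: "e \<in> darts M" "vertex M e \<in> vertices M - {?v}" "end_vertex M e \<in> vertices M - {?v}"
      "h (vertex M e) = h (end_vertex M d2)"
    have "e \<notin> ?v" "oinv M e \<notin> ?v"
      using e(2,3) vertex_eq_iff[OF e(1) d(1)] vertex_eq_iff[OF oinv_in[OF e(1)] d(1)]
      by (auto simp: end_vertex_def)
    then have "c e = 0" using SV by (auto simp: c_def s_def)
    then show "h (end_vertex M e) = h (end_vertex M d2)" using h[OF e(1)] e(4) by simp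
  qed (use off d vertex_in_vertices in auto)
  \<comment> \<open>Both darts start at the same vertex and end at equal potentials, but only
    \<open>d1\<close> belongs to the sector.\<close>
  moreover have "c d1 = 1" "c d2 = 0"
    using off d d1S d2S by (auto simp: c_def s_def)
  ultimately show False using h d by force
qed

section \<open>A free product of groups of order two\<close>

text \<open>The normal forms of the free product again, now as a type of its own, so that it becomes
  an instance of \<open>group_add\<close> and can carry cochains. All natural numbers are letters,
  which avoids a carrier set.\<close>

typedef invol_word = "{w :: nat list. distinct_adj w}"
  morphisms letters Abs_invol_word
  by (intro exI[of _ "[]"]) simp

instantiation invol_word :: group_add
begin

definition zero_invol_word where "0 = Abs_invol_word []"
definition plus_invol_word where "u + v = Abs_invol_word (foldr sigma_cons (letters u) (letters v))"
definition uminus_invol_word where "- u = Abs_invol_word (rev (letters u))"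
definition minus_invol_word where "u - v = u + - v" for u v :: invol_word

lemma distinct_adj_letters: "distinct_adj (letters u)"
  using letters[of u] by simp

lemma letters_zero: "letters 0 = []"
  unfolding zero_invol_word_def by (simp add: Abs_invol_word_inverse)

lemma letters_plus: "letters (u + v) = foldr sigma_cons (letters u) (letters v)"
  unfolding plus_invol_word_def
  by (simp add: Abs_invol_word_inverse foldr_sigma_cons_reduced distinct_adj_letters)

lemma letters_uminus: "letters (- u) = rev (letters u)"
  unfolding uminus_invol_word_def by (simp add: Abs_invol_word_inverse distinct_adj_letters)

instance
proof
  fix a b c :: invol_word
  show "a + b + c = a + (b + c)"
    by (simp add: letters_inject[symmetric] letters_plus foldr_sigma_cons_assoc distinct_adj_letters)
  show "0 + a = a"
    by (simp add: letters_inject[symmetric] letters_plus letters_zero)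
  show "a + 0 = a"
    by (simp add: letters_inject[symmetric] letters_plus letters_zero foldr_sigma_cons_Nil distinct_adj_letters)
  show "- a + a = 0"
    using foldr_sigma_cons_rev[of "[]" "letters a"] distinct_adj_letters[of a]
    by (simp add: letters_inject[symmetric] letters_plus letters_zero letters_uminus foldr_sigma_cons_Nil)
qed (simp add: minus_invol_word_def)

end

definition gen :: "nat \<Rightarrow> invol_word" where
  "gen i = Abs_invol_word [i]"

lemma letters_gen [simp]: "letters (gen i) = [i]"
  by (simp add: gen_def Abs_invol_word_inverse)

lemma gen_twice: "gen i + gen i = 0"
  by (simp add: letters_inject[symmetric] letters_plus letters_zero)

lemma uminus_gen [simp]: "- gen i = gen i"
  using gen_twice[of i] by (rule minus_unique)

lemma gen_cancel [simp]: "gen i + (gen i + x) = x"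
  by (metis add.assoc gen_twice add_0)

definition of_letters :: "nat list \<Rightarrow> invol_word" where
  "of_letters w = sum_list (map gen w)"

lemma of_letters_simps [simp]:
  "of_letters [] = 0" "of_letters (i # w) = gen i + of_letters w"
  by (simp_all add: of_letters_def)

lemma of_letters_append: "of_letters (u @ v) = of_letters u + of_letters v"
  by (simp add: of_letters_def)

lemma uminus_of_letters: "- of_letters w = of_letters (rev w)"
  by (induction w) (simp_all add: of_letters_append minus_add)

lemma letters_of_letters: "distinct_adj w \<Longrightarrow> letters (of_letters w) = w"
proof (induction w)
  case (Cons i w)
  then show ?case by (cases w) (auto simp: letters_plus)
qed (simp add: letters_zero)

lemma of_letters_letters: "of_letters (letters x) = x"
  by (simp add: letters_inject[symmetric] letters_of_letters distinct_adj_letters)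

text \<open>The orientation character: each letter will act as a reflection that exchanges the two
  orientations of chambers.\<close>

definition even_word :: "invol_word \<Rightarrow> bool" where
  "even_word x \<longleftrightarrow> even (length (letters x))"

lemma even_length_sigma_cons: "even (length (sigma_cons i w)) \<longleftrightarrow> odd (length w)"
  by (cases w) auto

lemma even_word_zero [simp]: "even_word 0"
  by (simp add: even_word_def letters_zero)

lemma even_word_gen [simp]: "\<not> even_word (gen i)"
  by (simp add: even_word_def)

lemma even_word_plus [simp]: "even_word (x + y) \<longleftrightarrow> (even_word x \<longleftrightarrow> even_word y)"
proof -
  have "even (length (foldr sigma_cons u v)) \<longleftrightarrow> (even (length u) \<longleftrightarrow> even (length v))" for u v
    by (induction u) (auto simp: even_length_sigma_cons)
  then show ?thesis by (simp add: even_word_def letters_plus)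
qed

lemma even_word_uminus [simp]: "even_word (- x) \<longleftrightarrow> even_word x"
  by (simp add: even_word_def letters_uminus)

lemma even_word_diff [simp]: "even_word (x - y) \<longleftrightarrow> (even_word x \<longleftrightarrow> even_word y)"
  by (simp only: diff_conv_add_uminus even_word_plus even_word_uminus)

lemma even_word_of_letters [simp]: "even_word (of_letters w) \<longleftrightarrow> even (length w)"
  by (induction w) auto

text \<open>In a dihedral group each of the two generating reflections inverts their
  product.\<close>

lemma conj_two_gens:
  assumes "set w \<subseteq> {i, j}"
  shows "of_letters w + (gen i + gen j) + of_letters (rev w) = (if even (length w) then gen i + gen j else gen j + gen i)"
  using assms
proof (induction w)
  case (Cons k w)
  have "of_letters (k # w) + (gen i + gen j) + of_letters (rev (k # w)) =
      gen k + (of_letters w + (gen i + gen j) + of_letters (rev w)) + gen k"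
    by (simp add: of_letters_append add.assoc)
  also have "of_letters w + (gen i + gen j) + of_letters (rev w) =
      (if even (length w) then gen i + gen j else gen j + gen i)"
    using Cons by simp
  finally show ?case using Cons.prems by (auto simp: add.assoc gen_twice)
qed simp

text \<open>Conjugation by one letter strips the outermost letter of \<open>y\<close>, or wraps a
  new letter around the word, or, if \<open>y\<close> is empty and the letter is 1 or 2, reverses
  the core.\<close>

lemma conj_class_letters:
  "\<exists>y w. w \<in> {[2, 1], [1, 2]} \<and> letters (r + (gen 2 + gen 1) - r) = y @ w @ rev y"
proof -
  have *: "\<exists>y w. w \<in> {[2, 1], [1, 2]} \<and> letters (gen i + x + gen i) = y @ w @ rev y"
    if "w \<in> {[2, 1], [1, 2]}" "letters x = y @ w @ rev y" for i x y w
  proof -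
    have x: "x = of_letters y + of_letters w + of_letters (rev y)"
      using that(2) by (metis of_letters_letters of_letters_append add.assoc)
    show ?thesis
    proof (cases y)
      case Nil
      then have x: "x = of_letters w" using x by simp
      consider "i = 2" | "i = 1" | "i \<noteq> 1" "i \<noteq> 2" by blast
      then show ?thesis
      proof cases
        case 1
        then have "letters (gen i + x + gen i) = [] @ rev w @ rev []"
          using that(1) x by (auto simp: letters_plus)
        then show ?thesis using that(1) by (intro exI[of _ "[]"] exI[of _ "rev w"]) auto
      next
        case 2
        then have "letters (gen i + x + gen i) = [] @ rev w @ rev []"
          using that(1) x by (auto simp: letters_plus)
        then show ?thesis using that(1) by (intro exI[of _ "[]"] exI[of _ "rev w"]) auto
      next
        case 3
        then have "letters (gen i + x + gen i) = [i] @ w @ rev [i]"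
          using that(1) x by (auto simp: letters_plus)
        then show ?thesis using that(1) by blast
      qed
    next
      case (Cons k y')
      show ?thesis
      proof (cases "k = i")
        case True
        have "gen i + x + gen i = of_letters (y' @ w @ rev y')"
          using x Cons True by (simp add: of_letters_append add.assoc gen_twice)
        moreover have "distinct_adj (y' @ w @ rev y')"
        proof -
          have "distinct_adj (k # (y' @ w @ rev y') @ [k])"
            using distinct_adj_letters[of x] that(2) Cons by simp
          then show ?thesis by (simp add: distinct_adj_Cons distinct_adj_append_iff del: append_assoc)
        qed
        ultimately show ?thesis using that(1) letters_of_letters by metis
      next
        case False
        have "gen i + x + gen i = of_letters ((i # y) @ w @ rev (i # y))"
          using x by (simp add: of_letters_append add.assoc)
        moreover have "distinct_adj ((i # y) @ w @ rev (i # y))"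
        proof -
          have "distinct_adj ((y @ w @ rev y))" using distinct_adj_letters[of x] that(2) by simp
          then have "distinct_adj ((y @ w @ rev y) @ [i])"
            using False Cons by (subst distinct_adj_append_iff) (auto simp: last_append)
          then show ?thesis using False Cons by (simp add: distinct_adj_Cons)
        qed
        ultimately show ?thesis using that(1) letters_of_letters by metis
      qed
    qed
  qed
  have "\<exists>y w. w \<in> {[2, 1], [1, 2]} \<and> letters (of_letters u + (gen 2 + gen 1) - of_letters u) = y @ w @ rev y" for u
  proof (induction u)
    case Nil
    show ?case by (intro exI[of _ "[]"] exI[of _ "[2, 1]"]) (simp add: letters_plus)
  next
    case (Cons i u)
    have "of_letters (i # u) + (gen 2 + gen 1) - of_letters (i # u) =
        gen i + (of_letters u + (gen 2 + gen 1) - of_letters u) + gen i"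
      by (simp only: of_letters_simps diff_conv_add_uminus minus_add uminus_gen add.assoc)
    then show ?case using Cons * by metis
  qed
  from this[of "letters r"] show ?thesis by (simp only: of_letters_letters)
qed

text \<open>This replaces the fact that a sphere with three punctures has only one isotopy class of cut-paths.\<close>

theorem simultaneous_conj:
  assumes A: "A = p + (gen 0 + gen 2) - p" and B: "B = q + (gen 0 + gen 1) - q"
    and AB: "- A + B = r + (gen 2 + gen 1) - r"
    and even: "even_word p" "even_word q"
  shows "\<exists>k. even_word k \<and> A = k + (gen 0 + gen 2) - k \<and> B = k + (gen 0 + gen 1) - k"
proof -
  \<comment> \<open>The relative conjugator. A left end over 0 and 2 can at most invert
    \<open>gen 0 + gen 2\<close>, and a right end over 0 and 1 can at most invert
    \<open>gen 0 + gen 1\<close>; both ends are split off, and the middle part \<open>g\<close> will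
    turn out to be empty.\<close>
  define G where "G = letters (- p + q)"
  define u where "u = takeWhile (\<lambda>i. i \<in> {0, 2}) G"
  define G1 where "G1 = dropWhile (\<lambda>i. i \<in> {0, 2}) G"
  define g where "g = rev (dropWhile (\<lambda>i. i \<in> {0, 1}) (rev G1))"
  define w where "w = rev (takeWhile (\<lambda>i. i \<in> {0, 1}) (rev G1))"
  have G1: "G1 = g @ w" unfolding g_def w_def by (metis rev_append rev_rev_ident takeWhile_dropWhile_id)
  have G: "G = u @ g @ w" unfolding u_def using G1 G1_def by (metis takeWhile_dropWhile_id)
  have su: "set u \<subseteq> {0, 2}" unfolding u_def by (auto dest: set_takeWhileD)
  have sw: "set w \<subseteq> {0, 1}" unfolding w_def by (auto dest: set_takeWhileD)
  have hd_g: "hd g \<notin> {0, 2}" if "g \<noteq> []"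
  proof -
    have "hd G1 = hd g" "G1 \<noteq> []" using that G1 by auto
    then show ?thesis using hd_dropWhile[of "\<lambda>i. i \<in> {0, 2}" G] unfolding G1_def by metis
  qed
  have last_g: "last g \<notin> {0, 1}" if "g \<noteq> []"
  proof -
    have "last g = hd (dropWhile (\<lambda>i. i \<in> {0, 1}) (rev G1))" unfolding g_def by (simp add: last_rev)
    then show ?thesis using hd_dropWhile[of "\<lambda>i. i \<in> {0, 1}" "rev G1"] that unfolding g_def by auto
  qed
  have q: "q = p + (of_letters u + of_letters g + of_letters w)"
    using of_letters_letters[of "- p + q"] unfolding G_def[symmetric] G of_letters_append
    by (metis add.assoc add_minus_cancel)
  define k where "k = p + of_letters u"
  define a where "a = (if even (length u) then gen 0 + gen 2 else gen 2 + gen 0)"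
  define b where "b = (if even (length w) then gen 0 + gen 1 else gen 1 + gen 0)"
  have "of_letters (rev u) + (gen 0 + gen 2) + of_letters u = a"
    using conj_two_gens[of "rev u" 0 2] su by (simp add: a_def)
  then have A': "A = k + a - k"
    unfolding A k_def a_def[symmetric]
    by (auto simp: diff_conv_add_uminus minus_add uminus_of_letters add.assoc
        simp flip: uminus_of_letters simp del: add_uminus_conv_diff)
  have "of_letters w + (gen 0 + gen 1) + of_letters (rev w) = b"
    using conj_two_gens[of w 0 1] sw by (simp add: b_def)
  then have B': "B = k + (of_letters g + b - of_letters g) - k"
    unfolding B q k_def
    by (auto simp: diff_conv_add_uminus minus_add add.assoc
        simp flip: uminus_of_letters simp del: add_uminus_conv_diff)
  \<comment> \<open>The product \<open>- A + B\<close> seen from the common conjugator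
    \<open>k\<close>; it is still a conjugate of \<open>gen 2 + gen 1\<close>.\<close>
  define X where "X = - a + (of_letters g + b - of_letters g)"
  have "- A + B = k + X - k"
    unfolding A' B' X_def
    by (simp add: diff_conv_add_uminus minus_add add.assoc del: add_uminus_conv_diff)
  then have "X = - k + (r + (gen 2 + gen 1) - r) + k"
    unfolding AB by (metis add.assoc add_diff_cancel diff_add_cancel minus_add_cancel)
  then have "X = (- k + r) + (gen 2 + gen 1) - (- k + r)"
    by (simp add: diff_conv_add_uminus minus_add add.assoc del: add_uminus_conv_diff)
  then obtain y z where z: "z \<in> {[2, 1], [1, 2]}" and X: "letters X = y @ z @ rev y"
    using conj_class_letters by metis
  define a' b' where "a' = (if even (length u) then [2, 0] else [0, 2 :: nat])"
    and "b' = (if even (length w) then [0, 1] else [1, 0 :: nat])"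
  have X': "X = of_letters (a' @ g @ b' @ rev g)"
    unfolding X_def a_def b_def a'_def b'_def
    by (simp add: of_letters_append uminus_of_letters minus_add add.assoc diff_conv_add_uminus
        del: add_uminus_conv_diff)
  \<comment> \<open>A word \<open>y @ z @ rev y\<close> begins and ends with the same letter unless
    \<open>y\<close> is empty.\<close>
  have hdX: "letters X \<noteq> []" "hd (letters X) = last (letters X) \<or> length (letters X) = 2"
    using z unfolding X by (cases y; auto)+
  have dg: "distinct_adj g"
    using distinct_adj_letters[of "- p + q"] unfolding G_def[symmetric] G by (simp add: distinct_adj_append_iff)
  \<comment> \<open>Otherwise the word found for \<open>X\<close> is reduced as it stands and too
    long; it begins with 0 or 2, but ends with the first letter of \<open>g\<close>, which is
    neither.\<close>
  have "g = []"
  proof (rule ccontr)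
    assume g: "g \<noteq> []"
    have "distinct_adj (a' @ g @ b' @ rev g)"
      using g hd_g last_g dg
      by (auto simp: distinct_adj_append_iff a'_def b'_def hd_append hd_rev)
    then have "letters X = a' @ g @ b' @ rev g" unfolding X' by (rule letters_of_letters)
    then show False using hdX hd_g g by (auto simp: a'_def last_rev split: if_splits)
  qed
  \<comment> \<open>With different parities \<open>X\<close> would be 2010 or 0201, again with
    different ends and length four.\<close>
  have "even (length u) = even (length w)"
  proof (rule ccontr)
    assume "even (length u) \<noteq> even (length w)"
    then have "letters X = a' @ b'"
      unfolding X' \<open>g = []\<close> by (auto simp: a'_def b'_def letters_plus letters_zero)
    then show False using hdX \<open>even (length u) \<noteq> even (length w)\<close>
      by (auto simp: a'_def b'_def split: if_splits)
  qed
  show ?thesis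
  proof (cases "even (length u)")
    case True
    then show ?thesis
      using A' B' \<open>g = []\<close> \<open>even (length u) = even (length w)\<close> even
      by (intro exI[of _ k]) (auto simp: k_def a_def b_def)
  next
    case False
    \<comment> \<open>One more \<open>gen 0\<close> in the conjugator inverts both products at once
      and makes its length even.\<close>
    then have "A = k + (gen 2 + gen 0) - k" "B = k + (gen 1 + gen 0) - k"
      using A' B' \<open>g = []\<close> \<open>even (length u) = even (length w)\<close> by (auto simp: a_def b_def)
    then have "A = (k + gen 0) + (gen 0 + gen 2) - (k + gen 0)"
      "B = (k + gen 0) + (gen 0 + gen 1) - (k + gen 0)"
      by (simp_all add: diff_conv_add_uminus minus_add add.assoc del: add_uminus_conv_diff)
    moreover have "even_word (k + gen 0)" using even False by (simp add: k_def)
    ultimately show ?thesis by blast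
  qed
qed

section \<open>The double of an lsp-operation\<close>

locale lsp =
  fixes Q :: "'a lsp"
  assumes lsp_operation: "lsp_operation Q"
begin

lemma emap_Q: "emap Q"
  using lsp_operation by unfold_locales (auto simp: lsp_operation_def embedded_graph_def)

sublocale plane_map Q
proof -
  interpret emap Q by (rule emap_Q)
  have "connected_via Q (darts Q)"
    unfolding connected_via_iff
    using lsp_operation[unfolded lsp_operation_def embedded_graph_def] by (elim conjE)
  moreover have "2 * card (vertices Q) + 2 * card (faces Q) = card (darts Q) + 4"
  proof -
    have "2 - real (card (vertices Q)) + real (card (edges Q)) - real (card (faces Q)) = 0"
      using lsp_operation by (simp add: lsp_operation_def plane_def genus_def)
    then have "real (2 + card (edges Q)) = real (card (vertices Q) + card (faces Q))" by simp
    then have "2 + card (edges Q) = card (vertices Q) + card (faces Q)" by (rule of_nat_eq_iff[THEN iffD1])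
    then show ?thesis using card_edges by linarith
  qed
  ultimately show "plane_map Q" by unfold_locales
qed

abbreviation "Out \<equiv> outer Q"
abbreviation "rprev \<equiv> inv_into (darts Q) (rot Q)"
abbreviation "boundary d \<equiv> d \<in> Out \<or> oinv Q d \<in> Out"
abbreviation "M \<equiv> lopsp_of_lsp Q"

lemma Out_face: "Out \<in> faces Q"
  using lsp_operation by (simp add: lsp_operation_def)

lemma Out_subset: "Out \<subseteq> darts Q"
  using Out_face by (rule faces_subset)

lemma Out_dart: "d \<in> Out \<Longrightarrow> d \<in> darts Q"
  using Out_subset by auto

lemma two_connected_Q: "3 \<le> card (vertices Q)" "connected_on Q (vertices Q)"
  "x \<in> vertices Q \<Longrightarrow> connected_on Q (vertices Q - {x})"
  using lsp_operation by (auto simp: lsp_operation_def two_connected_def)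

lemma types_differ: "d \<in> darts Q \<Longrightarrow> start_type Q d \<noteq> end_type Q d"
  using lsp_operation by (simp add: lsp_operation_def)

lemma no_loop: "d \<in> darts Q \<Longrightarrow> vertex Q d \<noteq> end_vertex Q d"
  using types_differ[of d] by (auto simp: start_type_def end_type_def)

lemma vtype_le: "v \<in> vertices Q \<Longrightarrow> vtype Q v \<in> {0, 1, 2}"
  using lsp_operation by (simp add: lsp_operation_def)

lemma special_vertex: "i < 3 \<Longrightarrow> special Q i \<in> vertices Q"
  and special_Out: "i < 3 \<Longrightarrow> special Q i \<inter> Out \<noteq> {}"
  and special_inj: "i < 3 \<Longrightarrow> j < 3 \<Longrightarrow> special Q i = special Q j \<longleftrightarrow> i = j"
proof -
  have 3: "i < 3 \<longleftrightarrow> i \<in> {0, 1, 2}" for i :: nat by auto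
  note l = lsp_operation[unfolded lsp_operation_def]
  have 1: "special Q ` {0, 1, 2} \<subseteq> vertices Q" using l by (elim conjE)
  have 2: "\<forall>i\<in>{0, 1, 2}. special Q i \<inter> outer Q \<noteq> {}" using l by (elim conjE)
  have inj: "inj_on (special Q) {0, 1, 2}" using l by (elim conjE)
  show "i < 3 \<Longrightarrow> special Q i \<in> vertices Q" using 1 unfolding 3 by blast
  show "i < 3 \<Longrightarrow> special Q i \<inter> Out \<noteq> {}" using 2 unfolding 3 by blast
  show "i < 3 \<Longrightarrow> j < 3 \<Longrightarrow> special Q i = special Q j \<longleftrightarrow> i = j"
    unfolding 3 using inj by (auto dest: inj_onD)
qed

lemma face_Out: "d \<in> Out \<Longrightarrow> face Q d = Out"
  using Out_face by (rule face_eqI)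

lemma face_eq_Out: "d \<in> darts Q \<Longrightarrow> face Q d = Out \<longleftrightarrow> d \<in> Out"
  using face_Out face_self by blast

lemma Out_face_next: "d \<in> darts Q \<Longrightarrow> face_next Q d \<in> Out \<longleftrightarrow> d \<in> Out"
  using face_eq_Out[of d] face_eq_Out[of "face_next Q d"] face_face_next[of d] fn.f_in[of d] by simp

lemma Out_rot: "d \<in> darts Q \<Longrightarrow> rot Q d \<in> Out \<longleftrightarrow> oinv Q d \<in> Out"
  by (simp add: rot_eq Out_face_next oinv_in)

text \<open>The outer facial walk is a simple cycle. This makes positions on it, and the two
  boundary edges at each of its vertices, well defined.\<close>

lemma Out_unique: "d \<in> Out \<Longrightarrow> e \<in> Out \<Longrightarrow> vertex Q d = vertex Q e \<Longrightarrow> d = e"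
  by (rule face_vertex_inj[OF two_connected_Q(3) no_loop]) (auto simp: Out_dart face_Out)

text \<open>An edge with the outer face on both sides would end in a vertex of degree one, and
  deleting the neighbour of that vertex would disconnect it from a third vertex.\<close>

lemma Out_oinv: "d \<in> Out \<Longrightarrow> oinv Q d \<notin> Out"
proof
  assume d: "d \<in> Out" "oinv Q d \<in> Out"
  have dD: "d \<in> darts Q" "oinv Q d \<in> darts Q" using d Out_dart by auto
  \<comment> \<open>Both are outer darts at the same vertex.\<close>
  have "rot Q (oinv Q d) = oinv Q d"
  proof (rule Out_unique)
    show "rot Q (oinv Q d) \<in> Out" using d dD by (simp add: Out_rot oinv_oinv)
  qed (use d dD vertex_rot in auto)
  then have v: "vertex Q (oinv Q d) = {oinv Q d}"
    using rot.orbit_f[OF dD(2)] orbit_altdef_bounded[of 1 "rot Q" "oinv Q d"] by (simp add: vertex_def)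
  have "\<not> vertices Q \<subseteq> {vertex Q d, end_vertex Q d}"
  proof
    assume "vertices Q \<subseteq> {vertex Q d, end_vertex Q d}"
    then have "card (vertices Q) \<le> card {vertex Q d, end_vertex Q d}" by (rule card_mono[rotated]) simp
    also have "\<dots> \<le> 2" by (simp add: card_insert_if)
    finally show False using two_connected_Q(1) by simp
  qed
  then obtain w where w: "w \<in> vertices Q" "w \<noteq> vertex Q d" "w \<noteq> end_vertex Q d" by blast
  have "w = end_vertex Q d"
  proof (rule connected_on_closed[OF two_connected_Q(3)[of "vertex Q d"],
        where u = "end_vertex Q d" and P = "\<lambda>x. x = end_vertex Q d"])
    fix e assume e: "e \<in> darts Q" "end_vertex Q e \<in> vertices Q - {vertex Q d}" "vertex Q e = end_vertex Q d"
    have "e = oinv Q d" using vertex_self[OF e(1)] e(3) v by (simp add: end_vertex_def)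
    then show "end_vertex Q e = end_vertex Q d" using e(2) dD by (simp add: end_vertex_oinv)
  qed (use w dD no_loop vertex_in_vertices end_vertex_in_vertices in auto)
  then show False using w by simp
qed

lemma boundary_vertex: "d \<in> darts Q \<Longrightarrow> boundary d \<Longrightarrow> vertex Q d \<inter> Out \<noteq> {} \<and> end_vertex Q d \<inter> Out \<noteq> {}"
proof -
  have *: "vertex Q d \<inter> Out \<noteq> {} \<and> end_vertex Q d \<inter> Out \<noteq> {}" if "d \<in> Out" for d
  proof -
    have d: "d \<in> darts Q" using that by (rule Out_dart)
    have "face_next Q d \<in> Out" using that d by (simp add: Out_face_next)
    moreover have "face_next Q d \<in> end_vertex Q d"
      using vertex_self[OF fn.f_in[OF d]] vertex_face_next[OF d] by simp
    ultimately show ?thesis using that vertex_self[OF d] by blast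
  qed
  assume "d \<in> darts Q" "boundary d"
  then show ?thesis using *[of d] *[of "oinv Q d"] by (auto simp: end_vertex_oinv simp flip: end_vertex_def)
qed

lemma rprev_simps: "d \<in> darts Q \<Longrightarrow> rprev d \<in> darts Q" "d \<in> darts Q \<Longrightarrow> rot Q (rprev d) = d"
  "d \<in> darts Q \<Longrightarrow> rprev (rot Q d) = d"
  by (simp_all add: rot.inv_into_in rot.f_inv_into rot.inv_into_f)

lemma darts_M: "(x, d) \<in> darts M \<longleftrightarrow> d \<in> darts Q \<and> (if x then d \<notin> Out else oinv Q d \<notin> Out)"
  by (auto simp: lopsp_of_lsp_def Let_def glue_copies_def inner_darts_def oinv_in split: if_splits)

lemma oinv_M: "oinv M (x, d) = ((if boundary d then \<not> x else x), oinv Q d)"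
  by (simp add: lopsp_of_lsp_def Let_def glue_copies_def)

lemma rot_M: "rot M (x, d) = (let y = (if boundary d then \<not> x else x) in (y, if y then rot Q d else rprev d))"
  by (simp add: lopsp_of_lsp_def Let_def glue_copies_def)

lemma vtype_M: "vtype M V = the_elem ((\<lambda>(x, d). vtype Q (vertex Q d)) ` V)"
  by (simp add: lopsp_of_lsp_def Let_def glue_copies_def)

lemma special_M: "special M i = {(x, d) \<in> darts M. d \<in> special Q i}"
  by (simp add: lopsp_of_lsp_def Let_def)

lemma oinv_M_in:
  assumes "(x, d) \<in> darts M"
  shows "oinv M (x, d) \<in> darts M"
proof -
  have d: "d \<in> darts Q" using assms by (simp only: darts_M)
  show ?thesis
    using assms oinv_in[OF d] oinv_oinv[OF d] Out_oinv[of d]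
    by (simp only: oinv_M darts_M) (cases x; simp)
qed

lemma oinv_M_oinv:
  assumes "d \<in> darts Q"
  shows "oinv M (oinv M (x, d)) = (x, d)"
  using oinv_oinv[OF assms] by (simp add: oinv_M disj_commute)

lemma finite_darts_M: "finite (darts M)"
proof (rule finite_subset)
  show "darts M \<subseteq> UNIV \<times> darts Q" by (auto simp: darts_M)
qed (use finite_darts in simp)

lemma rot_M_in:
  assumes "(x, d) \<in> darts M"
  shows "rot M (x, d) \<in> darts M"
proof -
  have d: "d \<in> darts Q" using assms by (simp only: darts_M)
  have "oinv Q (rprev d) \<in> Out \<longleftrightarrow> d \<in> Out"
    using Out_rot[of "rprev d"] d by (simp add: rprev_simps)
  then show ?thesis
    using oinv_M_in[OF assms] rot.f_in[OF d] rprev_simps(1)[OF d] Out_rot[OF d] oinv_oinv[OF d] d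
    by (simp only: oinv_M rot_M darts_M Let_def) (simp split: if_splits)
qed

lemma rot_M_inj: "inj_on (rot M) (darts M)"
proof (rule inj_onI)
  fix m n assume mn: "m \<in> darts M" "n \<in> darts M" "rot M m = rot M n"
  obtain x d y e where xy: "m = (x, d)" "n = (y, e)" by (cases m, cases n)
  have D: "d \<in> darts Q" "e \<in> darts Q" using mn xy by (simp_all add: darts_M)
  have eq: "rot M (x, d) = rot M (y, e)" using mn(3) xy by simp
  define nx ny where "nx = (if boundary d then \<not> x else x)" and "ny = (if boundary e then \<not> y else y)"
  have 1: "nx = ny" and 2: "(if nx then rot Q d else rprev d) = (if ny then rot Q e else rprev e)"
    using eq unfolding rot_M Let_def nx_def[symmetric] ny_def[symmetric] prod.inject by blast+
  have "d = e"
  proof (cases nx)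
    case True
    then show ?thesis using 1 2 rot.f_eq_iff[OF D] by simp
  next
    case False
    then have "rprev d = rprev e" using 1 2 by simp
    then show ?thesis using rprev_simps(2)[OF D(1)] rprev_simps(2)[OF D(2)] by metis
  qed
  moreover have "x = y" using 1 \<open>d = e\<close> unfolding nx_def ny_def by (simp split: if_splits)
  ultimately show "m = n" using xy by simp
qed

lemma emap_M: "emap M"
proof
  show "finite (darts M)" by (rule finite_darts_M)
  have "rot M ` darts M \<subseteq> darts M" using rot_M_in by auto
  then show "bij_betw (rot M) (darts M) (darts M)"
    using finite_darts_M rot_M_inj by (simp add: bij_betw_def endo_inj_surj)
next
  fix m assume m: "m \<in> darts M"
  obtain x d where xd: "m = (x, d)" by (cases m)
  then have d: "d \<in> darts Q" using m by (simp add: darts_M)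
  show "oinv M m \<in> darts M" using m xd oinv_M_in by simp
  show "oinv M m \<noteq> m" using oinv_ne[OF d] xd by (simp add: oinv_M)
  show "oinv M (oinv M m) = m" using oinv_M_oinv[OF d] xd by simp
qed

sublocale D: emap M
  by (rule emap_M)

end

section \<open>Vertices and faces of the double\<close>

context lsp
begin

text \<open>A vertex in the outer face belongs to both halves; for it the index \<open>x\<close> is
  ignored, so that one notation covers shared and unshared vertices.\<close>

definition vcopy :: "bool \<Rightarrow> 'a set \<Rightarrow> (bool \<times> 'a) set" where
  "vcopy x v = {(y, e) \<in> darts M. e \<in> v \<and> (v \<inter> Out = {} \<longrightarrow> y = x)}"

text \<open>A reflection exchanges left and right, so in the mirror half a face lies to the left of
  the inverses of its darts.\<close>

definition fcopy :: "bool \<Rightarrow> 'a set \<Rightarrow> (bool \<times> 'a) set" where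
  "fcopy x C = (\<lambda>d. (x, if x then d else oinv Q d)) ` C"

lemma vertex_M_subset: "(x, d) \<in> darts M \<Longrightarrow> vertex M (x, d) \<subseteq> {(y, e) \<in> darts M. e \<in> vertex Q d}"
proof
  fix m assume xd: "(x, d) \<in> darts M" and "m \<in> vertex M (x, d)"
  from this(2) show "m \<in> {(y, e) \<in> darts M. e \<in> vertex Q d}"
    unfolding vertex_def[of M]
  proof (induction rule: D.rot.orbit_induct_f[OF xd, consumes 1, case_names self step])
    case self
    then show ?case using xd vertex_self by (auto simp: darts_M)
  next
    case (step m)
    obtain y e where m: "m = (y, e)" by (cases m)
    have e: "e \<in> darts Q" "e \<in> vertex Q d" "d \<in> darts Q" "(y, e) \<in> darts M"
      using step xd m by (auto simp: darts_M)
    have "rot Q e \<in> vertex Q d" using e rot.f_in_orbit_iff[of d e] by (simp add: vertex_def)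
    moreover have "rprev e \<in> vertex Q d"
      using e rot.f_in_orbit_iff[of d "rprev e"] by (simp add: vertex_def rprev_simps)
    moreover have "rot M m \<in> darts M" using e m D.rot.f_in by simp
    ultimately show ?case unfolding m by (auto simp: rot_M Let_def)
  qed
qed

text \<open>Around a vertex in the outer face, the rotation goes from the outer dart
  \<open>d0\<close> of the mirror half into the half \<open>True\<close>, runs through the vertex
  there, crosses the other boundary edge and returns backwards through the mirror half. At an inner
  vertex no boundary edge is met and the half never changes.\<close>

lemma vertex_M:
  assumes xd: "(x, d) \<in> darts M"
  shows "vertex M (x, d) = vcopy x (vertex Q d)"
proof (cases "vertex Q d \<inter> Out = {}")
  case True
  have d: "d \<in> darts Q" using xd by (simp add: darts_M)
  have nb: "e \<in> darts Q \<and> \<not> boundary e" if "e \<in> vertex Q d" for e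
  proof -
    have e: "e \<in> darts Q" using that d vertex_subset by auto
    have "rot Q e \<in> vertex Q d" using that e d rot.f_in_orbit_iff[of d e] by (simp add: vertex_def)
    then show ?thesis using True that Out_rot[OF e] e by blast
  qed
  have fx: "fst m = x" if "m \<in> vertex M (x, d)" for m
    using that unfolding vertex_def
  proof (induction rule: D.rot.orbit_induct_f[OF xd, consumes 1, case_names self step])
    case (step m)
    then have "snd m \<in> vertex Q d" using vertex_M_subset[OF xd] by (auto simp: vertex_def)
    then show ?case using step nb[of "snd m"] by (cases m) (auto simp: rot_M Let_def)
  qed simp
  have xe: "(x, e) \<in> vertex M (x, d)" if "e \<in> vertex Q d" for e
    using that unfolding vertex_def
  proof (induction rule: rot.orbit_induct_f[OF d, consumes 1, case_names self step])
    case self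
    then show ?case using D.vertex_self[OF xd] by (simp add: vertex_def)
  next
    case (step e)
    have e: "e \<in> darts Q" "\<not> boundary e" "rot Q e \<in> darts Q" "\<not> boundary (rot Q e)"
      using nb[of e] nb[of "rot Q e"] step d rot.f_in_orbit_iff[of d e]
      by (auto simp: vertex_def)
    then have mm: "(x, rot Q e) \<in> darts M" by (simp add: darts_M)
    show ?case
    proof (cases x)
      case True
      then have "rot M (x, e) = (x, rot Q e)" using e by (simp add: rot_M)
      then show ?thesis using step(2) by (metis orbit.step)
    next
      case False
      then have "rot M (x, rot Q e) = (x, e)" using e by (simp add: rot_M rprev_simps)
      then show ?thesis using step(2) D.rot.f_in_orbit_iff[OF xd mm] by simp
    qed
  qed
  show ?thesis
  proof (intro equalityI subsetI)
    fix m assume m: "m \<in> vertex M (x, d)"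
    then have "fst m = x" by (rule fx)
    then show "m \<in> vcopy x (vertex Q d)"
      using m vertex_M_subset[OF xd] by (cases m) (auto simp: vcopy_def)
  next
    fix m assume "m \<in> vcopy x (vertex Q d)"
    then have "snd m \<in> vertex Q d" "fst m = x" using True by (auto simp: vcopy_def)
    then show "m \<in> vertex M (x, d)" using xe[of "snd m"] by (cases m) simp
  qed
next
  case False
  then obtain d0 where d0: "d0 \<in> Out" "d0 \<in> vertex Q d" by auto
  have d: "d \<in> darts Q" "d0 \<in> darts Q" using xd d0 Out_dart by (auto simp: darts_M)
  have v: "vertex Q d0 = vertex Q d" using d d0 vertex_eq_iff by simp
  let ?O = "orbit (rot M) (False, d0)"
  have F0: "(False, d0) \<in> darts M" using d0 d Out_oinv by (simp add: darts_M)
  have eq_d0: "e = d0" if "e \<in> Out" "e \<in> vertex Q d" for e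
    using Out_unique[OF that(1) d0(1)] that v vertex_eq_iff[of e d] d Out_dart by auto
  have step_in: "rot Q e \<in> vertex Q d" if "e \<in> vertex Q d" for e
    using that d rot.f_in_orbit_iff[of d e] vertex_subset[OF d(1)] by (auto simp: vertex_def)
  have T: "e \<notin> Out \<longrightarrow> (True, e) \<in> ?O" if "e \<in> orbit (rot Q) d0" for e
    using that
  proof (induction rule: rot.orbit_induct_f[OF d(2), consumes 1, case_names self step])
    case (step e)
    have e: "e \<in> darts Q" "e \<in> vertex Q d"
      using step d v rot.orbit_in_S by (auto simp: vertex_def)
    show ?case
    proof
      assume "rot Q e \<notin> Out"
      then have o: "oinv Q e \<notin> Out" using e by (simp add: Out_rot)
      show "(True, rot Q e) \<in> ?O"
      proof (cases "e \<in> Out")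
        case True
        then have "e = d0" using e eq_d0 by simp
        then have "rot M (False, d0) = (True, rot Q e)" using d0 by (simp add: rot_M)
        then show ?thesis by (metis orbit.base)
      next
        case False
        then have "rot M (True, e) = (True, rot Q e)" using o by (simp add: rot_M)
        then show ?thesis using step(2) False by (metis orbit.step)
      qed
    qed
  qed (use d0 in simp)
  \<comment> \<open>In the mirror half the rotation runs against \<open>rot Q\<close>, so membership
    in the orbit is pulled back along it.\<close>
  have F: "oinv Q e \<notin> Out \<longrightarrow> (False, e) \<in> ?O" if "e \<in> orbit (rot Q) d0" for e
    using that
  proof (induction rule: rot.orbit_induct_f[OF d(2), consumes 1, case_names self step])
    case self
    then show ?case using D.rot.self_in_orbit[OF F0] by simp
  next
    case (step e)
    have e: "e \<in> darts Q" "e \<in> vertex Q d"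
      using step d v rot.orbit_in_S by (auto simp: vertex_def)
    show ?case
    proof
      assume o: "oinv Q (rot Q e) \<notin> Out"
      show "(False, rot Q e) \<in> ?O"
      proof (cases "oinv Q e \<in> Out")
        case True
        then have "rot Q e = d0" using e eq_d0 step_in by (simp add: Out_rot)
        then show ?thesis using D.rot.self_in_orbit[OF F0] by simp
      next
        case False
        then have "rot M (False, rot Q e) = (False, e)"
          using o e by (simp add: rot_M rprev_simps Out_rot)
        moreover have "(False, rot Q e) \<in> darts M" using o e by (simp add: darts_M rot.f_in)
        ultimately show ?thesis using step(2) False D.rot.f_in_orbit_iff[OF F0] by metis
      qed
    qed
  qed
  have "{(y, e) \<in> darts M. e \<in> vertex Q d} \<subseteq> vertex M (False, d0)"
  proof (rule subsetI, clarify)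
    fix y e assume "(y, e) \<in> darts M" "e \<in> vertex Q d"
    then show "(y, e) \<in> vertex M (False, d0)"
      using T[of e] F[of e] v by (cases y) (auto simp: vertex_def darts_M)
  qed
  moreover have "vertex M (False, d0) = vertex M (x, d)"
    using D.vertex_eq_iff[OF xd F0] calculation xd vertex_self[OF d(1)] by auto
  ultimately show ?thesis using vertex_M_subset[OF xd] False unfolding vcopy_def by auto
qed

lemma vcopy_boundary: "v \<inter> Out \<noteq> {} \<Longrightarrow> vcopy x v = vcopy y v"
  by (auto simp: vcopy_def)

lemma vcopy_dart:
  assumes "v \<in> vertices Q"
  obtains y d where "(y, d) \<in> darts M" "(y, d) \<in> vcopy x v" "d \<in> v" "vertex Q d = v"
proof (cases "v \<inter> Out = {}")
  case True
  obtain d where d: "d \<in> darts Q" "v = vertex Q d" using assms by (rule verticesE)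
  have "\<not> boundary d" using boundary_vertex[OF d(1)] True d by blast
  then have "(x, d) \<in> darts M" using d by (simp add: darts_M)
  then show ?thesis using that d vertex_self[OF d(1)] by (auto simp: vcopy_def)
next
  case False
  then obtain d where d: "d \<in> v" "d \<in> Out" by auto
  then have "(False, d) \<in> darts M" using Out_dart Out_oinv by (simp add: darts_M)
  then show ?thesis using that d False vertex_eqI[OF assms d(1)] by (auto simp: vcopy_def)
qed

lemma vertices_M: "vertices M = {vcopy x v | x v. v \<in> vertices Q}"
proof (intro equalityI subsetI)
  fix V assume "V \<in> vertices M"
  then show "V \<in> {vcopy x v | x v. v \<in> vertices Q}"
    by (auto simp: vertices_def[of M] vertex_M) (auto simp: darts_M intro: vertex_in_vertices)
next
  fix V assume "V \<in> {vcopy x v | x v. v \<in> vertices Q}"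
  then obtain x v where V: "V = vcopy x v" "v \<in> vertices Q" by blast
  then obtain y d where yd: "(y, d) \<in> darts M" "(y, d) \<in> vcopy x v" "vertex Q d = v"
    by (metis vcopy_dart)
  then have "vertex M (y, d) = vcopy y v" by (simp add: vertex_M)
  also have "\<dots> = V" using yd vcopy_boundary V by (cases "v \<inter> Out = {}") (auto simp: vcopy_def)
  finally show "V \<in> vertices M" using yd D.vertex_in_vertices by metis
qed

lemma vcopy_eq_iff:
  assumes "v \<in> vertices Q" "w \<in> vertices Q"
  shows "vcopy x v = vcopy y w \<longleftrightarrow> v = w \<and> (v \<inter> Out = {} \<longrightarrow> x = y)"
proof
  assume eq: "vcopy x v = vcopy y w"
  obtain z d where zd: "(z, d) \<in> vcopy x v" "d \<in> v" using assms(1) by (metis vcopy_dart)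
  then have "d \<in> w" using eq by (auto simp: vcopy_def)
  then have "v = w" using zd vertex_eqI assms by metis
  then show "v = w \<and> (v \<inter> Out = {} \<longrightarrow> x = y)" using eq zd by (auto simp: vcopy_def)
qed (use vcopy_boundary in blast)

lemma vtype_vcopy:
  assumes "v \<in> vertices Q"
  shows "vtype M (vcopy x v) = vtype Q v"
proof -
  obtain z d where zd: "(z, d) \<in> vcopy x v" "d \<in> v" using assms(1) by (metis vcopy_dart)
  have "(\<lambda>(x, d). vtype Q (vertex Q d)) ` vcopy x v = {vtype Q v}"
  proof
    show "(\<lambda>(x, d). vtype Q (vertex Q d)) ` vcopy x v \<subseteq> {vtype Q v}"
      using vertex_eqI[OF assms] by (auto simp: vcopy_def)
    show "{vtype Q v} \<subseteq> (\<lambda>(x, d). vtype Q (vertex Q d)) ` vcopy x v"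
      using zd vertex_eqI[OF assms zd(2)] by (auto intro!: rev_image_eqI)
  qed
  then show ?thesis by (simp add: vtype_M)
qed

lemma start_type_M: "(x, d) \<in> darts M \<Longrightarrow> start_type M (x, d) = start_type Q d"
  by (auto simp: start_type_def vertex_M vtype_vcopy vertex_in_vertices darts_M)

lemma end_vertex_M:
  assumes "(x, d) \<in> darts M"
  shows "end_vertex M (x, d) = vcopy x (end_vertex Q d)"
proof -
  have d: "d \<in> darts Q" using assms by (simp add: darts_M)
  have "end_vertex M (x, d) = vcopy (if boundary d then \<not> x else x) (end_vertex Q d)"
    using D.oinv_in[OF assms] by (simp add: end_vertex_def oinv_M vertex_M)
  then show ?thesis
    using boundary_vertex[OF d] vcopy_boundary[of "end_vertex Q d" "\<not> x" x] by (simp split: if_splits)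
qed

lemma end_type_M: "(x, d) \<in> darts M \<Longrightarrow> end_type M (x, d) = end_type Q d"
  by (auto simp: end_type_def end_vertex_M vtype_vcopy end_vertex_in_vertices darts_M)

lemma special_M_vcopy: "i < 3 \<Longrightarrow> special M i = vcopy x (special Q i)"
  using special_Out[of i] by (auto simp: special_M vcopy_def)

text \<open>If \<open>oinv\<close> changes the half, the following rotation crosses the same edge
  again and undoes the change.\<close>

lemma face_next_M:
  assumes "(x, d) \<in> darts M"
  shows "face_next M (x, d) = (x, if x then face_next Q d else rprev (oinv Q d))"
proof -
  have d: "d \<in> darts Q" using assms by (simp only: darts_M)
  define y where "y = (if boundary d then \<not> x else x)"
  have "boundary (oinv Q d) \<longleftrightarrow> boundary d" unfolding oinv_oinv[OF d] by blast
  then have "(if boundary (oinv Q d) then \<not> y else y) = x" unfolding y_def by simp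
  then show ?thesis
    unfolding face_next_def oinv_M y_def[symmetric] rot_M Let_def by simp
qed

text \<open>In the mirror half a facial walk visits the inverse darts in reversed order, hence the
  use of the inverse of \<open>face_next\<close>.\<close>

lemma face_M:
  assumes xd: "(x, d) \<in> darts M"
  shows "face M (x, d) = fcopy x (face Q (if x then d else oinv Q d))"
proof -
  define f where "f = (if x then d else oinv Q d)"
  have d: "d \<in> darts Q" "f \<in> darts Q" "(x, d) = (x, if x then f else oinv Q f)"
    using xd oinv_in[of d] oinv_oinv[of d] by (auto simp: darts_M f_def)
  have f: "f \<notin> Out" using xd by (auto simp: darts_M f_def split: if_splits)
  have fO: "g \<in> darts Q \<and> g \<notin> Out" if "g \<in> orbit (face_next Q) f" for g
    using fn.orbit_in_S[OF that d(2)] that d f face_eq_Out[of f] face_eqI[OF Out_face, of g]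
      face_eqI[OF face_in_faces[OF d(2)], of g] by (auto simp: face_def)
  have step_eq: "face_next M (x, if x then g else oinv Q g) =
      (x, if x then face_next Q g else oinv Q (inv_into (darts Q) (face_next Q) g))"
    if "g \<in> darts Q" "g \<notin> Out" for g
  proof -
    define h where "h = inv_into (darts Q) (face_next Q) g"
    have h: "h \<in> darts Q" "face_next Q h = g"
      using that unfolding h_def by (auto simp: fn.inv_into_in fn.f_inv_into)
    have "rprev g = oinv Q h" using h rprev_simps(3)[OF oinv_in[OF h(1)]] by (simp add: face_next_def)
    moreover have "(x, if x then g else oinv Q g) \<in> darts M"
      using that by (auto simp: darts_M oinv_in oinv_oinv)
    ultimately show ?thesis using that by (simp add: face_next_M h_def oinv_oinv)
  qed
  have 1: "(x, if x then g else oinv Q g) \<in> face M (x, d)" if "g \<in> orbit (face_next Q) f" for g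
    using that
  proof (induction rule: fn.orbit_induct_f[OF d(2), consumes 1, case_names self step])
    case self
    then show ?case using D.face_self[OF xd] d(3) by metis
  next
    case (step g)
    have g: "g \<in> darts Q" "g \<notin> Out" using fO step by auto
    have g': "face_next Q g \<in> darts Q" "face_next Q g \<notin> Out" using g by (auto simp: fn.f_in Out_face_next)
    show ?case
    proof (cases x)
      case True
      then have "(x, if x then face_next Q g else oinv Q (face_next Q g)) =
          face_next M (x, if x then g else oinv Q g)"
        using step_eq[OF g] by simp
      then show ?thesis using step(2) unfolding face_def by (simp only: orbit.step)
    next
      case False
      have "(x, oinv Q (face_next Q g)) \<in> darts M"
        using False g' by (simp add: darts_M oinv_in oinv_oinv)
      moreover have "face_next M (x, oinv Q (face_next Q g)) = (x, oinv Q g)"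
        using step_eq[OF g'] False g by (simp add: fn.inv_into_f)
      ultimately show ?thesis
        using step(2) D.fn.f_in_orbit_iff[OF xd, of "(x, oinv Q (face_next Q g))"] False
        unfolding face_def by simp
    qed
  qed
  have 2: "m \<in> fcopy x (face Q f)" if "m \<in> orbit (face_next M) (x, d)" for m
    using that
  proof (induction rule: D.fn.orbit_induct_f[OF xd, consumes 1, case_names self step])
    case self
    then show ?case using d(3) face_self[OF d(2)] by (auto simp: fcopy_def)
  next
    case (step m)
    then obtain g where g: "g \<in> face Q f" "m = (x, if x then g else oinv Q g)" by (auto simp: fcopy_def)
    have gD: "g \<in> darts Q" "g \<notin> Out" using g fO by (auto simp: face_def)
    have "face_next Q g \<in> face Q f"
      using g gD fn.f_in_orbit_iff[OF d(2), of g] by (simp add: face_def)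
    moreover have "inv_into (darts Q) (face_next Q) g \<in> face Q f"
      using g gD fn.f_in_orbit_iff[OF d(2), of "inv_into (darts Q) (face_next Q) g"]
      by (simp add: face_def fn.inv_into_in fn.f_inv_into)
    ultimately show ?case unfolding g(2) step_eq[OF gD] fcopy_def by auto
  qed
  show ?thesis
    using 1 2 unfolding f_def[symmetric] by (auto simp: face_def fcopy_def)
qed

lemma faces_M: "faces M = {fcopy x C | x C. C \<in> faces Q - {Out}}"
proof (intro equalityI subsetI)
  fix V assume "V \<in> faces M"
  then obtain x d where xd: "(x, d) \<in> darts M" "V = face M (x, d)" by (auto simp: faces_def)
  then have "face Q (if x then d else oinv Q d) \<in> faces Q - {Out}"
    by (auto simp: darts_M oinv_in face_in_faces face_eq_Out)
  then show "V \<in> {fcopy x C | x C. C \<in> faces Q - {Out}}"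
    using xd face_M by blast
next
  fix V assume "V \<in> {fcopy x C | x C. C \<in> faces Q - {Out}}"
  then obtain x C where V: "V = fcopy x C" "C \<in> faces Q" "C \<noteq> Out" by blast
  then obtain f where f: "f \<in> darts Q" "C = face Q f" by (auto simp: faces_def)
  then have "f \<notin> Out" using V face_eq_Out by simp
  then have m: "(x, if x then f else oinv Q f) \<in> darts M"
    using f by (auto simp: darts_M oinv_in oinv_oinv)
  then have "face M (x, if x then f else oinv Q f) = V"
    using f V by (simp add: face_M oinv_oinv)
  then show "V \<in> faces M" using m D.face_in_faces by metis
qed

lemma fcopy_eq_iff:
  assumes "C \<in> faces Q" "C' \<in> faces Q"
  shows "fcopy x C = fcopy y C' \<longleftrightarrow> x = y \<and> C = C'"
proof
  assume eq: "fcopy x C = fcopy y C'"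
  obtain d where d: "d \<in> C" using faces_nonempty[OF assms(1)] by auto
  then have "(x, if x then d else oinv Q d) \<in> fcopy x C" unfolding fcopy_def by (rule imageI)
  then have "(x, if x then d else oinv Q d) \<in> fcopy y C'" using eq by simp
  then obtain e where e: "e \<in> C'" "x = y" "(if x then d else oinv Q d) = (if y then e else oinv Q e)"
    by (auto simp: fcopy_def)
  have "d \<in> darts Q" "e \<in> darts Q" using d e faces_subset assms by auto
  then have "d = e" using e oinv_oinv by (metis)
  then show "x = y \<and> C = C'" using d e face_eqI assms by metis
qed simp

lemma card_fcopy: "C \<in> faces Q \<Longrightarrow> card (fcopy x C) = card C"
proof -
  assume C: "C \<in> faces Q"
  have "inj_on (\<lambda>d. (x, if x then d else oinv Q d)) C"
  proof (rule inj_onI)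
    fix d e assume de: "d \<in> C" "e \<in> C" "(x, if x then d else oinv Q d) = (x, if x then e else oinv Q e)"
    have "d \<in> darts Q" "e \<in> darts Q" using faces_subset[OF C] de by auto
    then show "d = e" using de(3) oinv_oinv by (metis Pair_inject)
  qed
  then show ?thesis unfolding fcopy_def by (rule card_image)
qed

lemma card_vcopy_inner: "v \<in> vertices Q \<Longrightarrow> v \<inter> Out = {} \<Longrightarrow> card (vcopy x v) = card v"
proof -
  assume v: "v \<in> vertices Q" "v \<inter> Out = {}"
  have "(x, d) \<in> darts M" if "d \<in> v" for d
  proof -
    have d: "d \<in> darts Q" "vertex Q d = v" using that v vertices_subset vertex_eqI by auto
    then have "\<not> boundary d" using boundary_vertex[OF d(1)] v by auto
    then show ?thesis using d by (simp add: darts_M)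
  qed
  then have "vcopy x v = (\<lambda>d. (x, d)) ` v" using v by (auto simp: vcopy_def)
  then show ?thesis by (simp add: card_image inj_on_def)
qed

text \<open>The half \<open>True\<close> lacks the outer dart \<open>d0\<close> and the mirror half
  lacks its predecessor \<open>e0\<close>. Degree 3 thus becomes 4 and degree 2 remains 2, as the
  vertices of type 1 require.\<close>

lemma card_vcopy_boundary:
  assumes v: "v \<in> vertices Q" "v \<inter> Out \<noteq> {}"
  shows "card (vcopy x v) = 2 * (card v - 1)"
proof -
  obtain d0 where d0: "d0 \<in> v" "d0 \<in> Out" using v by auto
  have sub: "v \<subseteq> darts Q" using v by (simp add: vertices_subset)
  then have fin: "finite v" using finite_darts finite_subset by auto
  have d0D: "d0 \<in> darts Q" using d0 Out_dart by simp
  have vv: "v = vertex Q d0" using v d0 vertex_eqI by simp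
  define e0 where "e0 = rprev d0"
  have e0: "e0 \<in> darts Q" "rot Q e0 = d0" using d0D by (auto simp: e0_def rprev_simps)
  have e0v: "e0 \<in> v" using e0 d0D rot.f_in_orbit_iff[of d0 e0] d0 vv by (simp add: vertex_def)
  have T: "d \<in> Out \<longleftrightarrow> d = d0" if "d \<in> v" for d
    using that d0 Out_unique vertex_eqI[OF v(1)] by metis
  have F: "oinv Q d \<in> Out \<longleftrightarrow> d = e0" if "d \<in> v" for d
  proof -
    have d: "d \<in> darts Q" using that sub by auto
    have "rot Q d \<in> v" using that d d0D rot.f_in_orbit_iff[of d0 d] vv by (simp add: vertex_def)
    then show ?thesis using T[of "rot Q d"] d e0 rot.f_eq_iff[of d e0] Out_rot[OF d] by auto
  qed
  have "(y, d) \<in> vcopy x v \<longleftrightarrow> (y, d) \<in> Pair True ` (v - {d0}) \<union> Pair False ` (v - {e0})" for y d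
    unfolding vcopy_def using T[of d] F[of d] sub v(2) by (cases y) (auto simp: darts_M)
  then have "vcopy x v = Pair True ` (v - {d0}) \<union> Pair False ` (v - {e0})" by auto
  moreover have "card (Pair True ` (v - {d0}) \<union> Pair False ` (v - {e0})) =
      card (Pair True ` (v - {d0})) + card (Pair False ` (v - {e0}))"
    using fin by (intro card_Un_disjoint) auto
  ultimately show ?thesis using fin d0 e0v by (simp add: card_image inj_on_def)
qed

section \<open>Euler's formula and connectedness for the double\<close>

lemma card_darts_M: "card (darts M) = 2 * (card (darts Q) - card Out)"
proof -
  have "bij_betw (\<lambda>(x, d). (x, if x then d else oinv Q d)) (UNIV \<times> (darts Q - Out)) (darts M)"
    by (rule bij_betwI[where g = "\<lambda>(x, d). (x, if x then d else oinv Q d)"])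
      (auto simp: darts_M oinv_in oinv_oinv split: if_splits)
  then have "card (UNIV \<times> (darts Q - Out) :: (bool \<times> 'a) set) = card (darts M)" by (rule bij_betw_same_card)
  then show ?thesis
    using card_Diff_subset[OF finite_subset[OF Out_subset finite_darts] Out_subset]
    by (simp add: card_cartesian_product)
qed

lemma card_faces_M: "card (faces M) = 2 * (card (faces Q) - 1)"
proof -
  have "faces M = (\<lambda>(x, C). fcopy x C) ` (UNIV \<times> (faces Q - {Out}))"
    unfolding faces_M by auto
  moreover have "inj_on (\<lambda>(x, C). fcopy x C) (UNIV \<times> (faces Q - {Out}))"
    by (rule inj_onI) (auto simp: fcopy_eq_iff)
  ultimately show ?thesis
    using Out_face finite_faces by (simp add: card_image card_cartesian_product)
qed

text \<open>The vertices that are not doubled are those of a simple cycle with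
  \<open>card Out\<close> darts.\<close>

lemma card_vertices_M: "card (vertices M) + card Out = 2 * card (vertices Q)"
proof -
  define I B where "I = {v \<in> vertices Q. v \<inter> Out = {}}" and "B = {v \<in> vertices Q. v \<inter> Out \<noteq> {}}"
  have fin: "finite I" "finite B" using finite_vertices by (auto simp: I_def B_def)
  have "bij_betw (vertex Q) Out B"
    unfolding bij_betw_def
  proof
    show "inj_on (vertex Q) Out" by (rule inj_onI) (rule Out_unique)
    show "vertex Q ` Out = B"
    proof
      show "vertex Q ` Out \<subseteq> B"
        using Out_dart vertex_self vertex_in_vertices by (fastforce simp: B_def)
      show "B \<subseteq> vertex Q ` Out"
      proof
        fix v assume "v \<in> B"
        then obtain d where "d \<in> v" "d \<in> Out" "v \<in> vertices Q" by (auto simp: B_def)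
        then show "v \<in> vertex Q ` Out" using vertex_eqI by auto
      qed
    qed
  qed
  then have cB: "card B = card Out" by (metis bij_betw_same_card)
  have "vertices Q = I \<union> B" "I \<inter> B = {}" by (auto simp: I_def B_def)
  then have cV: "card (vertices Q) = card I + card B" using fin by (simp add: card_Un_disjoint)
  have "vertices M = (\<lambda>(x, v). vcopy x v) ` (UNIV \<times> I) \<union> vcopy True ` B"
  proof (intro equalityI subsetI)
    fix V assume "V \<in> vertices M"
    then obtain x v where V: "V = vcopy x v" "v \<in> vertices Q" by (auto simp: vertices_M)
    then show "V \<in> (\<lambda>(x, v). vcopy x v) ` (UNIV \<times> I) \<union> vcopy True ` B"
      using vcopy_boundary[of v x True] by (cases "v \<in> I") (auto simp: I_def B_def)
  qed (auto simp: vertices_M I_def B_def)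
  moreover have "(\<lambda>(x, v). vcopy x v) ` (UNIV \<times> I) \<inter> vcopy True ` B = {}"
    by (auto simp: vcopy_eq_iff I_def B_def)
  moreover have "card ((\<lambda>(x, v). vcopy x v) ` (UNIV \<times> I)) = 2 * card I"
    by (subst card_image) (auto simp: inj_on_def vcopy_eq_iff I_def card_cartesian_product)
  moreover have "card (vcopy True ` B) = card B"
    by (subst card_image) (auto simp: inj_on_def vcopy_eq_iff B_def)
  ultimately have "card (vertices M) = 2 * card I + card B"
    using fin by (simp add: card_Un_disjoint)
  then show ?thesis using cB cV by simp
qed

text \<open>Compared with two disjoint copies, \<open>card Out\<close> vertices,
  \<open>2 * card Out\<close> darts and the two outer faces disappear; the terms in
  \<open>card Out\<close> cancel.\<close>

lemma euler_M: "2 * card (vertices M) + 2 * card (faces M) = card (darts M) + 4"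
proof -
  have "card (faces Q) \<ge> 1" using Out_face finite_faces by (auto simp: Suc_le_eq card_gt_0_iff)
  moreover have "card Out \<le> card (darts Q)" using Out_subset finite_darts by (rule card_mono[rotated])
  ultimately show ?thesis
    using euler card_vertices_M card_faces_M card_darts_M by linarith
qed

text \<open>A boundary dart is present in one half only, but its two ends are shared, so it serves
  both halves.\<close>

lemma dart_copy:
  assumes "d \<in> darts Q"
  obtains m where "m \<in> darts M" "vertex M m = vcopy x (vertex Q d)" "end_vertex M m = vcopy x (end_vertex Q d)"
proof (cases "(x, d) \<in> darts M")
  case True
  then show ?thesis using that[of "(x, d)"] by (simp add: vertex_M end_vertex_M)
next
  case False
  then have b: "boundary d" using assms by (auto simp: darts_M split: if_splits)
  then have m: "(\<not> x, d) \<in> darts M" using assms Out_oinv[of d] False by (auto simp: darts_M)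
  then show ?thesis
    using that[of "(\<not> x, d)"] boundary_vertex[OF assms b] vcopy_boundary
    by (metis vertex_M end_vertex_M)
qed

text \<open>Deleting one vertex of the double removes at most one vertex from each half, so each
  half stays connected, and the halves still share a special vertex.\<close>

lemma connected_on_M:
  assumes "R = {} \<or> R = {w}"
  shows "connected_on M (vertices M - R)"
proof (rule D.connected_onI)
  fix P U V
  assume U: "U \<in> vertices M - R" and V: "V \<in> vertices M - R" and "P U"
    and step: "\<And>d. d \<in> darts M \<Longrightarrow> vertex M d \<in> vertices M - R \<Longrightarrow> end_vertex M d \<in> vertices M - R \<Longrightarrow>
         P (vertex M d) \<longleftrightarrow> P (end_vertex M d)"
  define W where "W x = {v \<in> vertices Q. vcopy x v \<notin> R}" for x
  have conn: "connected_on Q (W x)" for x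
  proof (cases "\<exists>v\<in>vertices Q. vcopy x v \<in> R")
    case True
    then obtain v where v: "v \<in> vertices Q" "vcopy x v \<in> R" by blast
    then have "W x = vertices Q - {v}"
      using assms by (auto simp: W_def vcopy_eq_iff)
    then show ?thesis using two_connected_Q(3)[OF v(1)] by simp
  next
    case False
    then have "W x = vertices Q" by (auto simp: W_def)
    then show ?thesis using two_connected_Q(2) by simp
  qed
  have eq: "P (vcopy x u) \<longleftrightarrow> P (vcopy x v)" if "u \<in> W x" "v \<in> W x" for x u v
  proof (rule connected_on_closed[OF conn that(2,1), where P = "\<lambda>u. P (vcopy x u) \<longleftrightarrow> P (vcopy x v)"])
    fix d assume d: "d \<in> darts Q" "vertex Q d \<in> W x" "end_vertex Q d \<in> W x"
      "P (vcopy x (vertex Q d)) \<longleftrightarrow> P (vcopy x v)"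
    obtain m where m: "m \<in> darts M" "vertex M m = vcopy x (vertex Q d)" "end_vertex M m = vcopy x (end_vertex Q d)"
      using d(1) by (rule dart_copy)
    then show "P (vcopy x (end_vertex Q d)) \<longleftrightarrow> P (vcopy x v)"
      using step[of m] d D.vertex_in_vertices[of m] D.end_vertex_in_vertices[of m] by (simp add: W_def)
  qed simp
  have "\<exists>i<3. special M i \<notin> R"
  proof (rule ccontr)
    assume "\<not> ?thesis"
    then have *: "special M i \<in> R" if "i < 3" for i using that by blast
    have "special M 0 = w" "special M 1 = w" using *[of 0] *[of 1] assms by auto
    then have "vcopy True (special Q 0) = vcopy True (special Q 1)"
      using special_M_vcopy[of 0 True] special_M_vcopy[of 1 True] by simp
    then show False using special_vertex[of 0] special_vertex[of 1] special_inj[of 0 1]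
      by (simp add: vcopy_eq_iff)
  qed
  then obtain i where i: "i < 3" "special M i \<notin> R" by blast
  have b: "special Q i \<in> W x" "vcopy x (special Q i) = special M i" for x
    using i special_vertex special_M_vcopy[OF i(1), of x] by (auto simp: W_def)
  have all: "P X \<longleftrightarrow> P (special M i)" if X: "X \<in> vertices M - R" for X
  proof -
    obtain x v where "X = vcopy x v" "v \<in> W x" using X by (auto simp: vertices_M W_def)
    then show ?thesis using eq[of v x "special Q i"] b by simp
  qed
  show "P V" using all[OF U] all[OF V] \<open>P U\<close> by simp
qed auto

sublocale D: plane_map M
proof unfold_locales
  show "connected_via M (darts M)"
    using connected_on_M[of "{}"] by (simp add: D.connected_via_iff)
qed (rule euler_M)

lemma lsp_conditions: "vtype Q (special Q 0) \<noteq> 1" "vtype Q (special Q 2) \<noteq> 1"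
    "vtype Q (special Q 1) = 1 \<Longrightarrow> card (special Q 1) = 2"
    "C \<in> faces Q \<Longrightarrow> C \<noteq> Out \<Longrightarrow> card C = 3"
    "v \<in> vertices Q \<Longrightarrow> vtype Q v = 1 \<Longrightarrow> v \<inter> Out = {} \<Longrightarrow> card v = 4"
    "v \<in> vertices Q \<Longrightarrow> vtype Q v = 1 \<Longrightarrow> v \<inter> Out \<noteq> {} \<Longrightarrow> v \<notin> special Q ` {0, 1, 2} \<Longrightarrow> card v = 3"
proof -
  note l = lsp_operation[unfolded lsp_operation_def]
  show "vtype Q (special Q 0) \<noteq> 1" using l by (elim conjE)
  show "vtype Q (special Q 2) \<noteq> 1" using l by (elim conjE)
  have "vtype Q (special Q 1) = 1 \<longrightarrow> card (special Q 1) = 2" using l by (elim conjE)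
  then show "vtype Q (special Q 1) = 1 \<Longrightarrow> card (special Q 1) = 2" by blast
  have "\<forall>C\<in>faces Q - {outer Q}. card C = 3" using l by (elim conjE)
  then show "C \<in> faces Q \<Longrightarrow> C \<noteq> Out \<Longrightarrow> card C = 3" by blast
  have "\<forall>v\<in>vertices Q. vtype Q v = 1 \<and> v \<inter> outer Q = {} \<longrightarrow> card v = 4" using l by (elim conjE)
  then show "v \<in> vertices Q \<Longrightarrow> vtype Q v = 1 \<Longrightarrow> v \<inter> Out = {} \<Longrightarrow> card v = 4" by blast
  have "\<forall>v\<in>vertices Q. vtype Q v = 1 \<and> v \<inter> outer Q \<noteq> {} \<and> v \<notin> special Q ` {0, 1, 2}
        \<longrightarrow> card v = 3" using l by (elim conjE)
  then show "v \<in> vertices Q \<Longrightarrow> vtype Q v = 1 \<Longrightarrow> v \<inter> Out \<noteq> {} \<Longrightarrow>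
      v \<notin> special Q ` {0, 1, 2} \<Longrightarrow> card v = 3" by blast
qed

theorem lopsp_operation_M: "lopsp_operation M"
proof -
  have 3: "i < 3 \<longleftrightarrow> i \<in> {0, 1, 2}" for i :: nat by auto
  have sV: "special M i \<in> vertices M" if "i < 3" for i
    using special_M_vcopy[OF that, of True] special_vertex[OF that] by (auto simp: vertices_M)
  have inj: "inj_on (special M) {0, 1, 2}"
  proof (rule inj_onI)
    fix i j :: nat assume ij: "i \<in> {0, 1, 2}" "j \<in> {0, 1, 2}" "special M i = special M j"
    then have "i < 3" "j < 3" by auto
    then show "i = j"
      using ij special_M_vcopy[of _ True] special_vertex special_inj by (simp add: vcopy_eq_iff)
  qed
  have tc: "two_connected M"
    unfolding two_connected_def
  proof (intro conjI ballI)
    have "card (special M ` {0, 1, 2}) \<le> card (vertices M)"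
      using sV D.finite_vertices by (intro card_mono) auto
    then show "3 \<le> card (vertices M)" using inj by (simp add: card_image)
    show "connected_on M (vertices M)" using connected_on_M[of "{}"] by simp
    show "connected_on M (vertices M - {x})" for x using connected_on_M[of "{x}"] by simp
  qed
  have "plane M"
  proof -
    have "2 + card (edges M) = card (vertices M) + card (faces M)"
      using euler_M D.card_edges by simp
    then have "real (2 + card (edges M)) = real (card (vertices M) + card (faces M))"
      by (simp only: of_nat_eq_iff)
    then show ?thesis by (simp add: plane_def genus_def)
  qed
  moreover have "embedded_graph M"
    unfolding embedded_graph_def
  proof (intro conjI ballI)
    show "darts M \<noteq> {}" using sV[of 0] by (auto simp: vertices_def)
    show "connected_on M (vertices M)" using connected_on_M[of "{}"] by simp
  qed (auto simp: D.finite_darts D.oinv_in D.oinv_ne D.oinv_oinv D.rot_bij)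
  moreover have "\<forall>v\<in>vertices M. vtype M v \<in> {0, 1, 2}"
  proof
    fix V assume "V \<in> vertices M"
    then obtain x v where "V = vcopy x v" "v \<in> vertices Q" by (auto simp: vertices_M)
    then show "vtype M V \<in> {0, 1, 2}" using vtype_le[of v] vtype_vcopy[of v x] by simp
  qed
  moreover have "special M ` {0, 1, 2} \<subseteq> vertices M" using sV by auto
  moreover have "\<forall>C\<in>faces M. card C = 3"
  proof
    fix V assume "V \<in> faces M"
    then obtain x C where "V = fcopy x C" "C \<in> faces Q" "C \<noteq> Out" by (auto simp: faces_M)
    then show "card V = 3" using card_fcopy[of C x] lsp_conditions(4)[of C] by simp
  qed
  moreover have "\<forall>d\<in>darts M. start_type M d \<noteq> end_type M d"
  proof
    fix d assume "d \<in> darts M"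
    then show "start_type M d \<noteq> end_type M d"
      using types_differ by (cases d) (auto simp: start_type_M end_type_M darts_M)
  qed
  moreover have "\<forall>v\<in>vertices M. vtype M v = 1 \<and> v \<notin> special M ` {0, 1, 2} \<longrightarrow> card v = 4"
  proof (intro ballI impI)
    fix V assume V: "V \<in> vertices M" "vtype M V = 1 \<and> V \<notin> special M ` {0, 1, 2}"
    then obtain x v where v: "V = vcopy x v" "v \<in> vertices Q" by (auto simp: vertices_M)
    then have t: "vtype Q v = 1" using V vtype_vcopy by simp
    show "card V = 4"
    proof (cases "v \<inter> Out = {}")
      case True
      then show ?thesis using v t card_vcopy_inner lsp_conditions(5) by simp
    next
      case False
      have "v \<notin> special Q ` {0, 1, 2}"
        using V(2) v special_M_vcopy[of _ x] by auto
      then show ?thesis using False v t card_vcopy_boundary lsp_conditions(6) by simp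
    qed
  qed
  moreover have "vtype M (special M i) = vtype Q (special Q i)" if "i < 3" for i
    using special_M_vcopy[OF that, of True] special_vertex[OF that] vtype_vcopy by simp
  moreover have "card (special M 1) = 2 * (card (special Q 1) - 1)"
    using special_M_vcopy[of 1 True] special_vertex[of 1] special_Out[of 1] card_vcopy_boundary by simp
  ultimately show ?thesis
    unfolding lopsp_operation_def using tc inj lsp_conditions(1-3) by simp
qed

end

section \<open>Chambers and double chambers of an embedded graph\<close>

lemma orbit_three:
  assumes "f x = y" "f y = z" "f z = x"
  shows "orbit f x = {x, y, z}"
proof -
  have *: "\<forall>m. (f ^^ m) x \<in> {x, y, z}"
  proof
    show "(f ^^ m) x \<in> {x, y, z}" for m by (induction m) (use assms in auto)
  qed
  have "y \<in> orbit f x" using assms by (metis orbit.base)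
  then have "z \<in> orbit f x" using assms by (metis orbit.step)
  then have "x \<in> orbit f x" using assms by (metis orbit.step)
  then show ?thesis
    using * \<open>y \<in> orbit f x\<close> \<open>z \<in> orbit f x\<close> by (auto simp: orbit_altdef)
qed

lemma orbit_four:
  assumes "f x = y" "f y = z" "f z = u" "f u = x"
  shows "orbit f x = {x, y, z, u}"
proof -
  have *: "\<forall>m. (f ^^ m) x \<in> {x, y, z, u}"
  proof
    show "(f ^^ m) x \<in> {x, y, z, u}" for m by (induction m) (use assms in auto)
  qed
  have "y \<in> orbit f x" using assms by (metis orbit.base)
  then have "z \<in> orbit f x" using assms by (metis orbit.step)
  then have "u \<in> orbit f x" using assms by (metis orbit.step)
  then have "x \<in> orbit f x" using assms by (metis orbit.step)
  then show ?thesis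
    using * \<open>y \<in> orbit f x\<close> \<open>z \<in> orbit f x\<close> \<open>u \<in> orbit f x\<close> by (auto simp: orbit_altdef)
qed

context emap
begin

abbreviation "B \<equiv> barycentric M"
abbreviation "DS \<equiv> double_chamber_system M"
abbreviation "prev \<equiv> inv_into (darts M) (rot M)"

text \<open>Chambers are named after the dart of their 2-edge: \<open>pos_chamber e\<close> and
  \<open>neg_chamber e\<close> lie on its two sides.\<close>

definition pos_chamber :: "'d \<Rightarrow> ('d \<times> nat \<times> nat) set" where
  "pos_chamber e = {(e, 0, 1), (e, 1, 2), (e, 2, 0)}"

definition neg_chamber :: "'d \<Rightarrow> ('d \<times> nat \<times> nat) set" where
  "neg_chamber e = {(e, 1, 0), (rot M e, 0, 2), (oinv M e, 2, 1)}"

text \<open>The union of \<open>pos_chamber e\<close> and its 0-neighbour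
  \<open>neg_chamber (oinv M e)\<close>, without their common edge. Double chambers are therefore
  indexed by darts.\<close>

definition double_chamber :: "'d \<Rightarrow> ('d \<times> nat \<times> nat) set" where
  "double_chamber e = {(e, 0, 1), (oinv M e, 1, 0), (face_next M e, 0, 2), (e, 2, 0)}"

lemma prev_simps: "e \<in> darts M \<Longrightarrow> prev e \<in> darts M" "e \<in> darts M \<Longrightarrow> rot M (prev e) = e"
  "e \<in> darts M \<Longrightarrow> prev (rot M e) = e"
  by (simp_all add: rot.inv_into_in rot.f_inv_into rot.inv_into_f)

lemma face_prev_eq: "e \<in> darts M \<Longrightarrow> inv_into (darts M) (face_next M) (rot M e) = oinv M e"
  using fn.inv_into_f[OF oinv_in[of e]] by (simp add: rot_eq)

lemma face_next_B: "face_next B (e, i, j) = bary_rot M (e, j, i)"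
  by (simp add: face_next_def barycentric_simps)

lemma face_B_pos:
  assumes "e \<in> darts M"
  shows "face B (e, 0, 1) = pos_chamber e" "face B (e, 1, 2) = pos_chamber e" "face B (e, 2, 0) = pos_chamber e"
proof -
  have n: "face_next B (e, 0, 1) = (e, 1, 2)" "face_next B (e, 1, 2) = (e, 2, 0)"
    "face_next B (e, 2, 0) = (e, 0, 1)" by (simp_all add: face_next_B)
  show "face B (e, 0, 1) = pos_chamber e" "face B (e, 1, 2) = pos_chamber e" "face B (e, 2, 0) = pos_chamber e"
    unfolding face_def pos_chamber_def
    using orbit_three[OF n] orbit_three[OF n(2,3,1)] orbit_three[OF n(3,1,2)] by auto
qed

lemma face_B_neg:
  assumes "e \<in> darts M"
  shows "face B (e, 1, 0) = neg_chamber e" "face B (rot M e, 0, 2) = neg_chamber e"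
    "face B (oinv M e, 2, 1) = neg_chamber e"
proof -
  have n: "face_next B (e, 1, 0) = (rot M e, 0, 2)" "face_next B (rot M e, 0, 2) = (oinv M e, 2, 1)"
    "face_next B (oinv M e, 2, 1) = (e, 1, 0)"
    using assms by (simp_all add: face_next_B face_prev_eq oinv_oinv)
  show "face B (e, 1, 0) = neg_chamber e" "face B (rot M e, 0, 2) = neg_chamber e"
    "face B (oinv M e, 2, 1) = neg_chamber e"
    unfolding face_def neg_chamber_def
    using orbit_three[OF n] orbit_three[OF n(2,3,1)] orbit_three[OF n(3,1,2)] by auto
qed

lemma face_B_neg':
  assumes "e \<in> darts M"
  shows "face B (e, 0, 2) = neg_chamber (prev e)" "face B (e, 2, 1) = neg_chamber (oinv M e)"
  using face_B_neg(2)[OF prev_simps(1)[OF assms]] face_B_neg(3)[OF oinv_in[OF assms]]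
  unfolding prev_simps(2)[OF assms] oinv_oinv[OF assms] .

lemma pos_chamber_eq_iff: "pos_chamber e = pos_chamber e' \<longleftrightarrow> e = e'"
proof
  have "(e, 0, 1) \<in> pos_chamber e" by (simp add: pos_chamber_def)
  also assume "pos_chamber e = pos_chamber e'"
  finally show "e = e'" by (simp add: pos_chamber_def)
qed simp

lemma faces_B: "faces B = pos_chamber ` darts M \<union> neg_chamber ` darts M"
proof (intro equalityI subsetI)
  fix C assume "C \<in> faces B"
  then obtain e i j where e: "e \<in> darts M" "i < 3" "j < 3" "i \<noteq> j" "C = face B (e, i, j)"
    by (auto simp: faces_def barycentric_def)
  have "i \<in> {0, 1, 2}" "j \<in> {0, 1, 2}" using e by auto
  then have "(i, j) \<in> {(0, 1), (1, 2), (2, 0), (1, 0), (0, 2), (2, 1)}" using e by auto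
  then have "C \<in> {pos_chamber e, neg_chamber e, neg_chamber (prev e), neg_chamber (oinv M e)}"
    using face_B_pos[OF e(1)] face_B_neg[OF e(1)] face_B_neg'[OF e(1)] e(5) by auto
  then show "C \<in> pos_chamber ` darts M \<union> neg_chamber ` darts M"
    using e(1) prev_simps oinv_in by auto
next
  fix C assume "C \<in> pos_chamber ` darts M \<union> neg_chamber ` darts M"
  then obtain e where e: "e \<in> darts M" "C = face B (e, 0, 1) \<or> C = face B (e, 1, 0)"
    using face_B_pos face_B_neg by force
  then show "C \<in> faces B"
    by (auto simp: faces_def barycentric_simps intro!: imageI)
qed

lemma chamber_orientation_pos: "chamber_orientation B (pos_chamber e)"
  unfolding chamber_orientation_def pos_chamber_def
  by (intro bexI[of _ "(e, 0, 1)"]) (simp_all add: start_type_barycentric end_type_barycentric)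

lemma chamber_orientation_neg: "\<not> chamber_orientation B (neg_chamber e)"
  by (auto simp: chamber_orientation_def neg_chamber_def start_type_barycentric end_type_barycentric)

lemma has_edge_type_B:
  assumes "a < 3" "b < 3" "a \<noteq> b"
  shows "has_edge_type B i (e, a, b) \<longleftrightarrow> a \<noteq> i \<and> b \<noteq> i"
  using assms by (simp add: has_edge_type_def start_type_barycentric end_type_barycentric)

lemma chamber_adj_eqI:
  assumes "d \<in> C" "has_edge_type B i d" "\<And>x. x \<in> C \<Longrightarrow> has_edge_type B i x \<Longrightarrow> x = d"
    and "face B (oinv B d) = C'" "C' \<in> faces B"
  shows "chamber_adj B (faces B) i C = C'"
proof -
  have "(THE d. d \<in> C \<and> has_edge_type B i d) = d" using assms(1-3) by blast
  then show ?thesis using assms(4,5) by (simp add: chamber_adj_def)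
qed

lemma chamber_adj_pos:
  assumes e: "e \<in> darts M"
  shows "chamber_adj B (faces B) 0 (pos_chamber e) = neg_chamber (oinv M e)"
    "chamber_adj B (faces B) 1 (pos_chamber e) = neg_chamber (prev e)"
    "chamber_adj B (faces B) 2 (pos_chamber e) = neg_chamber e"
proof -
  show "chamber_adj B (faces B) 0 (pos_chamber e) = neg_chamber (oinv M e)"
  proof (rule chamber_adj_eqI[of "(e, 1, 2)"])
    show "x = (e, 1, 2)" if "x \<in> pos_chamber e" "has_edge_type B 0 x" for x
      using that unfolding pos_chamber_def neg_chamber_def by (auto simp: has_edge_type_B)
    show "face B (oinv B (e, 1, 2)) = neg_chamber (oinv M e)" by (simp only: barycentric_simps face_B_neg'(2)[OF e])
    show "neg_chamber (oinv M e) \<in> faces B" unfolding faces_B using e oinv_in by blast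
  qed (simp_all add: pos_chamber_def neg_chamber_def has_edge_type_B)
  show "chamber_adj B (faces B) 1 (pos_chamber e) = neg_chamber (prev e)"
  proof (rule chamber_adj_eqI[of "(e, 2, 0)"])
    show "x = (e, 2, 0)" if "x \<in> pos_chamber e" "has_edge_type B 1 x" for x
      using that unfolding pos_chamber_def neg_chamber_def by (auto simp: has_edge_type_B)
    show "face B (oinv B (e, 2, 0)) = neg_chamber (prev e)" by (simp only: barycentric_simps face_B_neg'(1)[OF e])
    show "neg_chamber (prev e) \<in> faces B" unfolding faces_B using e prev_simps(1) by blast
  qed (simp_all add: pos_chamber_def neg_chamber_def has_edge_type_B)
  show "chamber_adj B (faces B) 2 (pos_chamber e) = neg_chamber e"
  proof (rule chamber_adj_eqI[of "(e, 0, 1)"])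
    show "x = (e, 0, 1)" if "x \<in> pos_chamber e" "has_edge_type B 2 x" for x
      using that unfolding pos_chamber_def neg_chamber_def by (auto simp: has_edge_type_B)
    show "face B (oinv B (e, 0, 1)) = neg_chamber e" by (simp only: barycentric_simps face_B_neg(1)[OF e])
    show "neg_chamber e \<in> faces B" unfolding faces_B using e  by blast
  qed (simp_all add: pos_chamber_def neg_chamber_def has_edge_type_B)
qed

lemma chamber_adj_neg:
  assumes e: "e \<in> darts M"
  shows "chamber_adj B (faces B) 0 (neg_chamber e) = pos_chamber (oinv M e)"
    "chamber_adj B (faces B) 1 (neg_chamber e) = pos_chamber (rot M e)"
    "chamber_adj B (faces B) 2 (neg_chamber e) = pos_chamber e"
proof -
  show "chamber_adj B (faces B) 0 (neg_chamber e) = pos_chamber (oinv M e)"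
  proof (rule chamber_adj_eqI[of "(oinv M e, 2, 1)"])
    show "x = (oinv M e, 2, 1)" if "x \<in> neg_chamber e" "has_edge_type B 0 x" for x
      using that unfolding pos_chamber_def neg_chamber_def by (auto simp: has_edge_type_B)
    show "face B (oinv B (oinv M e, 2, 1)) = pos_chamber (oinv M e)" by (simp only: barycentric_simps face_B_pos(2)[OF oinv_in[OF e]])
    show "pos_chamber (oinv M e) \<in> faces B" unfolding faces_B using e oinv_in by blast
  qed (simp_all add: pos_chamber_def neg_chamber_def has_edge_type_B)
  show "chamber_adj B (faces B) 1 (neg_chamber e) = pos_chamber (rot M e)"
  proof (rule chamber_adj_eqI[of "(rot M e, 0, 2)"])
    show "x = (rot M e, 0, 2)" if "x \<in> neg_chamber e" "has_edge_type B 1 x" for x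
      using that unfolding pos_chamber_def neg_chamber_def by (auto simp: has_edge_type_B)
    show "face B (oinv B (rot M e, 0, 2)) = pos_chamber (rot M e)" by (simp only: barycentric_simps face_B_pos(3)[OF rot.f_in[OF e]])
    show "pos_chamber (rot M e) \<in> faces B" unfolding faces_B using e rot.f_in by blast
  qed (simp_all add: pos_chamber_def neg_chamber_def has_edge_type_B)
  show "chamber_adj B (faces B) 2 (neg_chamber e) = pos_chamber e"
  proof (rule chamber_adj_eqI[of "(e, 1, 0)"])
    show "x = (e, 1, 0)" if "x \<in> neg_chamber e" "has_edge_type B 2 x" for x
      using that unfolding pos_chamber_def neg_chamber_def by (auto simp: has_edge_type_B)
    show "face B (oinv B (e, 1, 0)) = pos_chamber e" by (simp only: barycentric_simps face_B_pos(1)[OF e])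
    show "pos_chamber e \<in> faces B" unfolding faces_B using e  by blast
  qed (simp_all add: pos_chamber_def neg_chamber_def has_edge_type_B)
qed

lemma darts_DS: "(e, i, j) \<in> darts DS \<longleftrightarrow> e \<in> darts M \<and> (i, j) \<in> {(0, 1), (1, 0), (0, 2), (2, 0)}"
proof -
  have "i < 3 \<Longrightarrow> j < 3 \<Longrightarrow> i \<noteq> j \<Longrightarrow>
      (i, j) \<in> {(0, 1), (1, 2), (2, 0), (1, 0), (0, 2), (2, 1)}"
    by auto
  then show ?thesis
    by (auto simp: double_chamber_system_def sub_emb_def barycentric_simps has_edge_type_B)
qed

lemma oinv_DS: "oinv DS (e, i, j) = (e, j, i)"
  by (simp add: double_chamber_system_def sub_emb_def barycentric_simps)

lemma rot_DS_eq:
  assumes "(bary_rot M ^^ k) d \<in> darts DS" "0 < k" "\<And>l. 0 < l \<Longrightarrow> l < k \<Longrightarrow> (bary_rot M ^^ l) d \<notin> darts DS"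
  shows "rot DS d = (bary_rot M ^^ k) d"
proof -
  have "(LEAST k. 0 < k \<and> (bary_rot M ^^ k) d \<in> darts DS) = k"
    using assms by (intro Least_equality) (auto simp: not_less[symmetric])
  then show ?thesis
    by (simp add: double_chamber_system_def sub_emb_def barycentric_simps)
qed

text \<open>Only the vertices of types 1 and 2 meet the omitted 0-edges, and there every second edge
  is omitted.\<close>

lemma rot_DS:
  assumes e: "e \<in> darts M"
  shows "rot DS (e, 0, 1) = (rot M e, 0, 2)" "rot DS (e, 0, 2) = (e, 0, 1)"
    "rot DS (e, 1, 0) = (oinv M e, 1, 0)"
    "rot DS (e, 2, 0) = (inv_into (darts M) (face_next M) e, 2, 0)"
proof -
  show "rot DS (e, 0, 1) = (rot M e, 0, 2)"
    using e rot_DS_eq[of 1 "(e, 0, 1)"] by (simp add: darts_DS rot.f_in)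
  show "rot DS (e, 0, 2) = (e, 0, 1)"
    using e rot_DS_eq[of 1 "(e, 0, 2)"] by (simp add: darts_DS)
  show "rot DS (e, 1, 0) = (oinv M e, 1, 0)"
    using rot_DS_eq[of 2 "(e, 1, 0)"] e
    by (simp add: darts_DS oinv_in numeral_2_eq_2 less_Suc_eq)
  show "rot DS (e, 2, 0) = (inv_into (darts M) (face_next M) e, 2, 0)"
    using rot_DS_eq[of 2 "(e, 2, 0)"] e
    by (simp add: darts_DS fn.inv_into_in numeral_2_eq_2 less_Suc_eq)
qed

lemma face_DS:
  assumes e: "e \<in> darts M"
  shows "face DS (e, 0, 1) = double_chamber e" "face DS (oinv M e, 1, 0) = double_chamber e"
    "face DS (face_next M e, 0, 2) = double_chamber e" "face DS (e, 2, 0) = double_chamber e"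
proof -
  have n: "face_next DS (e, 0, 1) = (oinv M e, 1, 0)"
    "face_next DS (oinv M e, 1, 0) = (face_next M e, 0, 2)"
    "face_next DS (face_next M e, 0, 2) = (e, 2, 0)"
    "face_next DS (e, 2, 0) = (e, 0, 1)"
    unfolding face_next_def[of DS] oinv_DS rot_DS[OF e] rot_DS(1)[OF oinv_in[OF e]]
      rot_DS(4)[OF fn.f_in[OF e]] fn.inv_into_f[OF e]
    by (simp_all add: face_next_def)
  show "face DS (e, 0, 1) = double_chamber e" "face DS (oinv M e, 1, 0) = double_chamber e"
    "face DS (face_next M e, 0, 2) = double_chamber e" "face DS (e, 2, 0) = double_chamber e"
    unfolding face_def double_chamber_def
    using orbit_four[OF n] orbit_four[OF n(2,3,4,1)] orbit_four[OF n(3,4,1,2)] orbit_four[OF n(4,1,2,3)]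
    by auto
qed

lemma double_chamber_eq_iff: "double_chamber e = double_chamber e' \<longleftrightarrow> e = e'"
proof
  have "(e, 0, 1) \<in> double_chamber e" by (simp add: double_chamber_def)
  also assume "double_chamber e = double_chamber e'"
  finally show "e = e'" by (simp add: double_chamber_def)
qed simp

lemma faces_DS: "faces DS = double_chamber ` darts M"
proof (intro equalityI subsetI)
  fix C assume "C \<in> faces DS"
  then obtain x where x: "x \<in> darts DS" "C = face DS x" unfolding faces_def by blast
  obtain e i j where xe: "x = (e, i, j)" by (cases x)
  have e: "e \<in> darts M" "(i, j) \<in> {(0, 1), (1, 0), (0, 2), (2, 0)}" "C = face DS (e, i, j)"
    using x unfolding xe darts_DS by simp_all
  define f where "f = inv_into (darts M) (face_next M) e"
  have f: "f \<in> darts M" "face_next M f = e" using e by (auto simp: f_def fn.inv_into_in fn.f_inv_into)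
  note d2 = face_DS(2)[OF oinv_in[OF e(1)], unfolded oinv_oinv[OF e(1)]]
  note d3 = face_DS(3)[OF f(1), unfolded f(2)]
  consider "C = face DS (e, 0, 1)" | "C = face DS (e, 1, 0)" | "C = face DS (e, 0, 2)" | "C = face DS (e, 2, 0)"
    using e(2,3) by auto
  then show "C \<in> double_chamber ` darts M"
    by cases (simp_all only: face_DS[OF e(1)] d2 d3 e(1) f(1) oinv_in[OF e(1)] imageI)
next
  fix C assume "C \<in> double_chamber ` darts M"
  then obtain e where e: "e \<in> darts M" "C = double_chamber e" by blast
  have "(e, 0, 1) \<in> darts DS" using e by (simp add: darts_DS)
  then show "C \<in> faces DS" unfolding faces_def e(2) face_DS(1)[OF e(1), symmetric] by blast
qed

text \<open>If \<open>d\<close> lies on a single directed segment, exactly one side of the double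
  chamber has matching end types, which resolves the definite description in the gluing.\<close>

lemma lopsp_neighbour_eq:
  assumes e: "e \<in> darts M"
    and d: "\<And>a' b'. d \<in> cut_segment R P a' b' \<longleftrightarrow> a' = a \<and> b' = b"
  shows "a = 0 \<Longrightarrow> b = 1 \<Longrightarrow> lopsp_neighbour R P M (double_chamber e) d = double_chamber (oinv M e)"
    "a = 1 \<Longrightarrow> b = 0 \<Longrightarrow> lopsp_neighbour R P M (double_chamber e) d = double_chamber (oinv M e)"
    "a = 0 \<Longrightarrow> b = 2 \<Longrightarrow> lopsp_neighbour R P M (double_chamber e) d = double_chamber (face_next M e)"
    "a = 2 \<Longrightarrow> b = 0 \<Longrightarrow> lopsp_neighbour R P M (double_chamber e) d =
       double_chamber (inv_into (darts M) (face_next M) e)"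
proof -
  have ex: "\<exists>a b. d \<in> cut_segment R P a b" using d by blast
  have nb: "lopsp_neighbour R P M (double_chamber e) d = face DS (oinv DS x)"
    if x: "x \<in> double_chamber e" "start_type B x = a" "end_type B x = b"
      and u: "\<And>y. y \<in> double_chamber e \<Longrightarrow> start_type B y = a \<Longrightarrow> end_type B y = b \<Longrightarrow> y = x" for x
  proof -
    have "(THE x. x \<in> double_chamber e \<and> d \<in> cut_segment R P (start_type B x) (end_type B x)) = x"
      unfolding d using x u by blast
    then show ?thesis using ex by (simp add: lopsp_neighbour_def)
  qed
  note d1 = face_DS(2)[OF oinv_in[OF e], unfolded oinv_oinv[OF e]]
  note d4 = face_DS(3)[OF fn.inv_into_in[OF e], unfolded fn.f_inv_into[OF e]]
  show "lopsp_neighbour R P M (double_chamber e) d = double_chamber (oinv M e)" if "a = 0" "b = 1"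
  proof (rule trans[OF nb[of "(e, 0, 1)"]])
    show "y = (e, 0, 1)" if "y \<in> double_chamber e" "start_type B y = a" "end_type B y = b" for y
      using that unfolding \<open>a = 0\<close> \<open>b = 1\<close> double_chamber_def
      by (auto simp: start_type_barycentric end_type_barycentric)
    show "face DS (oinv DS (e, 0, 1)) = double_chamber (oinv M e)" by (simp only: oinv_DS d1)
  qed (simp_all add: \<open>a = 0\<close> \<open>b = 1\<close> double_chamber_def start_type_barycentric end_type_barycentric)
  show "lopsp_neighbour R P M (double_chamber e) d = double_chamber (oinv M e)" if "a = 1" "b = 0"
  proof (rule trans[OF nb[of "(oinv M e, 1, 0)"]])
    show "y = (oinv M e, 1, 0)" if "y \<in> double_chamber e" "start_type B y = a" "end_type B y = b" for y
      using that unfolding \<open>a = 1\<close> \<open>b = 0\<close> double_chamber_def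
      by (auto simp: start_type_barycentric end_type_barycentric)
    show "face DS (oinv DS (oinv M e, 1, 0)) = double_chamber (oinv M e)" by (simp only: oinv_DS face_DS(1)[OF oinv_in[OF e]])
  qed (simp_all add: \<open>a = 1\<close> \<open>b = 0\<close> double_chamber_def start_type_barycentric end_type_barycentric)
  show "lopsp_neighbour R P M (double_chamber e) d = double_chamber (face_next M e)" if "a = 0" "b = 2"
  proof (rule trans[OF nb[of "(face_next M e, 0, 2)"]])
    show "y = (face_next M e, 0, 2)" if "y \<in> double_chamber e" "start_type B y = a" "end_type B y = b" for y
      using that unfolding \<open>a = 0\<close> \<open>b = 2\<close> double_chamber_def
      by (auto simp: start_type_barycentric end_type_barycentric)
    show "face DS (oinv DS (face_next M e, 0, 2)) = double_chamber (face_next M e)" by (simp only: oinv_DS face_DS(4)[OF fn.f_in[OF e]])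
  qed (simp_all add: \<open>a = 0\<close> \<open>b = 2\<close> double_chamber_def start_type_barycentric end_type_barycentric)
  show "lopsp_neighbour R P M (double_chamber e) d = double_chamber (inv_into (darts M) (face_next M) e)" if "a = 2" "b = 0"
  proof (rule trans[OF nb[of "(e, 2, 0)"]])
    show "y = (e, 2, 0)" if "y \<in> double_chamber e" "start_type B y = a" "end_type B y = b" for y
      using that unfolding \<open>a = 2\<close> \<open>b = 0\<close> double_chamber_def
      by (auto simp: start_type_barycentric end_type_barycentric)
    show "face DS (oinv DS (e, 2, 0)) = double_chamber (inv_into (darts M) (face_next M) e)" by (simp only: oinv_DS d4)
  qed (simp_all add: \<open>a = 2\<close> \<open>b = 0\<close> double_chamber_def start_type_barycentric end_type_barycentric)
qed

lemma lopsp_neighbour_off: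
  assumes "\<And>a' b'. d \<notin> cut_segment R P a' b'"
  shows "lopsp_neighbour R P M C d = C"
  using assms by (simp add: lopsp_neighbour_def)

end

section \<open>The outer facial walk and its sides\<close>

context lsp
begin

text \<open>Well defined because the outer walk passes each of its vertices once.\<close>

definition corner :: "nat \<Rightarrow> 'a" where
  "corner i = (THE d. d \<in> Out \<and> vertex Q d = special Q i)"

lemma corner:
  assumes "i < 3"
  shows "corner i \<in> Out" "vertex Q (corner i) = special Q i"
    "d \<in> Out \<Longrightarrow> vertex Q d = special Q i \<longleftrightarrow> d = corner i"
proof -
  obtain c where d: "c \<in> Out" "c \<in> special Q i" using special_Out[OF assms] by blast
  then have v: "vertex Q c = special Q i" using special_vertex[OF assms] vertex_eqI by blast
  have "corner i = c"
    unfolding corner_def by (rule the_equality) (use d v Out_unique in auto)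
  then show *: "corner i \<in> Out" "vertex Q (corner i) = special Q i" using d v by auto
  show "d \<in> Out \<Longrightarrow> vertex Q d = special Q i \<longleftrightarrow> d = corner i"
    using * Out_unique by metis
qed

lemma corner_inj: "i < 3 \<Longrightarrow> j < 3 \<Longrightarrow> corner i = corner j \<longleftrightarrow> i = j"
  using corner(2) special_inj by metis

abbreviation "fnext \<equiv> face_next Q"
abbreviation "L \<equiv> card Out"

lemma Out_orbit: "d \<in> Out \<Longrightarrow> orbit fnext d = Out"
  using face_Out by (simp add: face_def)

lemma fnext_Out: "d \<in> Out \<Longrightarrow> (fnext ^^ k) d \<in> Out"
  using funpow_in_orbit[OF fn.self_in_orbit[OF Out_dart]] Out_orbit by blast

lemma fnext_period: "d \<in> Out \<Longrightarrow> (fnext ^^ L) d = d"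
  using fn.orbit_period(1)[OF Out_dart, of d] by (simp add: Out_orbit)

lemma fnext_inj: "d \<in> Out \<Longrightarrow> i < L \<Longrightarrow> j < L \<Longrightarrow> (fnext ^^ i) d = (fnext ^^ j) d \<longleftrightarrow> i = j"
  using fn.orbit_period(2)[OF Out_dart, of d] by (auto simp: Out_orbit inj_on_def)

lemma fnext_surj:
  assumes "d \<in> Out" "e \<in> Out"
  obtains k where "k < L" "e = (fnext ^^ k) d"
  using fn.orbitE_funpow[OF Out_dart[OF assms(1)], of e] assms by (auto simp: Out_orbit)

lemma vertex_fnext_special:
  "d \<in> Out \<Longrightarrow> i < 3 \<Longrightarrow> vertex Q ((fnext ^^ k) d) = special Q i \<longleftrightarrow> (fnext ^^ k) d = corner i"
  using corner(3) fnext_Out by blast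

text \<open>Nothing in \<open>outer_walk\<close> forbids several turns, but having to stop before
  \<open>v_c\<close> confines the walk to less than one turn.\<close>

lemma outer_walk_eq:
  assumes abc: "a < 3" "b < 3" "c < 3" "a \<noteq> b" "a \<noteq> c"
    and q: "p < L" "q < L" "(fnext ^^ p) (corner a) = corner b" "(fnext ^^ q) (corner a) = corner c"
  shows "outer_walk Q a b c = (if p < q then {(fnext ^^ k) (corner a) | k. k < p} else {})"
proof -
  have p0: "0 < p" using q(3) corner_inj[of a b] abc by (cases p) auto
  have n: "n = p \<and> p < q"
    if "vertex Q ((fnext ^^ n) (corner a)) = special Q b"
      "\<forall>l\<le>n. vertex Q ((fnext ^^ l) (corner a)) \<noteq> special Q c" for n
  proof -
    have 1: "(fnext ^^ n) (corner a) = corner b"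
      using that(1) vertex_fnext_special[OF corner(1)[OF abc(1)] abc(2)] by blast
    have "vertex Q ((fnext ^^ q) (corner a)) = special Q c" using q(4) corner(2)[OF abc(3)] by simp
    then have "n < q" using that(2) by (meson not_less)
    then have "n = p" using 1 q fnext_inj[OF corner(1)[OF abc(1)], of n p] by simp
    then show ?thesis using \<open>n < q\<close> by simp
  qed
  have w: "outer_walk Q a b c = {(fnext ^^ k) (corner a) | k n. k < n \<and>
      vertex Q ((fnext ^^ n) (corner a)) = special Q b \<and>
        (\<forall>l\<le>n. vertex Q ((fnext ^^ l) (corner a)) \<noteq> special Q c)}"
    unfolding outer_walk_def using corner[OF abc(1)] by blast
  show ?thesis
  proof (cases "p < q")
    case True
    have "\<forall>l\<le>p. vertex Q ((fnext ^^ l) (corner a)) \<noteq> special Q c"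
    proof (intro allI impI)
      fix l assume "l \<le> p"
      then have "(fnext ^^ l) (corner a) \<noteq> corner c"
        using True q fnext_inj[OF corner(1)[OF abc(1)], of l q] by simp
      then show "vertex Q ((fnext ^^ l) (corner a)) \<noteq> special Q c"
        using vertex_fnext_special[OF corner(1)[OF abc(1)] abc(3)] by blast
    qed
    moreover have "vertex Q ((fnext ^^ p) (corner a)) = special Q b" using q(3) corner(2)[OF abc(2)] by simp
    ultimately have "vertex Q ((fnext ^^ n) (corner a)) = special Q b \<and>
        (\<forall>l\<le>n. vertex Q ((fnext ^^ l) (corner a)) \<noteq> special Q c) \<longleftrightarrow> n = p" for n
      using n[of n] by blast
    then show ?thesis unfolding w using True by simp
  next
    case False
    then have "\<not> (vertex Q ((fnext ^^ n) (corner a)) = special Q b \<and>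
        (\<forall>l\<le>n. vertex Q ((fnext ^^ l) (corner a)) \<noteq> special Q c))" for n
      using n[of n] by blast
    then show ?thesis unfolding w using False by simp
  qed
qed

text \<open>Positions on the outer walk are counted from \<open>v_1\<close>; the sides are then
  separated by the positions 0, \<open>ppos 0\<close> and \<open>ppos 2\<close>.\<close>

definition ppos :: "nat \<Rightarrow> nat" where
  "ppos i = (THE k. k < L \<and> (fnext ^^ k) (corner 1) = corner i)"

lemma ppos:
  assumes "i < 3"
  shows "ppos i < L" "(fnext ^^ ppos i) (corner 1) = corner i"
proof -
  have c1: "corner 1 \<in> Out" by (rule corner) simp
  obtain k where k: "k < L" "corner i = (fnext ^^ k) (corner 1)"
    using fnext_surj[OF c1 corner(1)[OF assms]] .
  have "ppos i = k"
    unfolding ppos_def by (rule the_equality) (use k fnext_inj[OF c1] in auto)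
  then show "ppos i < L" "(fnext ^^ ppos i) (corner 1) = corner i" using k by auto
qed

lemma ppos_1: "ppos 1 = 0"
proof -
  have c1: "corner 1 \<in> Out" by (rule corner) simp
  have "(fnext ^^ ppos 1) (corner 1) = (fnext ^^ 0) (corner 1)" using ppos[of 1] by simp
  moreover have "0 < L" using ppos(1)[of 1] by simp
  ultimately show ?thesis using fnext_inj[OF c1, of "ppos 1" 0] ppos(1)[of 1] by simp
qed

lemma ppos_inj: "i < 3 \<Longrightarrow> j < 3 \<Longrightarrow> ppos i = ppos j \<longleftrightarrow> i = j"
  using ppos(2) corner_inj by metis

lemma corner_shift:
  assumes i: "i < 3" and j: "j < 3"
  defines "n \<equiv> (if ppos i \<le> ppos j then ppos j - ppos i else L + ppos j - ppos i)"
  shows "n < L" "(fnext ^^ n) (corner i) = corner j"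
proof -
  have c1: "corner 1 \<in> Out" by (rule corner) simp
  show "n < L" using ppos(1)[OF i] ppos(1)[OF j] by (auto simp: n_def)
  have "(fnext ^^ n) (corner i) = (fnext ^^ (n + ppos i)) (corner 1)"
    using ppos(2)[OF i] by (simp add: funpow_add)
  also have "\<dots> = (fnext ^^ ppos j) (corner 1)"
  proof (cases "ppos i \<le> ppos j")
    case False
    then have "n + ppos i = ppos j + L" using ppos(1)[OF i] by (simp add: n_def)
    then show ?thesis using fnext_period[OF c1] by (simp add: funpow_add)
  qed (simp add: n_def)
  finally show "(fnext ^^ n) (corner i) = corner j" using ppos(2)[OF j] by simp
qed

lemma walk_mem:
  assumes i: "i < 3" and k: "k < L" and that: "p \<le> L"
  defines "m \<equiv> (if ppos i \<le> k then k - ppos i else L + k - ppos i)"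
  shows "(fnext ^^ k) (corner 1) \<in> {(fnext ^^ l) (corner i) | l. l < p} \<longleftrightarrow> m < p"
proof -
  have c1: "corner 1 \<in> Out" by (rule corner) simp
  have mL: "m < L" using ppos(1)[OF i] k by (auto simp: m_def)
  have "(fnext ^^ m) (corner i) = (fnext ^^ (m + ppos i)) (corner 1)"
    using ppos(2)[OF i] by (simp add: funpow_add)
  also have "\<dots> = (fnext ^^ k) (corner 1)"
  proof (cases "ppos i \<le> k")
    case False
    then have "m + ppos i = k + L" using ppos(1)[OF i] by (simp add: m_def)
    then show ?thesis using fnext_period[OF c1] by (simp add: funpow_add)
  qed (simp add: m_def)
  finally have eq: "(fnext ^^ k) (corner 1) = (fnext ^^ m) (corner i)" by simp
  show ?thesis
  proof
    assume "(fnext ^^ k) (corner 1) \<in> {(fnext ^^ l) (corner i) | l. l < p}"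
    then obtain l where l: "l < p" "(fnext ^^ m) (corner i) = (fnext ^^ l) (corner i)"
      unfolding eq by blast
    then have "m = l" using fnext_inj[OF corner(1)[OF i], of m l] mL that by simp
    then show "m < p" using l by simp
  next
    assume "m < p"
    then show "(fnext ^^ k) (corner 1) \<in> {(fnext ^^ l) (corner i) | l. l < p}"
      unfolding eq by blast
  qed
qed

definition orient :: bool where
  "orient \<longleftrightarrow> ppos 0 < ppos 2"

text \<open>The oriented edge reached \<open>k\<close> steps after \<open>v\<^sub>1\<close> lies on the side opposite to the special
  vertex of this number.\<close>

definition side_at :: "nat \<Rightarrow> nat" where
  "side_at k = (if orient then (if k < ppos 0 then 2 else if k < ppos 2 then 1 else 0)
     else (if k < ppos 2 then 0 else if k < ppos 0 then 1 else 2))"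

lemma ppos_pos: "0 < ppos 0" "0 < ppos 2" "ppos 0 \<noteq> ppos 2"
  using ppos_inj[of 1 0] ppos_inj[of 1 2] ppos_inj[of 0 2] ppos_1 by simp_all

lemma outer_walk_mem:
  assumes abc: "a < 3" "b < 3" "c < 3" "a \<noteq> b" "a \<noteq> c" "b \<noteq> c" and k: "k < L"
  shows "(fnext ^^ k) (corner 1) \<in> outer_walk Q a b c \<longleftrightarrow>
    (let r = (\<lambda>j. if ppos a \<le> j then j - ppos a else L + j - ppos a)
     in r k < r (ppos b) \<and> r (ppos b) < r (ppos c))"
proof -
  define r where "r j = (if ppos a \<le> j then j - ppos a else L + j - ppos a)" for j
  have w: "outer_walk Q a b c =
      (if r (ppos b) < r (ppos c) then {(fnext ^^ k) (corner a) | k. k < r (ppos b)} else {})"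
    unfolding r_def
    by (rule outer_walk_eq[OF abc(1-5)]) (use corner_shift abc in blast)+
  have "r (ppos b) \<le> L" using corner_shift(1)[OF abc(1,2)] by (simp add: r_def)
  from walk_mem[OF abc(1) k this]
  have "(fnext ^^ k) (corner 1) \<in> {(fnext ^^ l) (corner a) | l. l < r (ppos b)} \<longleftrightarrow> r k < r (ppos b)"
    by (simp only: r_def)
  then show ?thesis unfolding w Let_def r_def[symmetric] by auto
qed

text \<open>Of the two orders of the other special vertices, just one gives a part of the cycle that
  misses \<open>v_i\<close>; \<open>orient\<close> decides which. The rest is arithmetic of
  positions modulo \<open>L\<close>.\<close>

lemma outer_walk_sides:
  assumes k: "k < L" and i: "i < 3"
  shows "(\<exists>a b. {a, b, i} = {0, 1, 2} \<and> (fnext ^^ k) (corner 1) \<in> outer_walk Q a b i) \<longleftrightarrow> side_at k = i"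
proof -
  have ab: "(\<exists>a b. {a, b, i} = {0, 1, 2} \<and> P a b) \<longleftrightarrow> P m n \<or> P n m"
    if mn: "{0, 1, 2} = {m, n, i}" "m \<noteq> n" "m \<noteq> i" "n \<noteq> i" for P :: "nat \<Rightarrow> nat \<Rightarrow> bool" and m n
  proof -
    have t: "{a, b, i} = {m, n, i} \<longleftrightarrow> (a = m \<and> b = n) \<or> (a = n \<and> b = m)" for a b
    proof
      assume *: "{a, b, i} = {m, n, i}"
      have "m \<in> {a, b, i}" "n \<in> {a, b, i}" unfolding * by simp_all
      then show "(a = m \<and> b = n) \<or> (a = n \<and> b = m)" using mn(2-4) by auto
    qed blast
    show ?thesis unfolding mn(1) t by blast
  qed
  have L: "ppos 0 < L" "ppos 2 < L" using ppos(1) by simp_all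
  have lt: "0 < (3 :: nat)" "1 < (3 :: nat)" "2 < (3 :: nat)" by simp_all
  have ne: "True" "0 \<noteq> (1 :: nat)" "0 \<noteq> (2 :: nat)" "1 \<noteq> (0 :: nat)" "True" "1 \<noteq> (2 :: nat)" "2 \<noteq> (0 :: nat)" "2 \<noteq> (1 :: nat)" "True" by simp_all
  note s = ppos_1[unfolded One_nat_def] side_at_def orient_def Let_def
  consider "i = 0" | "i = 1" | "i = 2" using i by linarith
  then show ?thesis
  proof cases
    case 1
    have e: "{0, 1, 2} = {1, 2, i}" "1 \<noteq> (2 :: nat)" "1 \<noteq> i" "2 \<noteq> i" using 1 by auto
    show ?thesis
      unfolding ab[OF e] unfolding 1
        outer_walk_mem[OF lt(2) lt(3) lt(1) e(2) ne(4) ne(7) k]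
        outer_walk_mem[OF lt(3) lt(2) lt(1) e(2)[symmetric] ne(7) ne(4) k]
      using ppos_pos L k by (auto simp: s)
  next
    case 2
    have e: "{0, 1, 2} = {0, 2, i}" "0 \<noteq> (2 :: nat)" "0 \<noteq> i" "2 \<noteq> i" using 2 by auto
    show ?thesis
      unfolding ab[OF e] unfolding 2
        outer_walk_mem[OF lt(1) lt(3) lt(2) e(2) ne(2) ne(8) k]
        outer_walk_mem[OF lt(3) lt(1) lt(2) e(2)[symmetric] ne(8) ne(2) k]
      using ppos_pos L k by (auto simp: s)
  next
    case 3
    have e: "{0, 1, 2} = {0, 1, i}" "0 \<noteq> (1 :: nat)" "0 \<noteq> i" "1 \<noteq> i" using 3 by auto
    show ?thesis
      unfolding ab[OF e] unfolding 3
        outer_walk_mem[OF lt(1) lt(2) lt(3) e(2) ne(3) ne(6) k]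
        outer_walk_mem[OF lt(2) lt(1) lt(3) e(2)[symmetric] ne(6) ne(3) k]
      using ppos_pos L k by (auto simp: s)
  qed
qed

lemma lsp_orientation_iff: "lsp_orientation Q \<longleftrightarrow> orient"
proof -
  have "outer_walk Q 1 0 2 = (if ppos 0 < ppos 2 then {(fnext ^^ k) (corner 1) | k. k < ppos 0} else {})"
    using ppos[of 0] ppos[of 2] by (intro outer_walk_eq) auto
  then show ?thesis using ppos_pos by (auto simp: lsp_orientation_def orient_def)
qed

definition out_side :: "'a \<Rightarrow> nat" where
  "out_side d = side_at (THE k. k < L \<and> (fnext ^^ k) (corner 1) = d)"

lemma out_side_fnext: "k < L \<Longrightarrow> out_side ((fnext ^^ k) (corner 1)) = side_at k"
proof -
  assume k: "k < L"
  have c1: "corner 1 \<in> Out" by (rule corner) simp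
  have "(THE l. l < L \<and> (fnext ^^ l) (corner 1) = (fnext ^^ k) (corner 1)) = k"
    by (rule the_equality) (use k fnext_inj[OF c1] in auto)
  then show ?thesis by (simp add: out_side_def)
qed

lemma out_side_less: "out_side d < 3"
  by (simp add: out_side_def side_at_def)

lemma out_walk_side:
  assumes "d \<in> Out" "i < 3"
  shows "(\<exists>a b. {a, b, i} = {0, 1, 2} \<and> d \<in> outer_walk Q a b i) \<longleftrightarrow> out_side d = i"
proof -
  have c1: "corner 1 \<in> Out" by (rule corner) simp
  obtain k where "k < L" "d = (fnext ^^ k) (corner 1)" using fnext_surj[OF c1 assms(1)] .
  then show ?thesis using outer_walk_sides[OF _ assms(2)] out_side_fnext by simp
qed

lemma outer_walk_Out: "outer_walk Q a b c \<subseteq> Out"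
  unfolding outer_walk_def using fnext_Out by blast

lemma boundary_side_iff:
  assumes "d \<in> darts Q" "i < 3"
  shows "d \<in> boundary_side Q i \<longleftrightarrow> (d \<in> Out \<and> out_side d = i) \<or> (oinv Q d \<in> Out \<and> out_side (oinv Q d) = i)"
proof -
  let ?W = "\<lambda>d. \<exists>a b. {a, b, i} = {0, 1, 2} \<and> d \<in> outer_walk Q a b i"
  have "d \<in> boundary_side Q i \<longleftrightarrow> ?W d \<or> ?W (oinv Q d)"
  proof -
    have im: "d \<in> oinv Q ` X \<longleftrightarrow> oinv Q d \<in> X" if "X \<subseteq> Out" for X
    proof
      assume "d \<in> oinv Q ` X"
      then obtain x where x: "x \<in> X" "d = oinv Q x" by blast
      then show "oinv Q d \<in> X" using that Out_dart oinv_oinv[of x] by auto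
    next
      assume "oinv Q d \<in> X"
      then show "d \<in> oinv Q ` X" using oinv_oinv[OF assms(1)] by (intro image_eqI[of _ _ "oinv Q d"]) simp_all
    qed
    have "d \<in> boundary_side Q i \<longleftrightarrow>
        (\<exists>a b. {a, b, i} = {0, 1, 2} \<and> (d \<in> outer_walk Q a b i \<or> d \<in> oinv Q ` outer_walk Q a b i))"
      unfolding boundary_side_def by (simp only: UN_iff Bex_def mem_Collect_eq split_paired_Ex prod.case Un_iff)
    then show ?thesis unfolding im[OF outer_walk_Out] by (simp only: conj_disj_distribL ex_disj_distrib)
  qed
  moreover have "?W d \<longleftrightarrow> d \<in> Out \<and> out_side d = i" for d
    using outer_walk_Out out_walk_side[OF _ assms(2)] by blast
  ultimately show ?thesis by blast
qed

definition side :: "'a \<Rightarrow> nat" where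
  "side d = out_side (if d \<in> Out then d else oinv Q d)"

lemma side_less: "side d < 3"
  by (simp add: side_def out_side_less)

lemma boundary_side_eq:
  assumes "d \<in> darts Q" "i < 3"
  shows "d \<in> boundary_side Q i \<longleftrightarrow> boundary d \<and> side d = i"
  using boundary_side_iff[OF assms] Out_oinv[of d] by (auto simp: side_def)

lemma side_oinv: "d \<in> darts Q \<Longrightarrow> boundary d \<Longrightarrow> side (oinv Q d) = side d"
  using Out_oinv[of d] oinv_oinv[of d] by (auto simp: side_def)

text \<open>The side changes only at the special vertices, and the order of the two sides there
  depends on the sense in which the outer walk meets these vertices.\<close>

lemma side_fnext:
  assumes "d \<in> Out"
  shows "vertex Q (fnext d) \<notin> special Q ` {0, 1, 2} \<Longrightarrow> side (fnext d) = side d"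
    "vertex Q (fnext d) = special Q 0 \<Longrightarrow> (side d, side (fnext d)) = (if orient then (2, 1) else (1, 2))"
    "vertex Q (fnext d) = special Q 1 \<Longrightarrow> (side d, side (fnext d)) = (if orient then (0, 2) else (2, 0))"
    "vertex Q (fnext d) = special Q 2 \<Longrightarrow> (side d, side (fnext d)) = (if orient then (1, 0) else (0, 1))"
proof -
  have c1: "corner 1 \<in> Out" by (rule corner) simp
  obtain k where k: "k < L" "d = (fnext ^^ k) (corner 1)" using fnext_surj[OF c1 assms] .
  \<comment> \<open>The last position is followed by position 0, which is the corner at
    \<open>v_1\<close>.\<close>
  define k' where "k' = (if Suc k = L then 0 else Suc k)"
  have k': "k' < L" "fnext d = (fnext ^^ k') (corner 1)"
    using k fnext_period[OF c1] by (auto simp: k'_def)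
      (metis funpow.simps(2) comp_apply)+
  have fO: "fnext d \<in> Out" using fnext_Out[OF assms, of 1] by simp
  have s: "side d = side_at k" "side (fnext d) = side_at k'"
    using out_side_fnext k k' assms fO by (simp_all add: side_def)
  have sp: "vertex Q (fnext d) = special Q i \<longleftrightarrow> k' = ppos i" if "i < 3" for i
    using corner(3)[OF that fO] ppos[OF that] fnext_inj[OF c1 k'(1) ppos(1)[OF that]] k' by metis
  have L: "ppos 0 < L" "ppos 2 < L" using ppos(1) by simp_all
  have kk: "k' = 0 \<and> Suc k = L \<or> k' = Suc k \<and> Suc k < L" using k by (auto simp: k'_def)
  show "side (fnext d) = side d" if "vertex Q (fnext d) \<notin> special Q ` {0, 1, 2}"
  proof -
    have "k' \<noteq> ppos 0" "k' \<noteq> ppos 1" "k' \<noteq> ppos 2" using that sp by auto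
    then show ?thesis unfolding s side_at_def using kk ppos_1 by auto
  qed
  show "(side d, side (fnext d)) = (if orient then (2, 1) else (1, 2))" if "vertex Q (fnext d) = special Q 0"
  proof -
    have "k' = ppos 0" using that sp by simp
    then show ?thesis unfolding s side_at_def orient_def using kk ppos_pos by auto
  qed
  show "(side d, side (fnext d)) = (if orient then (0, 2) else (2, 0))" if "vertex Q (fnext d) = special Q 1"
  proof -
    have "k' = 0" using that sp[of 1] ppos_1 by simp
    then show ?thesis unfolding s side_at_def orient_def using kk ppos_pos L by auto
  qed
  show "(side d, side (fnext d)) = (if orient then (1, 0) else (0, 1))" if "vertex Q (fnext d) = special Q 2"
  proof -
    have "k' = ppos 2" using that sp by simp
    then show ?thesis unfolding s side_at_def orient_def using kk ppos_pos by auto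
  qed
qed

section \<open>Existence of a cut-path\<close>

lemma cut_pathI:
  assumes n: "0 < n" and m: "\<And>k. k < n \<Longrightarrow> m k \<in> darts M \<and> vertex M (m k) = u k \<and> end_vertex M (m k) = u (Suc k)"
    and u: "inj_on u {..n}" "u 0 = special M 1" "u n = special M 2" "j < n" "u j = special M 0"
  shows "cut_path M (map m [0..<n])"
  unfolding cut_path_def
proof (intro conjI)
  have l: "last (map m [0..<n]) = m (n - 1)" using n by (simp add: last_map)
  have e: "end_vertex M (m (n - 1)) = u n" using m[of "n - 1"] n by simp
  show "map m [0..<n] \<noteq> []" using n by simp
  show "set (map m [0..<n]) \<subseteq> darts M" using m by auto
  show "\<forall>k. Suc k < length (map m [0..<n]) \<longrightarrow>
      end_vertex M (map m [0..<n] ! k) = vertex M (map m [0..<n] ! Suc k)"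
    using m by simp
  show "vertex M (hd (map m [0..<n])) = special M 1" using m n u by (simp add: hd_map)
  show "end_vertex M (last (map m [0..<n])) = special M 2" using l e u by simp
  show "special M 0 \<in> vertex M ` set (map m [0..<n])"
    using m[of j] u(4,5) by (auto intro!: rev_image_eqI[of "m j"])
  have "map (vertex M) (map m [0..<n]) = map u [0..<n]" using m by simp
  then have "map (vertex M) (map m [0..<n]) @ [end_vertex M (last (map m [0..<n]))] = map u [0..<Suc n]"
    using l e by simp
  moreover have "inj_on u (set [0..<Suc n])" using u(1) by (simp add: atLeast0_lessThan_Suc lessThan_Suc_atMost[symmetric] lessThan_atLeast0)
  ultimately show "distinct (map (vertex M) (map m [0..<n]) @ [end_vertex M (last (map m [0..<n]))])"
    by (simp only: distinct_map distinct_upt simp_thms)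
qed

text \<open>The boundary cycle contains one: of its two ways from \<open>v_1\<close> to
  \<open>v_2\<close>, exactly one passes \<open>v_0\<close>.\<close>

theorem cut_path_exists: "\<exists>P. cut_path M P"
proof -
  have c1: "corner 1 \<in> Out" by (rule corner) simp
  define w where "w k = (fnext ^^ k) (corner 1)" for k
  have wO: "w k \<in> Out" for k unfolding w_def using fnext_Out[OF c1] .
  have wD: "w k \<in> darts Q" for k using wO Out_dart by blast
  have wv: "vertex Q (w k) \<in> vertices Q" for k using wD vertex_in_vertices by blast
  have wn: "end_vertex Q (w k) = vertex Q (w (Suc k))" for k
    using vertex_face_next[OF wD[of k]] by (simp add: w_def)
  have wi: "vertex Q (w i) = vertex Q (w j) \<longleftrightarrow> i = j" if "i < L" "j < L" for i j
    using Out_unique[OF wO wO] fnext_inj[OF c1 that] unfolding w_def by metis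
  have wL: "w L = w 0" unfolding w_def using fnext_period[OF c1] by simp
  have wp: "vertex Q (w (ppos i)) = special Q i" if "i < 3" for i
    unfolding w_def using ppos(2)[OF that] corner(2)[OF that] by simp
  define U where "U k = vcopy True (vertex Q (w k))" for k
  have bd: "vertex Q (w k) \<inter> Out \<noteq> {}" for k using wO vertex_self[OF wD] by blast
  have Ui: "U i = U j \<longleftrightarrow> i = j" if "i < L" "j < L" for i j
    unfolding U_def using vcopy_eq_iff[OF wv wv] wi[OF that] by blast
  have UL: "U L = U 0" by (simp add: U_def wL)
  have Us: "U (ppos i) = special M i" if "i < 3" for i
    unfolding U_def wp[OF that] using special_M_vcopy[OF that, of True] by simp
  have F: "(False, w k) \<in> darts M \<and> vertex M (False, w k) = U k \<and> end_vertex M (False, w k) = U (Suc k)" for k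
  proof -
    have "(False, w k) \<in> darts M" using wD wO Out_oinv by (simp add: darts_M)
    then show ?thesis
      using vcopy_boundary[OF bd, of False k True] vcopy_boundary[OF bd, of False "Suc k" True]
      by (simp add: vertex_M end_vertex_M U_def wn)
  qed
  have T: "oinv M (False, w k) \<in> darts M \<and> vertex M (oinv M (False, w k)) = U (Suc k) \<and>
      end_vertex M (oinv M (False, w k)) = U k" for k
    using F[of k] D.oinv_in D.end_vertex_oinv by (simp add: end_vertex_def)
  have L: "ppos 0 < L" "ppos 2 < L" using ppos(1) by simp_all
  show ?thesis
  proof (cases "ppos 0 < ppos 2")
    case True
    have "cut_path M (map (\<lambda>k. (False, w k)) [0..<ppos 2])"
    proof (rule cut_pathI[where u = U and j = "ppos 0"])
      show "inj_on U {..ppos 2}" using Ui L by (intro inj_onI) simp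
      show "U 0 = special M 1" using Us[of 1] ppos_1 by simp
    qed (use ppos_pos F Us True in auto)
    then show ?thesis by blast
  next
    case False
    \<comment> \<open>Backwards from \<open>v_1\<close>, counted as position \<open>L\<close>, down
      to the position of \<open>v_2\<close>.\<close>
    define n where "n = L - ppos 2"
    have "cut_path M (map (\<lambda>k. oinv M (False, w (L - Suc k))) [0..<n])"
    proof (rule cut_pathI[where u = "\<lambda>k. U (L - k)" and j = "L - ppos 0"])
      show "inj_on (\<lambda>k. U (L - k)) {..n}"
      proof (rule inj_onI)
        fix i j assume ij: "i \<in> {..n}" "j \<in> {..n}" "U (L - i) = U (L - j)"
        \<comment> \<open>Positions \<open>L\<close> and 0 denote the same vertex; \<open>r\<close>
          reduces to positions below \<open>L\<close>, where distinct positions give distinct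
          vertices.\<close>
        define r where "r i = (if i = 0 then 0 else L - i)" for i
        have U0: "U (L - i) = U (r i)" for i using UL by (simp add: r_def)
        have "r i < L" "r j < L" using L by (auto simp: r_def)
        then have "r i = r j" using ij(3) Ui unfolding U0 by blast
        then show "i = j" using ij(1,2) L ppos_pos by (auto simp: r_def n_def split: if_splits)
      qed
      show "U (L - 0) = special M 1" using Us[of 1] ppos_1 UL by simp
      show "oinv M (False, w (L - Suc k)) \<in> darts M \<and> vertex M (oinv M (False, w (L - Suc k))) = U (L - k) \<and>
          end_vertex M (oinv M (False, w (L - Suc k))) = U (L - Suc k)" if "k < n" for k
        using T[of "L - Suc k"] that by (simp add: n_def Suc_diff_Suc)
    qed (use ppos_pos L Us False in \<open>auto simp: n_def\<close>)
    then show ?thesis by blast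
  qed
qed

end

section \<open>Tilings encoded by Delaney--Dress symbols\<close>

text \<open>Left multiplication by \<open>inv u\<close> takes the coset of \<open>w\<close> under
  \<open>N\<close> to a coset under the conjugate group, and it commutes with all right
  multiplications.\<close>

lemma (in group) rcosets_conj_iso:
  assumes N: "N \<subseteq> carrier G" and u: "u \<in> carrier G"
    and N': "N' = (\<lambda>n. inv u \<otimes> n \<otimes> u) ` N"
  shows "\<exists>f. bij_betw f (rcosets N) (rcosets N') \<and>
    (\<forall>X\<in>rcosets N. \<forall>g\<in>carrier G. f (X #> g) = f X #> g)"
proof -
  have N'G: "N' \<subseteq> carrier G" using N u unfolding N' by auto
  have eq: "inv u <# (N #> w) = N' #> (inv u \<otimes> w)" if w: "w \<in> carrier G" for w
  proof -
    have "inv u \<otimes> (n \<otimes> w) = inv u \<otimes> n \<otimes> u \<otimes> (inv u \<otimes> w)" if "n \<in> N" for n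
    proof -
      have n: "n \<in> carrier G" using that N by auto
      have "inv u \<otimes> n \<otimes> u \<otimes> (inv u \<otimes> w) = inv u \<otimes> n \<otimes> (u \<otimes> inv u) \<otimes> w"
        using n u w by (simp only: m_assoc inv_closed m_closed)
      also have "\<dots> = inv u \<otimes> (n \<otimes> w)" using n u w by (simp add: m_assoc)
      finally show ?thesis by simp
    qed
    then show ?thesis unfolding N' by (force simp: l_coset_def r_coset_def)
  qed
  have eq': "u <# (N' #> w) = N #> (u \<otimes> w)" if w: "w \<in> carrier G" for w
  proof -
    have "u \<otimes> (inv u \<otimes> n \<otimes> u \<otimes> w) = n \<otimes> (u \<otimes> w)" if "n \<in> N" for n
    proof -
      have n: "n \<in> carrier G" using that N by auto
      have "u \<otimes> (inv u \<otimes> n \<otimes> u \<otimes> w) = (u \<otimes> inv u) \<otimes> n \<otimes> (u \<otimes> w)"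
        using n u w by (simp only: m_assoc inv_closed m_closed)
      then show ?thesis using n u w by simp
    qed
    then show ?thesis unfolding N' by (force simp: l_coset_def r_coset_def)
  qed
  have inv_l: "u <# (inv u <# X) = X" "inv u <# (u <# X) = X" if "X \<subseteq> carrier G" for X
    using that u lcos_m_assoc[of X u "inv u"] lcos_m_assoc[of X "inv u" u]
    by (simp_all add: lcos_mult_one)
  have sub: "X \<subseteq> carrier G" if K: "K \<subseteq> carrier G" and X: "X \<in> rcosets K" for K X
  proof -
    obtain w where "w \<in> carrier G" "X = K #> w" using X by (auto simp: RCOSETS_def)
    then show ?thesis using r_coset_subset_G[OF K] by simp
  qed
  show ?thesis
  proof (intro exI conjI ballI)
    show "bij_betw (\<lambda>X. inv u <# X) (rcosets N) (rcosets N')"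
    proof (rule bij_betwI[where g = "\<lambda>X. u <# X"])
      show "(\<lambda>X. inv u <# X) \<in> rcosets N \<rightarrow> rcosets N'"
      proof (rule funcsetI)
        fix X assume "X \<in> rcosets N"
        then obtain w where w: "w \<in> carrier G" "X = N #> w" by (auto simp: RCOSETS_def)
        show "inv u <# X \<in> rcosets N'"
          unfolding w(2) eq[OF w(1)] using u w by (intro rcosetsI N'G) simp
      qed
      show "(\<lambda>X. u <# X) \<in> rcosets N' \<rightarrow> rcosets N"
      proof (rule funcsetI)
        fix X assume "X \<in> rcosets N'"
        then obtain w where w: "w \<in> carrier G" "X = N' #> w" by (auto simp: RCOSETS_def)
        show "u <# X \<in> rcosets N"
          unfolding w(2) eq'[OF w(1)] using u w by (intro rcosetsI N) simp
      qed
      show "u <# (inv u <# X) = X" if "X \<in> rcosets N" for X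
        using sub[OF N that] by (rule inv_l)
      show "inv u <# (u <# X) = X" if "X \<in> rcosets N'" for X
        using sub[OF N'G that] by (rule inv_l)
    qed
    fix X g assume X: "X \<in> rcosets N" and g: "g \<in> carrier G"
    have "inv u \<otimes> (x \<otimes> g) = inv u \<otimes> x \<otimes> g" if "x \<in> X" for x
    proof -
      have "x \<in> carrier G" using sub[OF N X] that by (rule subsetD)
      then show ?thesis using u g by (simp add: m_assoc)
    qed
    moreover have "inv u <# (X #> g) = (\<lambda>x. inv u \<otimes> (x \<otimes> g)) ` X"
      "(inv u <# X) #> g = (\<lambda>x. inv u \<otimes> x \<otimes> g) ` X"
      unfolding l_coset_def r_coset_def by blast+
    ultimately show "inv u <# (X #> g) = (inv u <# X) #> g" by (simp cong: image_cong)
  qed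
qed

lemma (in group) generate_conj:
  assumes "A \<subseteq> carrier G" "u \<in> carrier G"
  shows "generate G ((\<lambda>n. inv u \<otimes> n \<otimes> u) ` A) = (\<lambda>n. inv u \<otimes> n \<otimes> u) ` generate G A"
proof -
  have "(\<lambda>n. inv u \<otimes> n \<otimes> u) \<in> hom G G"
  proof (rule homI)
    fix x y assume xy: "x \<in> carrier G" "y \<in> carrier G"
    have "inv u \<otimes> x \<otimes> u \<otimes> (inv u \<otimes> y \<otimes> u) = inv u \<otimes> x \<otimes> (u \<otimes> inv u) \<otimes> y \<otimes> u"
      using xy assms(2) by (simp only: m_assoc inv_closed m_closed)
    also have "\<dots> = inv u \<otimes> (x \<otimes> y) \<otimes> u" using xy assms(2) by (simp add: m_assoc)
    finally show "inv u \<otimes> (x \<otimes> y) \<otimes> u = inv u \<otimes> x \<otimes> u \<otimes> (inv u \<otimes> y \<otimes> u)" by (rule sym)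
  qed (use assms in simp)
  then interpret h: group_hom G G "\<lambda>n. inv u \<otimes> n \<otimes> u"
    by unfold_locales
  show ?thesis using h.generate_img[OF assms(1)] by simp
qed

interpretation Sig: group \<Sigma>
  by (rule group_Sigma)

lemma sigma_gen_carrier: "i < 3 \<Longrightarrow> [i] \<in> carrier \<Sigma>"
  by (auto simp: Sigma_group_def)

locale dd =
  fixes D :: "'c dd_symbol"
  assumes act_in: "C \<in> chambers D \<Longrightarrow> i < 3 \<Longrightarrow> sigma_act D i C \<in> chambers D"
    and act_act: "C \<in> chambers D \<Longrightarrow> i < 3 \<Longrightarrow> sigma_act D i (sigma_act D i C) = C"
begin

lemma act_word_sigma_cons:
  assumes "C \<in> chambers D" "i < 3"
  shows "act_word D C (sigma_cons i w) = act_word D (sigma_act D i C) w"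
  using assms by (cases w) (auto simp: act_word_def act_act)

lemma act_word_mult:
  assumes "C \<in> chambers D" "u \<in> carrier \<Sigma>"
  shows "act_word D C (u \<otimes>\<^bsub>\<Sigma>\<^esub> v) = act_word D (act_word D C u) v"
proof -
  have "act_word D C (foldr sigma_cons u v) = act_word D (act_word D C u) v"
    if "set u \<subseteq> {0, 1, 2}" for u
    using assms(1) that
  proof (induction u arbitrary: C)
    case (Cons i u)
    then have i: "i < 3" by auto
    then have "act_word D C (foldr sigma_cons (i # u) v) = act_word D (sigma_act D i C) (foldr sigma_cons u v)"
      using act_word_sigma_cons[OF Cons.prems(1)] by simp
    also have "\<dots> = act_word D (act_word D (sigma_act D i C) u) v"
      using Cons act_in[OF Cons.prems(1) i] by simp
    finally show ?case by (simp add: act_word_def)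
  qed (simp add: act_word_def)
  then show ?thesis using assms(2) by (simp add: Sigma_group_def)
qed

definition relators :: "'c \<Rightarrow> nat list set" where
  "relators C = {w \<otimes>\<^bsub>\<Sigma>\<^esub> (\<sigma> i \<otimes>\<^bsub>\<Sigma>\<^esub> \<sigma> j) [^]\<^bsub>\<Sigma>\<^esub> (dd_m D i j (act_word D C w)) \<otimes>\<^bsub>\<Sigma>\<^esub> inv\<^bsub>\<Sigma>\<^esub> w | w i j.
          w \<in> carrier \<Sigma> \<and> i < j \<and> j < 3}"

lemma relators_carrier: "relators C \<subseteq> carrier \<Sigma>"
proof
  fix g assume "g \<in> relators C"
  then obtain w i j where g: "g = w \<otimes>\<^bsub>\<Sigma>\<^esub> (\<sigma> i \<otimes>\<^bsub>\<Sigma>\<^esub> \<sigma> j) [^]\<^bsub>\<Sigma>\<^esub> (dd_m D i j (act_word D C w)) \<otimes>\<^bsub>\<Sigma>\<^esub> inv\<^bsub>\<Sigma>\<^esub> w"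
    "w \<in> carrier \<Sigma>" "i < j" "j < 3" unfolding relators_def by blast
  then have "[i] \<in> carrier \<Sigma>" "[j] \<in> carrier \<Sigma>" using sigma_gen_carrier by simp_all
  then show "g \<in> carrier \<Sigma>" using g by simp
qed

text \<open>Substitute the product of \<open>u\<close> and \<open>w\<close> for \<open>w\<close>:
  the chamber reached is the same, and the extra \<open>u\<close> is a conjugation.\<close>

lemma relators_shift:
  assumes C: "C \<in> chambers D" and u: "u \<in> carrier \<Sigma>"
  shows "relators (act_word D C u) = (\<lambda>n. inv\<^bsub>\<Sigma>\<^esub> u \<otimes>\<^bsub>\<Sigma>\<^esub> n \<otimes>\<^bsub>\<Sigma>\<^esub> u) ` relators C"
proof -
  let ?r = "\<lambda>i j m. (\<sigma> i \<otimes>\<^bsub>\<Sigma>\<^esub> \<sigma> j) [^]\<^bsub>\<Sigma>\<^esub> (m :: nat)"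
  have r: "?r i j m \<in> carrier \<Sigma>" if "i < j" "j < 3" for i j m
    using that sigma_gen_carrier[of i] sigma_gen_carrier[of j] by simp
  have conj: "inv\<^bsub>\<Sigma>\<^esub> u \<otimes>\<^bsub>\<Sigma>\<^esub> (w \<otimes>\<^bsub>\<Sigma>\<^esub> x \<otimes>\<^bsub>\<Sigma>\<^esub> inv\<^bsub>\<Sigma>\<^esub> w) \<otimes>\<^bsub>\<Sigma>\<^esub> u =
      (inv\<^bsub>\<Sigma>\<^esub> u \<otimes>\<^bsub>\<Sigma>\<^esub> w) \<otimes>\<^bsub>\<Sigma>\<^esub> x \<otimes>\<^bsub>\<Sigma>\<^esub> inv\<^bsub>\<Sigma>\<^esub> (inv\<^bsub>\<Sigma>\<^esub> u \<otimes>\<^bsub>\<Sigma>\<^esub> w)"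
    if "w \<in> carrier \<Sigma>" "x \<in> carrier \<Sigma>" for w x
    using that u by (simp add: Sig.inv_mult_group Sig.m_assoc)
  show ?thesis
  proof (intro equalityI subsetI)
    fix g assume "g \<in> relators (act_word D C u)"
    then obtain w i j where g: "g = w \<otimes>\<^bsub>\<Sigma>\<^esub> ?r i j (dd_m D i j (act_word D (act_word D C u) w)) \<otimes>\<^bsub>\<Sigma>\<^esub> inv\<^bsub>\<Sigma>\<^esub> w"
      "w \<in> carrier \<Sigma>" "i < j" "j < 3" unfolding relators_def by blast
    let ?w = "u \<otimes>\<^bsub>\<Sigma>\<^esub> w"
    have w: "?w \<in> carrier \<Sigma>" "inv\<^bsub>\<Sigma>\<^esub> u \<otimes>\<^bsub>\<Sigma>\<^esub> ?w = w"
      using u g(2) by (simp_all add: Sig.m_assoc[symmetric])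
    have "g = inv\<^bsub>\<Sigma>\<^esub> u \<otimes>\<^bsub>\<Sigma>\<^esub> (?w \<otimes>\<^bsub>\<Sigma>\<^esub> ?r i j (dd_m D i j (act_word D C ?w)) \<otimes>\<^bsub>\<Sigma>\<^esub> inv\<^bsub>\<Sigma>\<^esub> ?w) \<otimes>\<^bsub>\<Sigma>\<^esub> u"
      unfolding conj[OF w(1) r[OF g(3,4)]] w(2) act_word_mult[OF C u] by (rule g(1))
    then show "g \<in> (\<lambda>n. inv\<^bsub>\<Sigma>\<^esub> u \<otimes>\<^bsub>\<Sigma>\<^esub> n \<otimes>\<^bsub>\<Sigma>\<^esub> u) ` relators C"
      unfolding relators_def using w(1) g(3,4) by blast
  next
    fix g assume "g \<in> (\<lambda>n. inv\<^bsub>\<Sigma>\<^esub> u \<otimes>\<^bsub>\<Sigma>\<^esub> n \<otimes>\<^bsub>\<Sigma>\<^esub> u) ` relators C"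
    then obtain w i j where g: "g = inv\<^bsub>\<Sigma>\<^esub> u \<otimes>\<^bsub>\<Sigma>\<^esub> (w \<otimes>\<^bsub>\<Sigma>\<^esub> ?r i j (dd_m D i j (act_word D C w)) \<otimes>\<^bsub>\<Sigma>\<^esub> inv\<^bsub>\<Sigma>\<^esub> w) \<otimes>\<^bsub>\<Sigma>\<^esub> u"
      "w \<in> carrier \<Sigma>" "i < j" "j < 3" unfolding relators_def by blast
    let ?w = "inv\<^bsub>\<Sigma>\<^esub> u \<otimes>\<^bsub>\<Sigma>\<^esub> w"
    have w: "?w \<in> carrier \<Sigma>" "u \<otimes>\<^bsub>\<Sigma>\<^esub> ?w = w"
      using u g(2) by (simp_all add: Sig.m_assoc[symmetric])
    have "g = ?w \<otimes>\<^bsub>\<Sigma>\<^esub> ?r i j (dd_m D i j (act_word D (act_word D C u) ?w)) \<otimes>\<^bsub>\<Sigma>\<^esub> inv\<^bsub>\<Sigma>\<^esub> ?w"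
      unfolding act_word_mult[OF C u, symmetric] w(2) conj[OF g(2) r[OF g(3,4)], symmetric] by (rule g(1))
    then show "g \<in> relators (act_word D C u)"
      unfolding relators_def using w(1) g(3,4) by blast
  qed
qed

lemma tiling_subgroup_eq: "tiling_subgroup D C = generate \<Sigma> (relators C)"
  by (simp add: tiling_subgroup_def relators_def)

text \<open>Another base chamber only conjugates the subgroup, which relabels its cosets.\<close>

lemma isomorphic_tilings_base:
  assumes "C \<in> chambers D" "u \<in> carrier \<Sigma>"
  shows "isomorphic_tilings (tiling_chambers D C) (tiling_chambers D (act_word D C u))"
proof -
  have 1: "tiling_subgroup D C \<subseteq> carrier \<Sigma>"
    unfolding tiling_subgroup_eq using Sig.generate_incl[OF relators_carrier] .
  have 2: "tiling_subgroup D (act_word D C u) = (\<lambda>n. inv\<^bsub>\<Sigma>\<^esub> u \<otimes>\<^bsub>\<Sigma>\<^esub> n \<otimes>\<^bsub>\<Sigma>\<^esub> u) ` tiling_subgroup D C"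
    unfolding tiling_subgroup_eq relators_shift[OF assms]
    by (rule Sig.generate_conj[OF relators_carrier assms(2)])
  show ?thesis
    unfolding isomorphic_tilings_def tiling_chambers_def
    by (rule Sig.rcosets_conj_iso[OF 1 assms(2) 2])
qed

end

text \<open>The relators see a symbol only through the numbers met along words, and an equivariant
  projection does not alter these.\<close>

lemma tiling_subgroup_morphism:
  assumes C: "C \<in> chambers D"
    and act: "\<And>A i. A \<in> chambers D \<Longrightarrow> i < 3 \<Longrightarrow> sigma_act D i A \<in> chambers D \<and> p (sigma_act D i A) = sigma_act E i (p A)"
    and m: "\<And>A i j. A \<in> chambers D \<Longrightarrow> i < j \<Longrightarrow> j < 3 \<Longrightarrow> dd_m E i j (p A) = dd_m D i j A"
  shows "tiling_subgroup D C = tiling_subgroup E (p C)"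
proof -
  have w: "act_word D C w \<in> chambers D \<and> p (act_word D C w) = act_word E (p C) w"
    if "set w \<subseteq> {0, 1, 2}" for w
    using that C unfolding act_word_def
  proof (induction w arbitrary: C)
    case (Cons i w)
    then have "i < 3" by auto
    then show ?case using Cons act[of C i] by simp
  qed simp
  have m': "dd_m E i j (act_word E (p C) w) = dd_m D i j (act_word D C w)"
    if wij: "w \<in> carrier \<Sigma>" "i < j" "j < 3" for w i j
  proof -
    have "set w \<subseteq> {0, 1, 2}" using wij by (simp add: Sigma_group_def)
    from w[OF this] show ?thesis using m[of "act_word D C w" i j] wij by simp
  qed
  let ?r = "\<lambda>w i j n. w \<otimes>\<^bsub>\<Sigma>\<^esub> (\<sigma> i \<otimes>\<^bsub>\<Sigma>\<^esub> \<sigma> j) [^]\<^bsub>\<Sigma>\<^esub> (n :: nat) \<otimes>\<^bsub>\<Sigma>\<^esub> inv\<^bsub>\<Sigma>\<^esub> w"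
  have "{?r w i j (dd_m D i j (act_word D C w)) | w i j. w \<in> carrier \<Sigma> \<and> i < j \<and> j < 3} =
      {?r w i j (dd_m E i j (act_word E (p C) w)) | w i j. w \<in> carrier \<Sigma> \<and> i < j \<and> j < 3}"
  proof (intro equalityI subsetI)
    fix g assume "g \<in> {?r w i j (dd_m D i j (act_word D C w)) | w i j. w \<in> carrier \<Sigma> \<and> i < j \<and> j < 3}"
    then obtain w i j where g: "g = ?r w i j (dd_m D i j (act_word D C w))" "w \<in> carrier \<Sigma>" "i < j" "j < 3"
      by blast
    have "g = ?r w i j (dd_m E i j (act_word E (p C) w))" unfolding m'[OF g(2-4)] by (rule g(1))
    then show "g \<in> {?r w i j (dd_m E i j (act_word E (p C) w)) | w i j. w \<in> carrier \<Sigma> \<and> i < j \<and> j < 3}"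
      using g(2-4) by blast
  next
    fix g assume "g \<in> {?r w i j (dd_m E i j (act_word E (p C) w)) | w i j. w \<in> carrier \<Sigma> \<and> i < j \<and> j < 3}"
    then obtain w i j where g: "g = ?r w i j (dd_m E i j (act_word E (p C) w))" "w \<in> carrier \<Sigma>" "i < j" "j < 3"
      by blast
    have "g = ?r w i j (dd_m D i j (act_word D C w))" unfolding m'[OF g(2-4), symmetric] by (rule g(1))
    then show "g \<in> {?r w i j (dd_m D i j (act_word D C w)) | w i j. w \<in> carrier \<Sigma> \<and> i < j \<and> j < 3}"
      using g(2-4) by blast
  qed
  then show ?thesis unfolding tiling_subgroup_def by (simp only:)
qed

section \<open>The Delaney--Dress symbols\<close>

lemma (in emap) face_card3:
  assumes d: "d \<in> darts M" and c: "card (face M d) = 3"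
  defines "e \<equiv> face_next M d"
  defines "f \<equiv> face_next M e"
  shows "face M d = {d, e, f}" "face_next M f = d" "e \<noteq> d" "f \<noteq> d" "f \<noteq> e"
proof -
  have c3: "card (orbit (face_next M) d) = 3" using c by (simp add: face_def)
  have p: "(face_next M ^^ 3) d = d" using fn.orbit_period(1)[OF d] c3 by simp
  then show fd: "face_next M f = d" by (simp add: e_def f_def numeral_3_eq_3)
  have i: "inj_on (\<lambda>i. (face_next M ^^ i) d) {..<3}" using fn.orbit_period(2)[OF d] c3 by simp
  have ef: "e = (face_next M ^^ 1) d" "f = (face_next M ^^ 2) d" "d = (face_next M ^^ 0) d"
    by (simp_all add: e_def f_def numeral_2_eq_2)
  show "e \<noteq> d" using inj_onD[OF i, of 1 0] ef by auto
  show "f \<noteq> d" using inj_onD[OF i, of 2 0] ef by auto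
  show "f \<noteq> e" using inj_onD[OF i, of 2 1] ef by auto
  have "{..<3} = {0, 1, 2 :: nat}" by auto
  then have "orbit (face_next M) d = {(face_next M ^^ 0) d, (face_next M ^^ 1) d, (face_next M ^^ 2) d}"
    using fn.orbit_period(3)[OF d] c3 by simp
  then show "face M d = {d, e, f}" using ef by (simp add: face_def)
qed

text \<open>Treats the chambers of \<open>Q\<close>, where one face is excluded, together with those
  of the double, where all faces are chambers.\<close>

locale triangles = emap M for M :: "('d, 'z) lemb_scheme" +
  fixes Cs :: "'d set set"
  assumes faces: "Cs \<subseteq> faces M"
    and card3: "C \<in> Cs \<Longrightarrow> card C = 3"
    and types: "d \<in> darts M \<Longrightarrow> start_type M d \<noteq> end_type M d"
    and types_less: "d \<in> darts M \<Longrightarrow> start_type M d < 3"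
begin

lemma end_type_eq: "d \<in> darts M \<Longrightarrow> end_type M d = start_type M (face_next M d)"
  by (simp add: end_type_def start_type_def vertex_face_next)

lemma chamber:
  assumes "C \<in> Cs" "d \<in> C"
  defines "e \<equiv> face_next M d"
  defines "f \<equiv> face_next M e"
  shows "d \<in> darts M" "e \<in> darts M" "f \<in> darts M" "C = {d, e, f}" "face_next M f = d"
    "start_type M d \<noteq> start_type M e" "start_type M e \<noteq> start_type M f" "start_type M f \<noteq> start_type M d"
    "face M d = C"
proof -
  have C: "C \<in> faces M" using faces assms by auto
  show d: "d \<in> darts M" using faces_subset[OF C] assms by auto
  show f: "face M d = C" using face_eqI[OF C assms(2)] .
  have c: "card (face M d) = 3" using card3[OF assms(1)] f by simp
  note t = face_card3[OF d c]
  show de: "e \<in> darts M" "f \<in> darts M" using d fn.f_in by (simp_all add: e_def f_def)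
  show "C = {d, e, f}" using t(1) f by (simp add: e_def f_def)
  show fd: "face_next M f = d" using t(2) by (simp add: e_def f_def)
  show "start_type M d \<noteq> start_type M e" using types[OF d] end_type_eq[OF d] by (simp add: e_def)
  show "start_type M e \<noteq> start_type M f" using types[OF de(1)] end_type_eq[OF de(1)] by (simp add: f_def)
  show "start_type M f \<noteq> start_type M d" using types[OF de(2)] end_type_eq[OF de(2)] fd by simp
qed

text \<open>All three types occur in a chamber, so its \<open>i\<close>-edge is the side opposite to
  its vertex of type \<open>i\<close>, where the dart two steps later starts.\<close>

lemma edge_type_iff:
  assumes "C \<in> Cs" "d \<in> C" "i < 3"
  shows "has_edge_type M i d \<longleftrightarrow> start_type M (face_next M (face_next M d)) = i"
proof -
  note c = chamber[OF assms(1,2)]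
  have "has_edge_type M i d \<longleftrightarrow> start_type M d \<noteq> i \<and> start_type M (face_next M d) \<noteq> i"
    using end_type_eq[OF c(1)] by (simp add: has_edge_type_def)
  then show ?thesis
    using c(6-8) types_less[OF c(1)] types_less[OF c(2)] types_less[OF c(3)] assms(3) by linarith
qed

lemma ex1_start_type:
  assumes "C \<in> Cs" "i < 3"
  shows "\<exists>!d. d \<in> C \<and> start_type M d = i"
proof -
  have "C \<noteq> {}" using assms faces faces_nonempty by blast
  then obtain d where d: "d \<in> C" by blast
  note c = chamber[OF assms(1) d]
  let ?e = "face_next M d"
  let ?f = "face_next M ?e"
  have "start_type M d = i \<or> start_type M ?e = i \<or> start_type M ?f = i"
    using c(6-8) types_less[OF c(1)] types_less[OF c(2)] types_less[OF c(3)] assms(2) by linarith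
  then show ?thesis using c(4,6-8) by auto
qed

lemma ex1_edge_type:
  assumes "C \<in> Cs" "i < 3"
  shows "\<exists>!d. d \<in> C \<and> has_edge_type M i d"
proof -
  obtain g where g: "g \<in> C" "start_type M g = i" using ex1_start_type[OF assms] by blast
  note c = chamber[OF assms(1) g(1)]
  have mem: "face_next M g \<in> C" using c(4) by blast
  have e: "has_edge_type M i (face_next M g)"
    using edge_type_iff[OF assms(1) mem assms(2)] c(5) g(2) by simp
  show ?thesis
  proof (rule ex1I[of _ "face_next M g"])
    show "face_next M g \<in> C \<and> has_edge_type M i (face_next M g)" using mem e by blast
    fix d assume d: "d \<in> C \<and> has_edge_type M i d"
    note c' = chamber[OF assms(1) conjunct1[OF d]]
    have "face_next M (face_next M d) \<in> C" using c'(4) by blast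
    moreover have "start_type M (face_next M (face_next M d)) = i"
      using edge_type_iff[OF assms(1) _ assms(2)] d by blast
    ultimately have "face_next M (face_next M d) = g" using g ex1_start_type[OF assms] by blast
    then show "d = face_next M g" using c'(5) by simp
  qed
qed

definition edge_dart :: "'d set \<Rightarrow> nat \<Rightarrow> 'd" where
  "edge_dart C i = (THE d. d \<in> C \<and> has_edge_type M i d)"

lemma edge_dart:
  assumes "C \<in> Cs" "i < 3"
  shows "edge_dart C i \<in> C" "has_edge_type M i (edge_dart C i)"
  using theI'[OF ex1_edge_type[OF assms]] by (simp_all add: edge_dart_def)

lemma edge_dart_eqI: "C \<in> Cs \<Longrightarrow> i < 3 \<Longrightarrow> d \<in> C \<Longrightarrow> has_edge_type M i d \<Longrightarrow> edge_dart C i = d"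
  using ex1_edge_type edge_dart by blast

lemma chamber_adj_eq:
  "chamber_adj M Cs i C = (if face M (oinv M (edge_dart C i)) \<in> Cs then face M (oinv M (edge_dart C i)) else C)"
  by (simp add: chamber_adj_def edge_dart_def Let_def)

lemma has_edge_type_oinv: "d \<in> darts M \<Longrightarrow> has_edge_type M i (oinv M d) \<longleftrightarrow> has_edge_type M i d"
  by (auto simp: has_edge_type_def start_type_def end_type_def end_vertex_def oinv_oinv)

lemma chamber_adj_in: "C \<in> Cs \<Longrightarrow> chamber_adj M Cs i C \<in> Cs"
  by (simp add: chamber_adj_eq)

lemma chamber_adj_twice:
  assumes "C \<in> Cs" "i < 3"
  shows "chamber_adj M Cs i (chamber_adj M Cs i C) = C"
proof (cases "face M (oinv M (edge_dart C i)) \<in> Cs")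
  case True
  define e where "e = edge_dart C i"
  have e: "e \<in> C" "has_edge_type M i e" using edge_dart[OF assms] by (simp_all add: e_def)
  note c = chamber[OF assms(1) e(1)]
  have C': "chamber_adj M Cs i C = face M (oinv M e)" using True by (simp add: chamber_adj_eq e_def)
  have "edge_dart (face M (oinv M e)) i = oinv M e"
    using True assms(2) face_self[OF oinv_in[OF c(1)]] has_edge_type_oinv[OF c(1)] e(2)
    by (intro edge_dart_eqI) (simp_all add: e_def)
  then have "chamber_adj M Cs i (face M (oinv M e)) = C"
    using c(9) assms(1) oinv_oinv[OF c(1)] by (simp add: chamber_adj_eq)
  then show ?thesis using C' by simp
qed (simp add: chamber_adj_eq)

lemma opposite_vertex_eqI:
  assumes "C \<in> Cs" "d \<in> C" "i < 3" "j < 3" "i \<noteq> j" "start_type M d \<notin> {i, j}"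
  shows "opposite_vertex M i j C = vertex M d"
  unfolding opposite_vertex_def
proof (rule the_equality)
  note c = chamber[OF assms(1,2)]
  show "vertex M d \<in> vertices M \<and> vertex M d \<inter> C \<noteq> {} \<and> vtype M (vertex M d) \<notin> {i, j}"
    using vertex_in_vertices[OF c(1)] vertex_self[OF c(1)] assms(2,6) by (auto simp: start_type_def)
  fix v assume v: "v \<in> vertices M \<and> v \<inter> C \<noteq> {} \<and> vtype M v \<notin> {i, j}"
  then obtain g where g: "g \<in> v" "g \<in> C" by blast
  have gv: "vertex M g = v" using v g vertex_eqI by blast
  have "start_type M g \<notin> {i, j}" using v gv by (simp add: start_type_def)
  moreover have "start_type M g < 3" "start_type M d < 3"
    using types_less chamber(1)[OF assms(1) g(2)] c(1) by blast+
  ultimately have "start_type M g = start_type M d" using assms(3-6) by auto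
  then have "g = d" using ex1_start_type[OF assms(1) types_less[OF c(1)]] g assms(2) by blast
  then show "v = vertex M d" using gv by simp
qed

end

section \<open>The action on the chambers of an lsp-operation and of its double\<close>

context lsp
begin

abbreviation "Ch \<equiv> faces Q - {Out}"

sublocale TQ: triangles Q Ch
proof
  show "card C = 3" if "C \<in> Ch" for C using that lsp_conditions(4) by blast
  show "start_type Q d < 3" if "d \<in> darts Q" for d
    using vtype_le[OF vertex_in_vertices[OF that]] by (auto simp: start_type_def)
qed (use types_differ in auto)

sublocale TM: triangles M "faces M"
proof
  have l: "lopsp_operation M" by (rule lopsp_operation_M)
  show "card C = 3" if "C \<in> faces M" for C using l that unfolding lopsp_operation_def by blast
  show "start_type M d < 3" if "d \<in> darts M" for d
    using that TQ.types_less by (cases d) (simp add: start_type_M darts_M)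
  show "start_type M d \<noteq> end_type M d" if "d \<in> darts M" for d
    using that types_differ by (cases d) (simp add: start_type_M end_type_M darts_M)
qed auto

lemma fcopy_in: "C \<in> Ch \<Longrightarrow> fcopy x C \<in> faces M"
  unfolding faces_M by blast

lemma face_in_Ch: "d \<in> darts Q \<Longrightarrow> face Q d \<in> Ch \<longleftrightarrow> d \<notin> Out"
  using face_in_faces face_eq_Out by blast

lemma chamber_Out: "C \<in> Ch \<Longrightarrow> e \<in> C \<Longrightarrow> e \<in> darts Q \<and> e \<notin> Out"
  using face_eqI[of C e] face_Out[of e] faces_subset[of C] by auto

definition adj :: "nat \<Rightarrow> 'a set \<Rightarrow> 'a set" where
  "adj i C = chamber_adj Q Ch i C"

definition crossing :: "nat \<Rightarrow> 'a set \<Rightarrow> bool" where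
  "crossing i C \<longleftrightarrow> oinv Q (TQ.edge_dart C i) \<in> Out"

lemma adj_eq:
  assumes "C \<in> Ch" "i < 3"
  shows "adj i C = (if crossing i C then C else face Q (oinv Q (TQ.edge_dart C i)))"
proof -
  have "TQ.edge_dart C i \<in> darts Q" using chamber_Out TQ.edge_dart(1)[OF assms] assms by blast
  then show ?thesis
    using face_in_Ch[OF oinv_in] by (simp only: adj_def TQ.chamber_adj_eq crossing_def if_not_P if_P split: if_split) blast
qed

lemma adj_in: "C \<in> Ch \<Longrightarrow> adj i C \<in> Ch"
  unfolding adj_def by (rule TQ.chamber_adj_in)

lemma adj_adj: "C \<in> Ch \<Longrightarrow> i < 3 \<Longrightarrow> adj i (adj i C) = C"
  unfolding adj_def by (rule TQ.chamber_adj_twice)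

text \<open>The projection of the double to \<open>Q\<close> is equivariant; where the action fixes
  a chamber of \<open>Q\<close>, it exchanges the two mirror images above it.\<close>

lemma adj_M:
  assumes C: "C \<in> Ch" and i: "i < 3"
  shows "chamber_adj M (faces M) i (fcopy x C) = fcopy (if crossing i C then \<not> x else x) (adj i C)"
proof -
  define e where "e = TQ.edge_dart C i"
  have e: "e \<in> C" "has_edge_type Q i e" using TQ.edge_dart[OF C i] by (simp_all add: e_def)
  have eD: "e \<in> darts Q" "e \<notin> Out" "oinv Q e \<in> darts Q" "oinv Q (oinv Q e) = e"
    using chamber_Out[OF C e(1)] oinv_in oinv_oinv by auto
  define m where "m = (x, if x then e else oinv Q e)"
  have m: "m \<in> fcopy x C" unfolding m_def fcopy_def using e(1) by (rule imageI)
  have mD: "m \<in> darts M" unfolding m_def using eD by (simp add: darts_M)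
  have mt: "has_edge_type M i m"
    using mD e(2) TQ.has_edge_type_oinv[OF eD(1), of i] unfolding m_def
    by (auto simp: has_edge_type_def start_type_M end_type_M)
  have ed: "TM.edge_dart (fcopy x C) i = m"
    by (rule TM.edge_dart_eqI[OF fcopy_in[OF C] i m mt])
  have fe: "face Q e = C" using face_eqI C e(1) by blast
  have cr: "crossing i C \<longleftrightarrow> oinv Q e \<in> Out" by (simp add: crossing_def e_def)
  have om: "oinv M m = ((if crossing i C then \<not> x else x), if x then oinv Q e else e)"
    unfolding m_def oinv_M cr using eD by simp
  have "face M (oinv M m) = fcopy (if crossing i C then \<not> x else x) (adj i C)"
    using D.oinv_in[OF mD] unfolding om adj_eq[OF C i] e_def[symmetric]
    by (subst face_M, assumption) (use eD fe in \<open>simp add: cr\<close>)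
  then show ?thesis
    unfolding TM.chamber_adj_eq ed using D.face_in_faces[OF D.oinv_in[OF mD]] by simp
qed

abbreviation "rel i j \<equiv> {(A, adj k A) | A k. k \<in> {i, j}}"
abbreviation "relM i j \<equiv> {(A, chamber_adj M (faces M) k A) | A k. k \<in> {i, j}}"

definition orb :: "nat \<Rightarrow> nat \<Rightarrow> 'a set \<Rightarrow> 'a set set" where
  "orb i j C = {A. (C, A) \<in> (rel i j)\<^sup>*}"

definition orbM :: "nat \<Rightarrow> nat \<Rightarrow> (bool \<times> 'a) set \<Rightarrow> (bool \<times> 'a) set set" where
  "orbM i j C = {A. (C, A) \<in> (relM i j)\<^sup>*}"

lemma orb_self: "C \<in> orb i j C"
  by (simp add: orb_def)

lemma orb_step: "A \<in> orb i j C \<Longrightarrow> k \<in> {i, j} \<Longrightarrow> adj k A \<in> orb i j C"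
  unfolding orb_def by (auto intro: rtrancl_into_rtrancl)

lemma orbM_self: "C \<in> orbM i j C"
  by (simp add: orbM_def)

lemma orbM_step: "A \<in> orbM i j C \<Longrightarrow> k \<in> {i, j} \<Longrightarrow> chamber_adj M (faces M) k A \<in> orbM i j C"
  unfolding orbM_def by (auto intro: rtrancl_into_rtrancl)

lemma orb_induct [consumes 1, case_names self step]:
  assumes "A \<in> orb i j C" and "P C" and "\<And>A k. A \<in> orb i j C \<Longrightarrow> P A \<Longrightarrow> k \<in> {i, j} \<Longrightarrow> P (adj k A)"
  shows "P A"
proof -
  have "(C, A) \<in> (rel i j)\<^sup>*" using assms(1) by (simp add: orb_def)
  then show ?thesis
  proof induction
    case (step y z)
    then obtain k where "k \<in> {i, j}" "z = adj k y" by blast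
    then show ?case using step assms(3) by (simp add: orb_def)
  qed (rule assms(2))
qed

lemma orbM_induct [consumes 1, case_names self step]:
  assumes "A \<in> orbM i j C" and "P C"
    and "\<And>A k. A \<in> orbM i j C \<Longrightarrow> P A \<Longrightarrow> k \<in> {i, j} \<Longrightarrow> P (chamber_adj M (faces M) k A)"
  shows "P A"
proof -
  have "(C, A) \<in> (relM i j)\<^sup>*" using assms(1) by (simp add: orbM_def)
  then show ?thesis
  proof induction
    case (step y z)
    then obtain k where "k \<in> {i, j}" "z = chamber_adj M (faces M) k y" by blast
    then show ?case using step assms(3) by (simp add: orbM_def)
  qed (rule assms(2))
qed

lemma orb_Ch: "A \<in> orb i j C \<Longrightarrow> C \<in> Ch \<Longrightarrow> A \<in> Ch"
  by (induction rule: orb_induct) (simp_all only: adj_in)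

lemma orb_sym:
  assumes "A \<in> orb i j C" "C \<in> Ch" "i < 3" "j < 3"
  shows "C \<in> orb i j A"
  using assms(1)
proof (induction rule: orb_induct)
  case (step A k)
  have A: "A \<in> Ch" using orb_Ch step assms(2) by blast
  have "adj k A \<in> orb i j (adj k A)" by (rule orb_self)
  then have "adj k (adj k A) \<in> orb i j (adj k A)" using step(2) by (rule orb_step)
  then have "(adj k A, A) \<in> (rel i j)\<^sup>*"
    using adj_adj[OF A, of k] step(2) assms(3,4) by (auto simp: orb_def)
  then show ?case using step.IH unfolding orb_def by (auto intro: rtrancl_trans)
qed (rule orb_self)

lemma orbM_proj:
  assumes "X \<in> orbM i j (fcopy x C)" "C \<in> Ch" "i < 3" "j < 3"
  shows "\<exists>y A. A \<in> orb i j C \<and> X = fcopy y A"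
  using assms(1)
proof (induction rule: orbM_induct)
  case self
  show ?case by (intro exI[of _ x] exI[of _ C] conjI orb_self refl)
next
  case (step X k)
  then obtain y A where A: "A \<in> orb i j C" "X = fcopy y A" by blast
  have "k < 3" using step(2) assms(3,4) by auto
  from adj_M[OF orb_Ch[OF A(1) assms(2)] this, of y]
  have "chamber_adj M (faces M) k X = fcopy (if crossing k A then \<not> y else y) (adj k A)"
    by (simp only: A(2))
  then show ?case using orb_step[OF A(1) step(2)] by blast
qed

lemma orbM_lift:
  assumes "A \<in> orb i j C" "C \<in> Ch" "i < 3" "j < 3"
  shows "\<exists>y. fcopy y A \<in> orbM i j (fcopy x C)"
  using assms(1)
proof (induction rule: orb_induct)
  case self
  show ?case by (intro exI[of _ x] orbM_self)
next
  case (step A k)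
  then obtain y where y: "fcopy y A \<in> orbM i j (fcopy x C)" by blast
  have "k < 3" using step(2) assms(3,4) by auto
  from orbM_step[OF y step(2)] adj_M[OF orb_Ch[OF step(1) assms(2)] this, of y]
  have "fcopy (if crossing k A then \<not> y else y) (adj k A) \<in> orbM i j (fcopy x C)" by simp
  then show ?case by (rule exI)
qed

end

section \<open>Orbit sizes and the numbers of the two symbols\<close>

context lsp
begin

text \<open>The \<open>i\<close>- and \<open>j\<close>-edges of a chamber are those at its vertex of
  the third type. If this vertex is not in the outer face, they are not boundary edges, and the
  orbit stays in one half.\<close>

lemma card_orbM_inner:
  assumes C: "C \<in> Ch" "f \<in> C" "i < 3" "j < 3" "i \<noteq> j" and t: "start_type Q f \<notin> {i, j}"
    and v: "vertex Q f \<inter> Out = {}"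
  shows "card (orbM i j (fcopy x C)) = card (orb i j C)"
proof -
  have nc: "A \<in> Ch \<Longrightarrow> g \<in> A \<Longrightarrow> vertex Q g = vertex Q f \<Longrightarrow> k \<in> {i, j} \<Longrightarrow>
      \<not> crossing k A \<and> (\<exists>g'\<in>adj k A. vertex Q g' = vertex Q f)" for A g k
  proof -
    assume A: "A \<in> Ch" and g: "g \<in> A" "vertex Q g = vertex Q f" and k: "k \<in> {i, j}"
    have k3: "k < 3" using k C(3,4) by auto
    define e where "e = TQ.edge_dart A k"
    have e: "e \<in> A" "has_edge_type Q k e" using TQ.edge_dart[OF A k3] by (simp_all add: e_def)
    note c = TQ.chamber[OF A e(1)]
    note cg = TQ.chamber[OF A g(1)]
    have "start_type Q g = start_type Q f" using g by (simp add: start_type_def)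
    then have "start_type Q g \<noteq> k" using t k by auto
    then have "g \<noteq> face_next Q (face_next Q e)"
      using TQ.edge_type_iff[OF A e(1) k3] e(2) by auto
    then have "g = e \<or> g = face_next Q e" using c(4) g(1) by blast
    then have ve: "vertex Q e = vertex Q f \<or> end_vertex Q e = vertex Q f"
      using g(2) vertex_face_next[OF c(1)] by auto
    then have nb: "\<not> boundary e" using boundary_vertex[OF c(1)] v by auto
    then have ncr: "\<not> crossing k A" by (simp add: crossing_def e_def)
    have o: "oinv Q e \<in> darts Q" "oinv Q e \<notin> Out" using c(1) oinv_in nb by auto
    have ad: "adj k A = face Q (oinv Q e)" using adj_eq[OF A k3] ncr by (simp add: e_def)
    have m1: "oinv Q e \<in> adj k A" unfolding ad by (rule face_self[OF o(1)])
    have "adj k A \<in> Ch" using A by (rule adj_in)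
    from TQ.chamber(4)[OF this m1] have m2: "face_next Q (oinv Q e) \<in> adj k A" by blast
    have "vertex Q (oinv Q e) = vertex Q f \<or> vertex Q (face_next Q (oinv Q e)) = vertex Q f"
      using ve vertex_face_next[OF o(1)] end_vertex_oinv[OF c(1)] by (auto simp: end_vertex_def)
    then show ?thesis using ncr m1 m2 by blast
  qed
  have inv: "\<exists>g\<in>A. vertex Q g = vertex Q f" if "A \<in> orb i j C" for A
    using that
  proof (induction rule: orb_induct)
    case (step A k)
    then show ?case using nc[OF orb_Ch[OF step(1) C(1)]] by blast
  qed (use C in blast)
  have proj: "X \<in> fcopy x ` orb i j C" if "X \<in> orbM i j (fcopy x C)" for X
    using that
  proof (induction rule: orbM_induct)
    case self
    show ?case by (intro imageI orb_self)
  next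
    case (step X k)
    then obtain A where A: "A \<in> orb i j C" "X = fcopy x A" by blast
    have "k < 3" using step(2) C(3,4) by auto
    moreover have "\<not> crossing k A" using inv[OF A(1)] nc[OF orb_Ch[OF A(1) C(1)]] step(2) by blast
    ultimately have "chamber_adj M (faces M) k X = fcopy x (adj k A)"
      using adj_M[OF orb_Ch[OF A(1) C(1)]] A(2) by simp
    then show ?case using orb_step[OF A(1) step(2)] by blast
  qed
  have lift: "fcopy x A \<in> orbM i j (fcopy x C)" if A: "A \<in> orb i j C" for A
  proof -
    obtain y where y: "fcopy y A \<in> orbM i j (fcopy x C)" using orbM_lift[OF A C(1,3,4)] by blast
    from proj[OF y] obtain A' where A': "A' \<in> orb i j C" "fcopy y A = fcopy x A'" by (rule imageE)
    have "A \<in> faces Q" "A' \<in> faces Q" using orb_Ch[OF A C(1)] orb_Ch[OF A'(1) C(1)] by simp_all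
    then have "y = x" using A'(2) fcopy_eq_iff[of A A' y x] by simp
    then show ?thesis using y by simp
  qed
  have "orbM i j (fcopy x C) = fcopy x ` orb i j C"
  proof (intro equalityI subsetI)
    fix X assume "X \<in> fcopy x ` orb i j C"
    then obtain A where "A \<in> orb i j C" "X = fcopy x A" by (rule imageE)
    then show "X \<in> orbM i j (fcopy x C)" using lift by simp
  qed (rule proj)
  moreover have "inj_on (fcopy x) (orb i j C)"
  proof (rule inj_onI)
    fix A A' assume AA: "A \<in> orb i j C" "A' \<in> orb i j C" "fcopy x A = fcopy x A'"
    show "A = A'"
      using AA(3) orb_Ch[OF AA(1) C(1)] orb_Ch[OF AA(2) C(1)] fcopy_eq_iff[of A A' x x] by simp
  qed
  ultimately show ?thesis by (simp add: card_image)
qed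

text \<open>Otherwise the orbit would contain all chambers around the vertex, and none would touch the outer face.\<close>

lemma orb_crossing:
  assumes C: "C \<in> Ch" "f \<in> C" "i < 3" "j < 3" "i \<noteq> j" and t: "start_type Q f \<notin> {i, j}"
    and v: "vertex Q f \<inter> Out \<noteq> {}"
  shows "\<exists>A\<in>orb i j C. \<exists>k\<in>{i, j}. crossing k A"
proof (rule ccontr)
  assume no: "\<not> ?thesis"
  have f: "f \<in> darts Q" "f \<notin> Out" using chamber_Out[OF C(1,2)] by auto
  have "g \<notin> Out \<and> face Q g \<in> orb i j C" if "g \<in> orbit (rot Q) f" for g
    using that
  proof (induction rule: rot.orbit_induct_f[OF f(1), consumes 1, case_names self step])
    case self
    have "face Q f = C" using face_eqI[OF _ C(2)] C(1) by blast
    then show ?case using f orb_self by blast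
  next
    case (step g)
    have g: "g \<in> darts Q" "vertex Q g = vertex Q f"
      using rot.orbit_in_S[OF step(1) f(1)] rot.orbit_eqI[OF f(1) step(1)] by (simp_all add: vertex_def)
    have tg: "start_type Q g \<notin> {i, j}" using t g by (simp add: start_type_def)
    define A where "A = face Q g"
    have A: "A \<in> Ch" "g \<in> A" "A \<in> orb i j C"
      using step(2) face_in_Ch[OF g(1)] face_self[OF g(1)] by (simp_all add: A_def)
    have e: "end_type Q g < 3" "start_type Q g < 3" "start_type Q g \<noteq> end_type Q g"
      using TQ.types_less[OF fn.f_in[OF g(1)]] TQ.types_less[OF g(1)] TQ.types[OF g(1)] TQ.end_type_eq[OF g(1)] by auto
    have "\<exists>k\<in>{i, j}. has_edge_type Q k g"
      using e tg C(3-5) by (auto simp: has_edge_type_def)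
    then obtain k where k: "k \<in> {i, j}" "has_edge_type Q k g" by blast
    have k3: "k < 3" using k C(3,4) by auto
    have ed: "TQ.edge_dart A k = g" using TQ.edge_dart_eqI[OF A(1) k3 A(2) k(2)] .
    have nc: "\<not> crossing k A" using no A(3) k(1) by blast
    then have o: "oinv Q g \<notin> Out" by (simp add: crossing_def ed)
    have "adj k A = face Q (rot Q g)" using adj_eq[OF A(1) k3] nc by (simp add: ed face_rot[OF g(1)])
    then show ?case using orb_step[OF A(3) k(1)] o Out_rot[OF g(1)] by simp
  qed
  then show False using v by (auto simp: vertex_def)
qed

text \<open>At a chamber with a boundary edge the orbit passes to the mirror image, and from this
  chamber all others are reached in both halves.\<close>

lemma card_orbM_boundary:
  assumes C: "C \<in> Ch" "f \<in> C" "i < 3" "j < 3" "i \<noteq> j" and t: "start_type Q f \<notin> {i, j}"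
    and v: "vertex Q f \<inter> Out \<noteq> {}"
  shows "card (orbM i j (fcopy x C)) = 2 * card (orb i j C)"
proof -
  obtain A k where A: "A \<in> orb i j C" "k \<in> {i, j}" "crossing k A"
    using orb_crossing[OF C t v] by blast
  have ACh: "A \<in> Ch" using orb_Ch A(1) C(1) by blast
  have k3: "k < 3" using A(2) C(3,4) by auto
  have fixed: "adj k A = A" using adj_eq[OF ACh k3] A(3) by simp
  obtain y where y: "fcopy y A \<in> orbM i j (fcopy x C)" using orbM_lift[OF A(1) C(1,3,4)] by blast
  have "fcopy (\<not> y) A \<in> orbM i j (fcopy x C)"
    using orbM_step[OF y A(2)] adj_M[OF ACh k3, of y] A(3) fixed by simp
  then have both: "fcopy z A \<in> orbM i j (fcopy x C)" for z using y by (cases "z = y") auto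
  have all: "\<forall>z. fcopy z A' \<in> orbM i j (fcopy x C)" if "A' \<in> orb i j A" for A'
    using that
  proof (induction rule: orb_induct)
    case (step A' l)
    have A': "A' \<in> Ch" using orb_Ch step(1) ACh by blast
    have l3: "l < 3" using step(2) C(3,4) by auto
    show ?case
    proof
      fix z
      define z' where "z' = (if crossing l A' then \<not> z else z)"
      have "chamber_adj M (faces M) l (fcopy z' A') = fcopy z (adj l A')"
        unfolding adj_M[OF A' l3] z'_def by simp
      then show "fcopy z (adj l A') \<in> orbM i j (fcopy x C)"
        using orbM_step[OF _ step(2), of "fcopy z' A'"] step.IH by metis
    qed
  qed (use both in blast)
  have "fcopy z A' \<in> orbM i j (fcopy x C)" if A': "A' \<in> orb i j C" for z A'
  proof -
    have "C \<in> orb i j A" by (rule orb_sym[OF A(1) C(1,3,4)])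
    then have "A' \<in> orb i j A" using A' unfolding orb_def by (auto intro: rtrancl_trans)
    then show ?thesis using all by blast
  qed
  then have "orbM i j (fcopy x C) = (\<lambda>(z, A). fcopy z A) ` (UNIV \<times> orb i j C)"
    using orbM_proj[OF _ C(1,3,4)] by fastforce
  moreover have "inj_on (\<lambda>(z, A). fcopy z A) (UNIV \<times> orb i j C)"
  proof (rule inj_onI, clarify)
    fix z A z' A' assume AA: "A \<in> orb i j C" "A' \<in> orb i j C" "fcopy z A = fcopy z' A'"
    show "z = z' \<and> A = A'"
      using AA(3) orb_Ch[OF AA(1) C(1)] orb_Ch[OF AA(2) C(1)] fcopy_eq_iff[of A A' z z'] by simp
  qed
  ultimately show ?thesis by (simp add: card_image card_cartesian_product)
qed

lemma dd_lsp_simps: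
  "chambers (dd_lsp Q) = Ch" "sigma_act (dd_lsp Q) = adj"
  by (simp_all add: dd_lsp_def Let_def adj_def[abs_def])

lemma dd_lopsp_simps:
  "chambers (dd_lopsp M) = faces M" "sigma_act (dd_lopsp M) = chamber_adj M (faces M)"
  by (simp_all add: dd_lopsp_def Let_def)

text \<open>Around a vertex in the outer face the doubled orbit cancels the division by two. The
  factors 2, 3 and 6 occur only there, because the special vertices are in the outer face.\<close>

lemma dd_m_eq:
  assumes C: "C \<in> Ch" and ij: "i < j" "j < 3"
  shows "dd_m (dd_lopsp M) i j (fcopy x C) = dd_m (dd_lsp Q) i j C"
proof -
  have ij3: "i < 3" "j < 3" "i \<noteq> j" using ij by auto
  \<comment> \<open>The third type.\<close>
  define l where "l = 3 - i - j"
  have "l < 3 \<and> l \<noteq> i \<and> l \<noteq> j" unfolding l_def using ij by presburger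
  then have l: "l < 3" "l \<notin> {i, j}" by simp_all
  obtain f where f: "f \<in> C" "start_type Q f = l" using TQ.ex1_start_type[OF C l(1)] by blast
  have t: "start_type Q f \<notin> {i, j}" using f l by simp
  note c = TQ.chamber[OF C f(1)]
  let ?v = "vertex Q f"
  have vV: "?v \<in> vertices Q" using c(1) by (rule vertex_in_vertices)
  have oQ: "opposite_vertex Q i j C = ?v" by (rule TQ.opposite_vertex_eqI[OF C f(1) ij3 t])
  define g where "g = face_next Q (face_next Q f)"
  have g: "g \<in> darts Q" "g \<in> C" "end_vertex Q g = ?v"
    using c(3,4,5) vertex_face_next[of g] by (auto simp: g_def)
  \<comment> \<open>The mirror image of the chamber consists of inverse darts, so there the dart
    starting at the vertex comes from the dart \<open>g\<close> that ends at it.\<close>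
  define m where "m = (x, if x then f else oinv Q g)"
  have m: "m \<in> fcopy x C" using f g by (auto simp: m_def fcopy_def)
  have mD: "m \<in> darts M" using m fcopy_in[OF C] D.faces_subset by blast
  have mv: "vertex M m = vcopy x ?v"
    using mD g(3) unfolding m_def by (auto simp: vertex_M end_vertex_def)
  have "start_type M m = l" using mv vtype_vcopy[OF vV] f(2) by (simp add: start_type_def)
  then have oM: "opposite_vertex M i j (fcopy x C) = vcopy x ?v"
    using TM.opposite_vertex_eqI[OF fcopy_in[OF C] m ij3] l mv by simp
  have sp: "vcopy x ?v = special M a \<longleftrightarrow> ?v = special Q a" if "a < 3" for a
    unfolding special_M_vcopy[OF that, of x] vcopy_eq_iff[OF vV special_vertex[OF that]] by simp
  have sp_b: "?v \<inter> Out \<noteq> {}" if "?v = special Q a" "a < 3" for a using that special_Out by simp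
  have nQ: "dihedral_orbit_size adj i j C = card (orb i j C)"
    by (simp add: dihedral_orbit_size_def orb_def)
  have nM: "dihedral_orbit_size (chamber_adj M (faces M)) i j (fcopy x C) = card (orbM i j (fcopy x C))"
    by (simp add: dihedral_orbit_size_def orbM_def)
  have mQ: "dd_m (dd_lsp Q) i j C = (let n = card (orb i j C) in
      if ?v = special Q 1 then 2 * n else if ?v = special Q 0 then 3 * n
      else if ?v = special Q 2 then 6 * n else if ?v \<inter> Out = {} then n div 2 else n)"
    unfolding dd_lsp_def Let_def using nQ oQ by (simp add: adj_def[abs_def])
  have mM: "dd_m (dd_lopsp M) i j (fcopy x C) = card (orbM i j (fcopy x C)) div 2 *
     (if ?v = special Q 1 then 2 else if ?v = special Q 0 then 3 else if ?v = special Q 2 then 6 else 1)"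
    unfolding dd_lopsp_def Let_def using nM oM sp by simp
  show ?thesis
  proof (cases "?v \<inter> Out = {}")
    case True
    then have "?v \<noteq> special Q a" if "a < 3" for a using sp_b that by blast
    then show ?thesis
      unfolding mQ mM using card_orbM_inner[OF C f(1) ij3 t True] True by (simp add: Let_def)
  next
    case False
    show ?thesis
      unfolding mQ mM card_orbM_boundary[OF C f(1) ij3 t False] using False by (simp add: Let_def)
  qed
qed

sublocale DM: dd "dd_lopsp M"
  by unfold_locales (use TM.chamber_adj_in TM.chamber_adj_twice in \<open>simp_all only: dd_lopsp_simps\<close>)

lemma tiling_subgroup_M:
  assumes "C \<in> Ch"
  shows "tiling_subgroup (dd_lopsp M) (fcopy x C) = tiling_subgroup (dd_lsp Q) C"
proof -
  define p where "p X = (THE A. A \<in> Ch \<and> (\<exists>y. X = fcopy y A))" for X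
  have p: "p (fcopy y A) = A" if "A \<in> Ch" for y A
    unfolding p_def
  proof (rule the_equality)
    show "A \<in> Ch \<and> (\<exists>z. fcopy y A = fcopy z A)" using that by blast
    fix A' assume "A' \<in> Ch \<and> (\<exists>z. fcopy y A = fcopy z A')"
    then obtain z where "A' \<in> Ch" "fcopy y A = fcopy z A'" by (elim conjE exE)
    then show "A' = A" using fcopy_eq_iff[of A A' y z] that by simp
  qed
  have "tiling_subgroup (dd_lopsp M) (fcopy x C) = tiling_subgroup (dd_lsp Q) (p (fcopy x C))"
  proof (rule tiling_subgroup_morphism)
    show "fcopy x C \<in> chambers (dd_lopsp M)" using fcopy_in[OF assms] by (simp add: dd_lopsp_simps)
    fix X assume "X \<in> chambers (dd_lopsp M)"
    then obtain y A where X: "X = fcopy y A" "A \<in> Ch" by (auto simp: dd_lopsp_simps faces_M)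
    show "sigma_act (dd_lopsp M) i X \<in> chambers (dd_lopsp M) \<and>
        p (sigma_act (dd_lopsp M) i X) = sigma_act (dd_lsp Q) i (p X)" if "i < 3" for i
      using adj_M[OF X(2) that, of y] p[OF X(2)] p[OF adj_in[OF X(2)]] fcopy_in[OF adj_in[OF X(2)]]
      by (simp add: X(1) dd_lopsp_simps dd_lsp_simps)
    show "dd_m (dd_lsp Q) i j (p X) = dd_m (dd_lopsp M) i j X" if "i < j" "j < 3" for i j
      using dd_m_eq[OF X(2) that] p[OF X(2)] by (simp add: X(1))
  qed
  then show ?thesis using p[OF assms] by simp
qed

text \<open>The dual graph is connected, and crossing a dart is the action of the generator that
  belongs to the type of its edge.\<close>

lemma chambers_connected:
  assumes "C \<in> faces M" "C' \<in> faces M"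
  shows "\<exists>u\<in>carrier \<Sigma>. act_word (dd_lopsp M) C u = C'"
proof -
  define R where "R = {X. \<exists>u\<in>carrier \<Sigma>. act_word (dd_lopsp M) C u = X}"
  interpret dualM: plane_map "dual_map M" by (rule D.plane_map_dual_map)
  have step: "chamber_adj M (faces M) i X \<in> R" if X: "X \<in> R" and i: "i < 3" for X i
  proof -
    obtain u where u: "u \<in> carrier \<Sigma>" "act_word (dd_lopsp M) C u = X" using X by (auto simp: R_def)
    have "act_word (dd_lopsp M) C (u \<otimes>\<^bsub>\<Sigma>\<^esub> [i]) = chamber_adj M (faces M) i X"
      using DM.act_word_mult[of C u "[i]"] assms(1) u by (simp add: dd_lopsp_simps act_word_def)
    moreover have "u \<otimes>\<^bsub>\<Sigma>\<^esub> [i] \<in> carrier \<Sigma>" using u sigma_gen_carrier[OF i] by simp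
    ultimately show ?thesis unfolding R_def by blast
  qed
  have adj: "face M (oinv M m) \<in> R" if m: "m \<in> darts M" "face M m \<in> R" for m
  proof -
    have F: "face M m \<in> faces M" using m D.face_in_faces by blast
    define a b where "a = start_type M m" and "b = end_type M m"
    have ab: "a < 3" "b < 3"
      using TM.types_less[OF m(1)] TM.types_less[OF D.fn.f_in[OF m(1)]] TM.end_type_eq[OF m(1)]
      by (simp_all add: a_def b_def)
    have ne: "a \<noteq> b" using TM.types[OF m(1)] by (simp add: a_def b_def)
    define i where "i = 3 - a - b"
    have "i < 3 \<and> a \<noteq> i \<and> b \<noteq> i" unfolding i_def using ab ne by presburger
    then have i: "i < 3" "a \<noteq> i" "b \<noteq> i" by simp_all
    have "TM.edge_dart (face M m) i = m"
      using TM.edge_dart_eqI[OF F i(1) D.face_self[OF m(1)]] i(2,3) by (simp add: has_edge_type_def a_def b_def)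
    then have "chamber_adj M (faces M) i (face M m) = face M (oinv M m)"
      using D.face_in_faces[OF D.oinv_in[OF m(1)]] by (simp add: TM.chamber_adj_eq)
    then show ?thesis using step[OF m(2) i(1)] by simp
  qed
  have "C \<in> R" unfolding R_def
    by (intro CollectI bexI[of _ "[]"]) (simp_all add: act_word_def Sigma_group_def)
  have "darts (dual_map M) \<inter> {m. face M m \<in> R} = {} \<or> darts (dual_map M) \<subseteq> {m. face M m \<in> R}"
  proof (rule dualM.connected[unfolded connected_via_def, rule_format])
    show "rot (dual_map M) e \<in> {m. face M m \<in> R} \<longleftrightarrow> e \<in> {m. face M m \<in> R}" if "e \<in> darts (dual_map M)" for e
      using that by (simp add: D.face_face_next)
    show "oinv (dual_map M) e \<in> {m. face M m \<in> R} \<longleftrightarrow> e \<in> {m. face M m \<in> R}" if "e \<in> darts (dual_map M)" for e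
    proof -
      have e: "e \<in> darts M" using that by simp
      show ?thesis using adj[OF e] adj[OF D.oinv_in[OF e]] D.oinv_oinv[OF e] by auto
    qed
  qed
  moreover obtain m where "m \<in> darts M" "C = face M m" using assms(1) by (auto simp: faces_def)
  ultimately have "face M m' \<in> R" if "m' \<in> darts M" for m' using \<open>C \<in> R\<close> that by auto
  then have "C' \<in> R" using assms(2) by (auto simp: faces_def)
  then show ?thesis by (simp add: R_def)
qed

text \<open>Over corresponding base chambers the two subgroups are equal; any other base chamber of
  the double is reached by a word, at the cost of a conjugation.\<close>

theorem tilings_isomorphic:
  assumes "C \<in> chambers (dd_lsp Q)" "C' \<in> chambers (dd_lopsp M)"
  shows "isomorphic_tilings (tiling_chambers (dd_lsp Q) C) (tiling_chambers (dd_lopsp M) C')"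
proof -
  have C: "C \<in> Ch" using assms(1) by (simp add: dd_lsp_simps)
  have C': "C' \<in> faces M" using assms(2) by (simp add: dd_lopsp_simps)
  obtain u where u: "u \<in> carrier \<Sigma>" "act_word (dd_lopsp M) (fcopy True C) u = C'"
    using chambers_connected[OF fcopy_in[OF C] C'] by blast
  have "fcopy True C \<in> chambers (dd_lopsp M)" using fcopy_in[OF C] by (simp add: dd_lopsp_simps)
  from DM.isomorphic_tilings_base[OF this u(1)]
  have "isomorphic_tilings (tiling_chambers (dd_lopsp M) (fcopy True C)) (tiling_chambers (dd_lopsp M) C')"
    unfolding u(2) .
  then show ?thesis
    unfolding tiling_chambers_def[of _ "fcopy True C"] tiling_subgroup_M[OF C]
    by (simp only: tiling_chambers_def)
qed

end

section \<open>The reflections crossed in the double\<close>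

lemma (in finite_bij) even_path_sum:
  assumes "x \<in> S" "\<And>y. y \<in> S \<Longrightarrow> even_word (c y)"
  shows "even_word (path_sum f c x m)"
  by (induction m) (simp_all add: assms(2) funpow_in[OF assms(1)])

context lsp
begin

text \<open>The cochain of the lsp-gluing: crossing an edge on a side reflects the underlying
  chamber in that side.\<close>

definition mirror :: "bool \<times> 'a \<Rightarrow> invol_word" where
  "mirror m = (if boundary (snd m) then gen (side (snd m)) else 0)"

lemma boundary_oinv: "d \<in> darts Q \<Longrightarrow> boundary (oinv Q d) \<longleftrightarrow> boundary d"
  using oinv_oinv[of d] by auto

lemma dart_M_Q: "m \<in> darts M \<Longrightarrow> snd m \<in> darts Q"
  by (cases m) (simp add: darts_M)

lemma snd_oinv_M: "snd (oinv M m) = oinv Q (snd m)"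
  by (cases m) (simp add: oinv_M)

lemma fst_oinv_M: "fst (oinv M m) = (if boundary (snd m) then \<not> fst m else fst m)"
  by (cases m) (simp add: oinv_M)

lemma mirror_oinv:
  assumes "m \<in> darts M"
  shows "mirror (oinv M m) = - mirror m"
  using boundary_oinv[OF dart_M_Q[OF assms]] side_oinv[OF dart_M_Q[OF assms]]
  by (simp add: mirror_def snd_oinv_M)

lemma even_word_mirror: "even_word (mirror m) \<longleftrightarrow> \<not> boundary (snd m)"
  by (simp add: mirror_def)

lemma fst_oinv_M_iff: "fst (oinv M m) = fst m \<longleftrightarrow> even_word (mirror m)"
  by (simp add: fst_oinv_M even_word_mirror)

lemma vertex_M_snd: "m \<in> darts M \<Longrightarrow> vertex M m = vcopy (fst m) (vertex Q (snd m))"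
  by (cases m) (simp add: vertex_M)

lemma mirror_inner:
  assumes "m \<in> darts M" "vertex Q (snd m) \<inter> Out = {}"
  shows "mirror m = 0"
  using boundary_vertex[OF dart_M_Q[OF assms(1)]] assms(2) by (auto simp: mirror_def)

text \<open>At a vertex of the outer face, exactly two oriented edges of the double cross the boundary.\<close>

lemma boundary_vertex_holonomy:
  assumes c: "c \<in> Out"
  defines "d \<equiv> fnext c"
  defines "a \<equiv> (True, oinv Q c)" and "b \<equiv> (False, d)"
  shows "a \<in> darts M" "b \<in> darts M" "vertex M a = vcopy True (vertex Q d)" "vertex M b = vcopy True (vertex Q d)"
    "holonomy (rot M) mirror a = gen (side c) + gen (side d)"
    "holonomy (rot M) mirror b = gen (side d) + gen (side c)"
proof -
  have oD: "c \<in> darts Q" "oinv Q c \<in> darts Q" "oinv Q (oinv Q c) = c"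
    using Out_dart[OF c] oinv_in oinv_oinv by simp_all
  have dO: "d \<in> Out" unfolding d_def using c Out_face_next[OF oD(1)] by simp
  have dD: "d \<in> darts Q" using dO by (rule Out_dart)
  show a: "a \<in> darts M" using oD Out_oinv[OF c] by (simp add: a_def darts_M)
  show b: "b \<in> darts M" using dD Out_oinv[OF dO] by (simp add: b_def darts_M)
  have vd: "vertex Q (oinv Q c) = vertex Q d"
    unfolding d_def using vertex_face_next[OF oD(1)] by (simp add: end_vertex_def)
  have bd: "vertex Q d \<inter> Out \<noteq> {}" using dO vertex_self[OF dD] by blast
  show va: "vertex M a = vcopy True (vertex Q d)" using a vd by (simp add: a_def vertex_M)
  show vb: "vertex M b = vcopy True (vertex Q d)"
    using b vcopy_boundary[OF bd, of False True] by (simp add: b_def vertex_M)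
  have ra: "mirror a = gen (side c)"
    using c side_oinv[OF oD(1)] oD(3) by (simp add: a_def mirror_def)
  have rb: "mirror b = gen (side d)" using dO by (simp add: b_def mirror_def)
  have ab: "a \<noteq> b" by (simp add: a_def b_def)
  have other: "mirror m = 0" if m: "m \<in> vertex M a" "m \<noteq> a" "m \<noteq> b" for m
  proof -
    have mD: "m \<in> darts M" using m(1) D.vertex_subset[OF a] by blast
    have mQ: "snd m \<in> darts Q" using mD by (rule dart_M_Q)
    have mv: "snd m \<in> vertex Q d" using m(1) unfolding va by (auto simp: vcopy_def)
    have vm: "vertex Q (snd m) = vertex Q d" using vertex_eq_iff[OF mQ dD] mv by simp
    have 1: "snd m \<notin> Out"
    proof
      assume "snd m \<in> Out"
      then have "snd m = d" using Out_unique dO vm by blast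
      then show False using m(3) mD \<open>snd m \<in> Out\<close> by (cases m) (auto simp: b_def darts_M)
    qed
    have 2: "oinv Q (snd m) \<notin> Out"
    proof
      assume oi: "oinv Q (snd m) \<in> Out"
      have "fnext (oinv Q (snd m)) \<in> Out" using oi Out_face_next[OF oinv_in[OF mQ]] by simp
      moreover have "vertex Q (fnext (oinv Q (snd m))) = vertex Q d"
        using vertex_face_next[OF oinv_in[OF mQ]] end_vertex_oinv[OF mQ] vm by simp
      ultimately have "fnext (oinv Q (snd m)) = d" using Out_unique dO by blast
      then have "oinv Q (snd m) = c" unfolding d_def using fn.f_eq_iff[OF oinv_in[OF mQ] oD(1)] by simp
      then have "snd m = oinv Q c" using oinv_oinv[OF mQ] by simp
      then show False using m(2) mD oi by (cases m) (auto simp: a_def darts_M)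
    qed
    show ?thesis using 1 2 by (simp add: mirror_def)
  qed
  have vab: "vertex M a = vertex M b" using va vb by simp
  show "holonomy (rot M) mirror a = gen (side c) + gen (side d)"
    unfolding ra[symmetric] rb[symmetric]
  proof (rule D.rot.holonomy_eq_pair[OF a])
    show "b \<in> orbit (rot M) a" using D.vertex_self[OF b] vab by (simp add: vertex_def)
  qed (use ab other in \<open>auto simp: vertex_def\<close>)
  show "holonomy (rot M) mirror b = gen (side d) + gen (side c)"
    unfolding ra[symmetric] rb[symmetric]
  proof (rule D.rot.holonomy_eq_pair[OF b])
    show "a \<in> orbit (rot M) b" using D.vertex_self[OF a] vab by (simp add: vertex_def)
    show "mirror m = 0" if "m \<in> orbit (rot M) b" "m \<noteq> b" "m \<noteq> a" for m
      using that other vab by (simp add: vertex_def)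
  qed (use ab in auto)
qed

lemma Out_prev:
  assumes "d \<in> Out"
  obtains c where "c \<in> Out" "fnext c = d"
proof -
  have dD: "d \<in> darts Q" using assms by (rule Out_dart)
  define c where "c = inv_into (darts Q) fnext d"
  have c: "c \<in> darts Q" "fnext c = d" using fn.inv_into_in[OF dD] fn.f_inv_into[OF dD] by (simp_all add: c_def)
  have "c \<in> Out" using Out_face_next[OF c(1)] c(2) assms by simp
  then show ?thesis using that c(2) by blast
qed

text \<open>At an ordinary vertex of the outer face both boundary edges lie on the same side, and
  the reflection is crossed twice.\<close>

lemma holonomy_mirror_flat:
  assumes m: "m \<in> darts M" "vertex M m \<notin> special M ` {0, 1, 2}"
  shows "holonomy (rot M) mirror m = 0"
proof (cases "vertex Q (snd m) \<inter> Out = {}")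
  case True
  have z: "mirror y = 0" if y: "y \<in> vertex M m" for y
  proof -
    have yD: "y \<in> darts M" using y D.vertex_subset[OF m(1)] by blast
    have "snd y \<in> vertex Q (snd m)" using y unfolding vertex_M_snd[OF m(1)] vcopy_def by (cases y) simp
    then have "vertex Q (snd y) = vertex Q (snd m)"
      using vertex_eq_iff[OF dart_M_Q[OF yD] dart_M_Q[OF m(1)]] by simp
    then show ?thesis using mirror_inner[OF yD] True by simp
  qed
  have "holonomy (rot M) mirror m = mirror m"
    by (rule D.rot.holonomy_eq_single[OF m(1)]) (use z in \<open>simp add: vertex_def\<close>)
  then show ?thesis using z[OF D.vertex_self[OF m(1)]] by simp
next
  case False
  then obtain d where d: "d \<in> Out" "d \<in> vertex Q (snd m)" by blast
  obtain c where c: "c \<in> Out" "fnext c = d" using Out_prev[OF d(1)] .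
  have vd: "vertex Q d = vertex Q (snd m)"
    using vertex_eq_iff[OF Out_dart[OF d(1)] dart_M_Q[OF m(1)]] d(2) by simp
  note h = boundary_vertex_holonomy[OF c(1), unfolded c(2)]
  let ?a = "(True, oinv Q c)"
  have va: "vertex M ?a = vertex M m"
    using h(3) vertex_M_snd[OF m(1)] vd vcopy_boundary[OF False, of True "fst m"] by simp
  have "vertex Q d \<notin> special Q ` {0, 1, 2}"
  proof
    assume "vertex Q d \<in> special Q ` {0, 1, 2}"
    then obtain i where "i \<in> {0, 1, 2}" "vertex Q d = special Q i" by (rule imageE)
    then have i: "i < 3" "vertex Q d = special Q i" by auto
    have "vertex M m = special M i"
      using va h(3) i special_M_vcopy[OF i(1), of True] by simp
    moreover have "i \<in> {0, 1, 2}" using i(1) by auto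
    ultimately show False using m(2) by blast
  qed
  then have "side d = side c" using side_fnext(1)[OF c(1)] c(2) by simp
  then have h0: "holonomy (rot M) mirror ?a = 0" using h(5) by (simp add: gen_twice)
  have "m \<in> orbit (rot M) ?a" using D.vertex_self[OF m(1)] va by (simp add: vertex_def)
  then obtain j where "m = (rot M ^^ j) ?a" by (rule D.rot.orbitE_funpow[OF h(1)])
  then show ?thesis using D.rot.holonomy_conj[OF h(1), of mirror j] h0 by simp
qed

text \<open>The product of the reflections in the two sides that meet at \<open>v_i\<close>, in the
  order met from the half named \<open>orient\<close>.\<close>

definition corner_word :: "nat \<Rightarrow> invol_word" where
  "corner_word i = (if i = 0 then gen 2 + gen 1 else if i = 1 then gen 0 + gen 2 else gen 1 + gen 0)"

text \<open>Reversing the outer walk reverses the order of the two sides, and so does starting in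
  the other half; the base point in the half \<open>orient\<close> makes the word independent of the
  orientation.\<close>

lemma holonomy_mirror_special:
  assumes i: "i < 3"
  obtains m where "m \<in> darts M" "vertex M m = special M i" "fst m = orient"
    "holonomy (rot M) mirror m = corner_word i"
proof -
  let ?d = "corner i"
  have d: "?d \<in> Out" "vertex Q ?d = special Q i" using corner[OF i] by simp_all
  obtain c where c: "c \<in> Out" "fnext c = ?d" using Out_prev[OF d(1)] .
  note h = boundary_vertex_holonomy[OF c(1), unfolded c(2)]
  note s = side_fnext[OF c(1), unfolded c(2)]
  have v: "vcopy True (vertex Q ?d) = special M i"
    using d(2) special_M_vcopy[OF i, of True] by simp
  consider "i = 0" | "i = 1" | "i = 2" using i by linarith
  then have sd: "gen (side c) + gen (side ?d) = corner_word i" if orient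
  proof cases
    case 1
    then show ?thesis using s(2) d(2) that by (simp add: corner_word_def)
  next
    case 2
    then show ?thesis using s(3) d(2) that by (simp add: corner_word_def)
  next
    case 3
    then show ?thesis using s(4) d(2) that by (simp add: corner_word_def)
  qed
  consider "i = 0" | "i = 1" | "i = 2" using i by linarith
  then have sd': "gen (side ?d) + gen (side c) = corner_word i" if "\<not> orient"
  proof cases
    case 1
    then show ?thesis using s(2) d(2) that by (simp add: corner_word_def)
  next
    case 2
    then show ?thesis using s(3) d(2) that by (simp add: corner_word_def)
  next
    case 3
    then show ?thesis using s(4) d(2) that by (simp add: corner_word_def)
  qed
  show ?thesis
  proof (cases orient)
    case True
    show ?thesis by (rule that[of "(True, oinv Q c)"]) (use h v sd True in simp_all)
  next
    case False
    show ?thesis by (rule that[of "(False, ?d)"]) (use h v sd' False in simp_all)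
  qed
qed

end

section \<open>Straightening a cut-path\<close>

locale lsp_cut = lsp Q for Q :: "'a lsp" +
  fixes P :: "(bool \<times> 'a) list"
  assumes cut_path: "cut_path (lopsp_of_lsp Q) P"
begin

abbreviation "len \<equiv> length P"

definition path_vertex :: "nat \<Rightarrow> (bool \<times> 'a) set" where
  "path_vertex k = (map (vertex M) P @ [end_vertex M (last P)]) ! k"

lemma len_pos: "0 < len"
  using cut_path by (simp add: cut_path_def)

lemma P_dart: "k < len \<Longrightarrow> P ! k \<in> darts M"
  using cut_path nth_mem by (auto simp: cut_path_def)

lemma vertex_P: "k < len \<Longrightarrow> vertex M (P ! k) = path_vertex k"
  by (simp add: path_vertex_def nth_append)

lemma end_vertex_P:
  assumes "k < len"
  shows "end_vertex M (P ! k) = path_vertex (Suc k)"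
proof (cases "Suc k < len")
  case True
  then show ?thesis using cut_path vertex_P[OF True] by (simp add: cut_path_def)
next
  case False
  then have "Suc k = len" using assms by simp
  then have "k = len - 1" by simp
  moreover have "path_vertex len = end_vertex M (last P)" by (simp add: path_vertex_def nth_append)
  moreover have "last P = P ! (len - 1)" using len_pos by (simp add: last_conv_nth)
  ultimately show ?thesis using \<open>Suc k = len\<close> by simp
qed

lemma vertex_oinv_P: "k < len \<Longrightarrow> vertex M (oinv M (P ! k)) = path_vertex (Suc k)"
  using end_vertex_P by (simp add: end_vertex_def)

lemma path_vertex_inj: "i \<le> len \<Longrightarrow> j \<le> len \<Longrightarrow> path_vertex i = path_vertex j \<longleftrightarrow> i = j"
proof -
  assume ij: "i \<le> len" "j \<le> len"
  have "distinct (map (vertex M) P @ [end_vertex M (last P)])" using cut_path unfolding cut_path_def by blast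
  then show ?thesis unfolding path_vertex_def using ij by (subst nth_eq_iff_index_eq) auto
qed

lemma path_vertex_special: "path_vertex 0 = special M 1" "path_vertex len = special M 2"
proof -
  show "path_vertex 0 = special M 1"
    using cut_path vertex_P[OF len_pos] hd_conv_nth[of P] len_pos unfolding cut_path_def by auto
  show "path_vertex len = special M 2"
    using cut_path by (simp add: cut_path_def path_vertex_def nth_append)
qed

definition k0 :: nat where
  "k0 = (SOME k. k < len \<and> path_vertex k = special M 0)"

lemma k0: "0 < k0" "k0 < len" "path_vertex k0 = special M 0"
proof -
  have "special M 0 \<in> vertex M ` set P" using cut_path unfolding cut_path_def by blast
  then obtain d where "d \<in> set P" "special M 0 = vertex M d" by blast
  then obtain k where "k < len" "path_vertex k = special M 0" using vertex_P by (metis in_set_conv_nth)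
  then have k: "k0 < len \<and> path_vertex k0 = special M 0"
    unfolding k0_def by (rule_tac someI[of _ k]) simp
  then show "k0 < len" "path_vertex k0 = special M 0" by simp_all
  have "special M 0 \<noteq> special M 1"
    using special_M_vcopy[of 0 True] special_M_vcopy[of 1 True] special_inj[of 0 1]
      vcopy_eq_iff[OF special_vertex[of 0] special_vertex[of 1]] by simp
  then show "0 < k0" using k path_vertex_special(1) by (cases k0) auto
qed

lemma path_vertex_special_iff: "k \<le> len \<Longrightarrow> path_vertex k \<in> special M ` {0, 1, 2} \<longleftrightarrow> k = 0 \<or> k = k0 \<or> k = len"
proof -
  assume k: "k \<le> len"
  have "path_vertex k \<in> special M ` {0, 1, 2} \<longleftrightarrow> path_vertex k = path_vertex k0 \<or> path_vertex k = path_vertex 0 \<or> path_vertex k = path_vertex len"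
    using path_vertex_special k0(3) by simp
  then show ?thesis using path_vertex_inj[OF k] k0(2) by auto
qed

lemma P_inj: "i < len \<Longrightarrow> j < len \<Longrightarrow> P ! i = P ! j \<longleftrightarrow> i = j"
  using vertex_P path_vertex_inj by (metis less_imp_le)

lemma P_oinv_inj: "i < len \<Longrightarrow> j < len \<Longrightarrow> oinv M (P ! i) = oinv M (P ! j) \<longleftrightarrow> i = j"
  using P_inj P_dart D.oinv_oinv by metis

lemma P_neq_oinv: "i < len \<Longrightarrow> j < len \<Longrightarrow> P ! i \<noteq> oinv M (P ! j)"
proof
  assume ij: "i < len" "j < len" "P ! i = oinv M (P ! j)"
  have "path_vertex i = path_vertex (Suc j)" using vertex_P[OF ij(1)] vertex_oinv_P[OF ij(2)] ij(3) by simp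
  then have 1: "i = Suc j" using path_vertex_inj[of i "Suc j"] ij by simp
  have "path_vertex (Suc i) = path_vertex j"
    using end_vertex_P[OF ij(1)] D.end_vertex_oinv[OF P_dart[OF ij(2)]] vertex_P[OF ij(2)] ij(3) by simp
  then have "Suc i = j" using path_vertex_inj[of "Suc i" j] ij by simp
  then show False using 1 by simp
qed

abbreviation "path_darts \<equiv> {P ! k | k. k < len} \<union> {oinv M (P ! k) | k. k < len}"

text \<open>The vertices of the path are distinct, so \<open>takeWhile\<close> stops exactly at
  index \<open>k0\<close>.\<close>

lemma cut_segment_iff:
  "m \<in> cut_segment M P a b \<longleftrightarrow>
     (\<exists>k<len. (m = P ! k \<and> (a, b) = (if k < k0 then (1, 0) else (0, 2))) \<or>
       (m = oinv M (P ! k) \<and> (a, b) = (if k < k0 then (0, 1) else (2, 0))))"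
proof -
  have t: "takeWhile (\<lambda>d. vertex M d \<noteq> special M 0) P = take k0 P"
  proof (rule takeWhile_eq_take_P_nth)
    show "vertex M (P ! i) \<noteq> special M 0" if "i < k0" "i < len" for i
      using that vertex_P[of i] k0 path_vertex_inj[of i k0] by simp
    show "\<not> vertex M (P ! k0) \<noteq> special M 0" if "k0 < len" using vertex_P[OF that] k0 by simp
  qed
  have d: "dropWhile (\<lambda>d. vertex M d \<noteq> special M 0) P = drop k0 P"
    unfolding dropWhile_eq_drop t using k0(2) by simp
  have A: "x \<in> set (take k0 P) \<longleftrightarrow> (\<exists>k<len. x = P ! k \<and> k < k0)" for x
    using k0(2) by (auto simp: in_set_conv_nth) (metis less_trans)
  have B: "x \<in> set (drop k0 P) \<longleftrightarrow> (\<exists>k<len. x = P ! k \<and> \<not> k < k0)" for x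
  proof
    assume "x \<in> set (drop k0 P)"
    then obtain i where "i < len - k0" "x = P ! (k0 + i)" by (auto simp: in_set_conv_nth)
    then show "\<exists>k<len. x = P ! k \<and> \<not> k < k0" by (intro exI[of _ "k0 + i"]) simp
  next
    assume "\<exists>k<len. x = P ! k \<and> \<not> k < k0"
    then obtain k where k: "k < len" "x = P ! k" "\<not> k < k0" by blast
    then have "drop k0 P ! (k - k0) = x" "k - k0 < length (drop k0 P)" by simp_all
    then show "x \<in> set (drop k0 P)" using nth_mem by metis
  qed
  have A': "x \<in> oinv M ` set (take k0 P) \<longleftrightarrow> (\<exists>k<len. x = oinv M (P ! k) \<and> k < k0)" for x
    unfolding image_iff Bex_def A by blast
  have B': "x \<in> oinv M ` set (drop k0 P) \<longleftrightarrow> (\<exists>k<len. x = oinv M (P ! k) \<and> \<not> k < k0)" for x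
    unfolding image_iff Bex_def B by blast
  have ifs: "((1 :: nat, 0 :: nat) = (if c then (1, 0) else (0, 2))) = c"
    "((1 :: nat, 0 :: nat) = (if c then (0, 1) else (2, 0))) = False"
    "((0 :: nat, 1 :: nat) = (if c then (1, 0) else (0, 2))) = False"
    "((0 :: nat, 1 :: nat) = (if c then (0, 1) else (2, 0))) = c"
    "((0 :: nat, 2 :: nat) = (if c then (1, 0) else (0, 2))) = (\<not> c)"
    "((0 :: nat, 2 :: nat) = (if c then (0, 1) else (2, 0))) = False"
    "((2 :: nat, 0 :: nat) = (if c then (1, 0) else (0, 2))) = False"
    "((2 :: nat, 0 :: nat) = (if c then (0, 1) else (2, 0))) = (\<not> c)" for c
    by simp_all
  consider "(a, b) = (1, 0)" | "(a, b) = (0, 1)" | "(a, b) = (0, 2)" | "(a, b) = (2, 0)"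
    | "(a, b) \<notin> {(1, 0), (0, 1), (0, 2), (2, 0)}" by blast
  then show ?thesis
  proof cases
    case 1
    then have ab: "a = 1" "b = 0" by simp_all
    show ?thesis unfolding ab ifs by (simp add: cut_segment_def t d Let_def A)
  next
    case 2
    then have ab: "a = 0" "b = 1" by simp_all
    show ?thesis unfolding ab ifs by (simp add: cut_segment_def t d Let_def A')
  next
    case 3
    then have ab: "a = 0" "b = 2" by simp_all
    show ?thesis unfolding ab ifs by (simp add: cut_segment_def t d Let_def B)
  next
    case 4
    then have ab: "a = 2" "b = 0" by simp_all
    show ?thesis unfolding ab ifs by (simp add: cut_segment_def t d Let_def B')
  next
    case 5
    then have n: "((a, b) = (1, 0)) = False" "((a, b) = (0, 1)) = False"
      "((a, b) = (0, 2)) = False" "((a, b) = (2, 0)) = False" by blast+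
    then have "cut_segment M P a b = {}" unfolding cut_segment_def Let_def n by (simp only: if_False)
    then show ?thesis using 5 by (simp split: if_splits)
  qed
qed

text \<open>A path is a tree grown from \<open>v_1\<close>; the leaf edge is the inverse of a path
  dart because growth steps start at the new vertex.\<close>

lemma grows_P: "n \<le> len \<Longrightarrow> grows M (darts M) {path_vertex 0} {} (path_vertex ` {..n}) ({P ! k | k. k < n} \<union> {oinv M (P ! k) | k. k < n})"
proof (induction n)
  case 0
  have "{P ! k | k. k < 0} \<union> {oinv M (P ! k) | k. k < 0} = {}" by simp
  moreover have "path_vertex ` {..0} = {path_vertex 0}" by simp
  ultimately show ?case using grows_refl[of M "darts M" "{path_vertex 0}" "{}"] by simp
next
  case (Suc n)
  have n: "n < len" using Suc.prems by simp
  let ?d = "oinv M (P ! n)"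
  have d: "?d \<in> darts M" using D.oinv_in[OF P_dart[OF n]] .
  have v: "vertex M ?d = path_vertex (Suc n)" by (rule vertex_oinv_P[OF n])
  have e: "end_vertex M ?d = path_vertex n" using D.end_vertex_oinv[OF P_dart[OF n]] vertex_P[OF n] by simp
  have new: "path_vertex (Suc n) \<notin> path_vertex ` {..n}"
  proof
    assume "path_vertex (Suc n) \<in> path_vertex ` {..n}"
    then obtain i where "i \<le> n" "path_vertex (Suc n) = path_vertex i" by auto
    then show False using path_vertex_inj[of "Suc n" i] n by simp
  qed
  have "grows M (darts M) {path_vertex 0} {} (insert (path_vertex (Suc n)) (path_vertex ` {..n}))
      (insert ?d (insert (P ! n) ({P ! k | k. k < n} \<union> {oinv M (P ! k) | k. k < n})))"
    using grows_step[OF Suc.IH d, unfolded v e] Suc.prems new D.oinv_oinv[OF P_dart[OF n]] by simp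
  moreover have "insert ?d (insert (P ! n) ({P ! k | k. k < n} \<union> {oinv M (P ! k) | k. k < n})) =
      {P ! k | k. k < Suc n} \<union> {oinv M (P ! k) | k. k < Suc n}"
    unfolding less_Suc_eq by blast
  moreover have "insert (path_vertex (Suc n)) (path_vertex ` {..n}) = path_vertex ` {..Suc n}" by (simp add: atMost_Suc)
  ultimately show ?case by simp
qed

lemma grows_path_darts: "grows M (darts M) {path_vertex 0} {} (path_vertex ` {..len}) path_darts"
  by (rule grows_P) simp

lemma path_vertex_in_vertices: "path_vertex 0 \<in> vertices M"
  using vertex_P[OF len_pos] D.vertex_in_vertices[OF P_dart[OF len_pos]] by simp

lemma path_darts_at:
  assumes "m \<in> path_darts" "vertex M m = path_vertex k" "k \<le> len"
  shows "(k < len \<and> m = P ! k) \<or> (0 < k \<and> m = oinv M (P ! (k - 1)))"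
proof -
  consider l where "l < len" "m = P ! l" | l where "l < len" "m = oinv M (P ! l)" using assms(1) by blast
  then show ?thesis
  proof cases
    case 1
    then have "l = k" using assms(2,3) vertex_P[OF 1(1)] path_vertex_inj[of l k] by simp
    then show ?thesis using 1 by simp
  next
    case 2
    then have "Suc l = k" using assms(2,3) vertex_oinv_P[OF 2(1)] path_vertex_inj[of "Suc l" k] by simp
    then show ?thesis using 2 by auto
  qed
qed

text \<open>The cochain \<open>mirror\<close> after a change of gauge that renames the chambers in
  each face by the word \<open>h\<close> of this face.\<close>

definition twist :: "((bool \<times> 'a) set \<Rightarrow> invol_word) \<Rightarrow> bool \<times> 'a \<Rightarrow> invol_word" where
  "twist h m = - h (face M m) + mirror m + h (face M (oinv M m))"

lemma twist_oinv: "m \<in> darts M \<Longrightarrow> twist h (oinv M m) = - twist h m"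
  using mirror_oinv[of m] D.oinv_oinv[of m]
  by (simp add: twist_def minus_add add.assoc diff_conv_add_uminus del: add_uminus_conv_diff)

text \<open>All special vertices lie on the path, so trivialization applies off it. There the parity
  of \<open>h\<close> changes exactly when the half changes, and the faces stay connected without
  crossing the path; hence the parity is right everywhere or wrong everywhere.\<close>

lemma exists_even_twist:
  "\<exists>h. (\<forall>m\<in>darts M - path_darts. twist h m = 0) \<and> (\<forall>m\<in>darts M. even_word (h (face M m)) \<longleftrightarrow> fst m = orient)"
proof -
  have "\<exists>h. \<forall>e\<in>darts M - path_darts. - h (face M e) + mirror e + h (face M (oinv M e)) = 0"
  proof (rule D.trivialization[where c = mirror, OF grows_path_darts path_vertex_in_vertices mirror_oinv])
    fix e assume e: "e \<in> darts M" "vertex M e \<notin> path_vertex ` {..len}"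
    have "special M ` {0, 1, 2} \<subseteq> path_vertex ` {..len}"
    proof -
      have "special M 0 \<in> path_vertex ` {..len}" using k0 by (intro rev_image_eqI[of k0]) simp_all
      moreover have "special M 1 \<in> path_vertex ` {..len}" using path_vertex_special by (intro rev_image_eqI[of 0]) simp_all
      moreover have "special M 2 \<in> path_vertex ` {..len}" using path_vertex_special by (intro rev_image_eqI[of len]) simp_all
      ultimately show ?thesis by simp
    qed
    then show "holonomy (rot M) mirror e = 0" using holonomy_mirror_flat[OF e(1)] e(2) by blast
  qed
  then obtain h where h: "twist h e = 0" if "e \<in> darts M" "e \<notin> path_darts" for e
    unfolding twist_def by blast
  let ?A = "{m. even_word (h (face M m)) \<longleftrightarrow> fst m = orient}"
  have "darts (dual_map M) \<inter> ?A = {} \<or> darts (dual_map M) \<subseteq> ?A"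
  proof (rule D.grows_dual_connected[OF D.connected grows_path_darts path_vertex_in_vertices, unfolded connected_via_def, rule_format])
    fix e assume "e \<in> darts (dual_map M)"
    then have e: "e \<in> darts M" by simp
    have "fst (face_next M e) = fst e" using face_next_M[of "fst e" "snd e"] e by simp
    then show "rot (dual_map M) e \<in> ?A \<longleftrightarrow> e \<in> ?A" using D.face_face_next[OF e] by simp
  next
    fix e assume "e \<in> darts M - path_darts"
    then have e: "e \<in> darts M" "e \<notin> path_darts" by simp_all
    have "even_word (twist h e)" using h[OF e] by simp
    then have "(even_word (h (face M e)) \<longleftrightarrow> even_word (mirror e)) \<longleftrightarrow> even_word (h (face M (oinv M e)))"
      by (simp add: twist_def)
    then show "oinv (dual_map M) e \<in> ?A \<longleftrightarrow> e \<in> ?A" using fst_oinv_M_iff[of e] by auto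
  qed
  then consider "darts M \<subseteq> ?A" | "darts M \<inter> ?A = {}" by auto
  then show ?thesis
  proof cases
    case 1
    then show ?thesis using h by (intro exI[of _ h]) auto
  next
    case 2
    \<comment> \<open>A constant added on the right conjugates the twist, which keeps its zeros, and
      an odd constant flips all parities.\<close>
    let ?h = "\<lambda>X. h X + gen 0"
    have "twist ?h e = - gen 0 + twist h e + gen 0" for e
      by (simp only: twist_def minus_add add.assoc)
    then have "\<forall>e\<in>darts M - path_darts. twist ?h e = 0" using h by (simp add: gen_twice)
    moreover have "\<forall>m\<in>darts M. even_word (?h (face M m)) \<longleftrightarrow> fst m = orient" using 2 by auto
    ultimately show ?thesis by blast
  qed
qed

text \<open>The cochain of the lopsp-gluing: the word that takes the positive chamber of a double
  chamber to that of the one glued along the dart.\<close>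

definition cut_word :: "bool \<times> 'a \<Rightarrow> invol_word" where
  "cut_word m = (if m \<in> cut_segment M P 1 0 then gen 0 + gen 2
     else if m \<in> cut_segment M P 0 1 then gen 2 + gen 0
     else if m \<in> cut_segment M P 0 2 then gen 0 + gen 1
     else if m \<in> cut_segment M P 2 0 then gen 1 + gen 0 else 0)"

lemma cut_segment_P:
  assumes k: "k < len"
  shows "P ! k \<in> cut_segment M P a b \<longleftrightarrow> (a, b) = (if k < k0 then (1, 0) else (0, 2))"
  unfolding cut_segment_iff using k P_inj[OF k] P_neq_oinv[OF k] by blast

lemma cut_segment_oinv_P:
  assumes k: "k < len"
  shows "oinv M (P ! k) \<in> cut_segment M P a b \<longleftrightarrow> (a, b) = (if k < k0 then (0, 1) else (2, 0))"
  unfolding cut_segment_iff using k P_oinv_inj[OF k] P_neq_oinv[OF _ k] by (metis (no_types, lifting))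

lemma cut_segment_off: "m \<notin> path_darts \<Longrightarrow> m \<notin> cut_segment M P a b"
  unfolding cut_segment_iff by blast

lemma cut_word_simps:
  "k < len \<Longrightarrow> cut_word (P ! k) = (if k < k0 then gen 0 + gen 2 else gen 0 + gen 1)"
  "k < len \<Longrightarrow> cut_word (oinv M (P ! k)) = (if k < k0 then gen 2 + gen 0 else gen 1 + gen 0)"
  "m \<notin> path_darts \<Longrightarrow> cut_word m = 0"
  by (simp_all add: cut_word_def cut_segment_P cut_segment_oinv_P cut_segment_off del: One_nat_def)

theorem exists_straightening:
  "\<exists>h. (\<forall>m\<in>darts M. twist h m = cut_word m) \<and> (\<forall>m\<in>darts M. even_word (h (face M m)) \<longleftrightarrow> fst m = orient)"
proof -
  obtain h where off: "\<And>m. m \<in> darts M \<Longrightarrow> m \<notin> path_darts \<Longrightarrow> twist h m = 0"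
    and par: "\<And>m. m \<in> darts M \<Longrightarrow> even_word (h (face M m)) \<longleftrightarrow> fst m = orient"
    using exists_even_twist by blast
  have even: "even_word (twist h m)" if m: "m \<in> darts M" for m
    using par[OF m] par[OF D.oinv_in[OF m]] fst_oinv_M_iff[of m] by (auto simp: twist_def)
  have gauge: "holonomy (rot M) (twist h) m = - h (face M m) + holonomy (rot M) mirror m + h (face M m)"
    if m: "m \<in> darts M" for m
    by (rule D.rot.holonomy_gauge[OF m, where h = "\<lambda>m. h (face M m)"])
      (use D.face_rot[OF D.rot.orbit_in_S[OF _ m]] in \<open>simp add: twist_def\<close>)
  \<comment> \<open>Neither the gauge nor the base point affects the conjugacy class. The conjugator
    is even: all values of the twist are even, and so is \<open>h\<close> at a base point in the
    half \<open>orient\<close>.\<close>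
  have special: "\<exists>q. even_word q \<and> holonomy (rot M) (twist h) m = q + corner_word i - q"
    if m: "m \<in> darts M" "vertex M m = special M i" and i: "i < 3" for m i
  proof -
    obtain m0 where m0: "m0 \<in> darts M" "vertex M m0 = special M i" "fst m0 = orient"
      "holonomy (rot M) mirror m0 = corner_word i" using holonomy_mirror_special[OF i] .
    have "m \<in> orbit (rot M) m0" using D.vertex_self[OF m(1)] m(2) m0(2) by (simp add: vertex_def)
    then obtain j where j: "m = (rot M ^^ j) m0" by (rule D.rot.orbitE_funpow[OF m0(1)])
    define s where "s = path_sum (rot M) (twist h) m0 j"
    have "even_word s" unfolding s_def by (rule D.rot.even_path_sum[OF m0(1) even])
    have "holonomy (rot M) (twist h) m = - s + (- h (face M m0) + corner_word i + h (face M m0)) + s"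
      using D.rot.holonomy_conj[OF m0(1), of "twist h" j] gauge[OF m0(1)] m0(4) j by (simp add: s_def)
    also have "\<dots> = (- s + - h (face M m0)) + corner_word i - (- s + - h (face M m0))"
      by (simp add: diff_conv_add_uminus minus_add add.assoc del: add_uminus_conv_diff)
    finally show ?thesis
      using \<open>even_word s\<close> par[OF m0(1)] m0(3) by (intro exI[of _ "- s + - h (face M m0)"]) simp
  qed
  have zero: "twist h y = 0"
    if "m \<in> darts M" "vertex M m = path_vertex k" "k \<le> len" "y \<in> orbit (rot M) m"
      "k < len \<Longrightarrow> y \<noteq> P ! k" "0 < k \<Longrightarrow> y \<noteq> oinv M (P ! (k - 1))" for m k y
  proof -
    have y: "y \<in> darts M" using D.rot.orbit_in_S that(1,4) by blast
    have "vertex M y = path_vertex k" using D.rot.orbit_eqI[OF that(1,4)] that(2) by (simp add: vertex_def)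
    then have "y \<notin> path_darts" using path_darts_at[of y k] that(3,5,6) by blast
    then show ?thesis using off[OF y] by blast
  qed
  have start: "holonomy (rot M) (twist h) (P ! 0) = twist h (P ! 0)"
    using P_dart[OF len_pos] zero[OF P_dart[OF len_pos] vertex_P[OF len_pos]]
    by (intro D.rot.holonomy_eq_single) simp_all
  define l where "l = len - 1"
  have l: "l < len" "Suc l = len" using len_pos by (simp_all add: l_def)
  have stop: "holonomy (rot M) (twist h) (oinv M (P ! l)) = twist h (oinv M (P ! l))"
  proof (rule D.rot.holonomy_eq_single[OF D.oinv_in[OF P_dart[OF l(1)]]])
    fix y assume y: "y \<in> orbit (rot M) (oinv M (P ! l))" "y \<noteq> oinv M (P ! l)"
    show "twist h y = 0"
      by (rule zero[OF D.oinv_in[OF P_dart[OF l(1)]] vertex_oinv_P[OF l(1)] _ y(1)])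
        (use y(2) l in \<open>simp_all add: l_def\<close>)
  qed
  \<comment> \<open>At an intermediate vertex only the arriving and the leaving path dart carry a
    value.\<close>
  have pair: "holonomy (rot M) (twist h) (oinv M (P ! k)) = - twist h (P ! k) + twist h (P ! Suc k)"
    if k: "Suc k < len" for k
  proof -
    have k': "k < len" using k by simp
    note o = D.oinv_in[OF P_dart[OF k']]
    have "holonomy (rot M) (twist h) (oinv M (P ! k)) = twist h (oinv M (P ! k)) + twist h (P ! Suc k)"
    proof (rule D.rot.holonomy_eq_pair[OF o])
      show "P ! Suc k \<in> orbit (rot M) (oinv M (P ! k))"
        using D.vertex_self[OF P_dart[OF k]] vertex_P[OF k] vertex_oinv_P[OF k'] by (simp add: vertex_def)
      show "P ! Suc k \<noteq> oinv M (P ! k)" by (rule P_neq_oinv[OF k k'])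
      show "twist h y = 0" if "y \<in> orbit (rot M) (oinv M (P ! k))" "y \<noteq> oinv M (P ! k)" "y \<noteq> P ! Suc k" for y
        using zero[OF o vertex_oinv_P[OF k'] _ that(1)] that(2,3) k by simp
    qed
    then show ?thesis using twist_oinv[OF P_dart[OF k']] by simp
  qed
  have same: "twist h (P ! Suc k) = twist h (P ! k)" if k: "Suc k < len" "Suc k \<noteq> k0" for k
  proof -
    have k': "k < len" using k by simp
    have "vertex M (oinv M (P ! k)) \<notin> special M ` {0, 1, 2}"
      unfolding vertex_oinv_P[OF k'] using path_vertex_special_iff[of "Suc k"] k by simp
    then have "holonomy (rot M) (twist h) (oinv M (P ! k)) = 0"
      using gauge[OF D.oinv_in[OF P_dart[OF k']]] holonomy_mirror_flat[OF D.oinv_in[OF P_dart[OF k']]] by simp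
    then have "- twist h (P ! k) + twist h (P ! Suc k) = 0" using pair[OF k(1)] by simp
    from minus_unique[OF this] show ?thesis by simp
  qed
  \<comment> \<open>The constants on the halves before and after \<open>v_0\<close>.\<close>
  define A where "A = twist h (P ! 0)"
  define B where "B = twist h (P ! l)"
  have tA: "k < k0 \<Longrightarrow> twist h (P ! k) = A" for k
    using same k0(2) by (induction k) (simp_all add: A_def)
  have tB: "twist h (P ! k) = B" if "k0 \<le> k" "k < len" for k
  proof -
    have "k \<le> l" using that l by simp
    then show ?thesis
      using that(1)
    proof (induction rule: inc_induct)
      case (step n)
      then show ?case using same[of n] l by simp
    qed (simp add: B_def)
  qed
  obtain p where p: "even_word p" "A = p + (gen 0 + gen 2) - p"
    using special[OF P_dart[OF len_pos], of 1] start vertex_P[OF len_pos] path_vertex_special(1)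
    by (auto simp: corner_word_def A_def)
  obtain q where q: "even_word q" "- B = q + (gen 1 + gen 0) - q"
    using special[OF D.oinv_in[OF P_dart[OF l(1)]], of 2] stop vertex_oinv_P[OF l(1)] path_vertex_special(2) l
      twist_oinv[OF P_dart[OF l(1)]]
    by (auto simp: corner_word_def B_def)
  have qB: "B = q + (gen 0 + gen 1) - q"
  proof -
    have "B = - (q + (gen 1 + gen 0) - q)" using q(2) by (metis minus_minus)
    then show ?thesis
      by (simp add: diff_conv_add_uminus minus_add add.assoc del: add_uminus_conv_diff)
  qed
  \<comment> \<open>The holonomy at \<open>v_0\<close>, where the path arrives with value
    \<open>A\<close> and leaves with value \<open>B\<close>.\<close>
  obtain r where r: "- A + B = r + (gen 2 + gen 1) - r"
  proof -
    have k: "Suc (k0 - 1) < len" "k0 - 1 < k0" "Suc (k0 - 1) = k0" using k0 by simp_all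
    have k': "k0 - 1 < len" using k by simp
    have "holonomy (rot M) (twist h) (oinv M (P ! (k0 - 1))) = - A + B"
      using pair[OF k(1)] tA[OF k(2)] tB[of k0] k k0 by simp
    moreover have "vertex M (oinv M (P ! (k0 - 1))) = special M 0"
      using vertex_oinv_P[OF k'] k(3) k0(3) by simp
    ultimately show ?thesis
      using special[OF D.oinv_in[OF P_dart[OF k']], of 0] that by (auto simp: corner_word_def)
  qed
  obtain k where k: "even_word k" "A = k + (gen 0 + gen 2) - k" "B = k + (gen 0 + gen 1) - k"
    using simultaneous_conj[OF p(2) qB r p(1) q(1)] by blast
  \<comment> \<open>The constant \<open>k\<close> conjugates both values to the prescribed words;
    being even, it preserves the parity condition.\<close>
  let ?h = "\<lambda>X. h X + k"
  have tw: "twist ?h m = - k + twist h m + k" for m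
    by (simp only: twist_def minus_add add.assoc)
  have kk: "- k + (k + x - k) + k = x" for x :: invol_word
    by (simp add: diff_conv_add_uminus add.assoc del: add_uminus_conv_diff)
  have P1: "twist ?h (P ! i) = cut_word (P ! i)" if i: "i < len" for i
  proof (cases "i < k0")
    case True
    then show ?thesis unfolding cut_word_simps(1)[OF i] tw tA[OF True] k(2) kk by simp
  next
    case False
    then have "k0 \<le> i" by simp
    from tB[OF this i] show ?thesis unfolding cut_word_simps(1)[OF i] tw k(3) using False kk by simp
  qed
  have P2: "twist ?h (oinv M (P ! i)) = cut_word (oinv M (P ! i))" if i: "i < len" for i
    unfolding twist_oinv[OF P_dart[OF i]] P1[OF i] cut_word_simps(1,2)[OF i] by (simp add: minus_add)
  have "twist ?h m = cut_word m" if m: "m \<in> darts M" for m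
  proof (cases "m \<in> path_darts")
    case True
    then show ?thesis using P1 P2 by blast
  next
    case False
    then show ?thesis using cut_word_simps(3)[OF False] off[OF m False] tw by simp
  qed
  moreover have "\<forall>m\<in>darts M. even_word (?h (face M m)) \<longleftrightarrow> fst m = orient" using par k(1) by simp
  ultimately show ?thesis by blast
qed

end

section \<open>The application of an lsp-operation and of its double\<close>

text \<open>The rotation of the glued graph stays over one vertex of the patch, so the set given to
  \<open>the_elem\<close> is a singleton.\<close>

lemma start_type_glue:
  fixes N :: "('d, 'z) lemb_scheme" and X :: "'c set" and I p nb
  assumes N: "emap N"
  defines "T \<equiv> glue_copies N I X p nb"
  assumes closed: "\<And>m. m \<in> darts T \<Longrightarrow> rot T m \<in> darts T"
    and xd: "(x, d) \<in> darts T"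
  shows "start_type T (x, d) = start_type N d"
proof -
  interpret N: emap N by (rule N)
  have step: "vertex N (snd (rot T m)) = vertex N (snd m)" if m: "m \<in> darts T" for m
  proof -
    have e: "snd m \<in> darts N" using m by (cases m) (simp add: T_def glue_copies_def)
    have "vertex N (N.prev (snd m)) = vertex N (snd m)"
      using N.vertex_rot[OF N.prev_simps(1)[OF e]] N.prev_simps(2)[OF e] by simp
    then show ?thesis using N.vertex_rot[OF e] by (cases m) (simp add: T_def glue_copies_def)
  qed
  have orb: "m \<in> darts T \<and> vertex N (snd m) = vertex N d" if "m \<in> orbit (rot T) (x, d)" for m
    using that
  proof induction
    case base
    then show ?case using closed[OF xd] step[OF xd] by simp
  next
    case (step m)
    then show ?case using closed[of m] \<open>\<And>m. m \<in> darts T \<Longrightarrow> vertex N (snd (rot T m)) = vertex N (snd m)\<close>[of m]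
      by simp
  qed
  have "(\<lambda>(x, d). vtype N (vertex N d)) ` orbit (rot T) (x, d) = {vtype N (vertex N d)}"
  proof (intro equalityI subsetI)
    fix y assume "y \<in> (\<lambda>(x, d). vtype N (vertex N d)) ` orbit (rot T) (x, d)"
    then obtain m where m: "m \<in> orbit (rot T) (x, d)" "y = (\<lambda>(x, d). vtype N (vertex N d)) m" by (rule imageE)
    then show "y \<in> {vtype N (vertex N d)}" using orb[OF m(1)] by (simp add: case_prod_unfold)
  next
    fix y assume "y \<in> {vtype N (vertex N d)}"
    then have "y = (\<lambda>(x, d). vtype N (vertex N d)) (rot T (x, d))"
      using step[OF xd] by (simp add: case_prod_unfold)
    then show "y \<in> (\<lambda>(x, d). vtype N (vertex N d)) ` orbit (rot T) (x, d)"
      using orbit.base[of "rot T" "(x, d)"] by (rule image_eqI)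
  qed
  then show ?thesis by (simp add: start_type_def vertex_def T_def glue_copies_def)
qed

lemma end_type_glue:
  fixes N :: "('d, 'z) lemb_scheme" and X :: "'c set" and I p nb
  assumes N: "emap N"
  defines "T \<equiv> glue_copies N I X p nb"
  assumes closed: "\<And>m. m \<in> darts T \<Longrightarrow> rot T m \<in> darts T" "\<And>m. m \<in> darts T \<Longrightarrow> oinv T m \<in> darts T"
    and xd: "(x, d) \<in> darts T"
  shows "end_type T (x, d) = end_type N d"
proof -
  have "oinv T (x, d) = (nb x d, oinv N d)" by (simp add: T_def glue_copies_def)
  then have "start_type T (nb x d, oinv N d) = start_type N (oinv N d)"
    using start_type_glue[OF N closed(1)[unfolded T_def], of "nb x d" "oinv N d"] closed(2)[OF xd]
    by (simp add: T_def)
  then show ?thesis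
    using \<open>oinv T (x, d) = (nb x d, oinv N d)\<close> by (simp add: start_type_def end_type_def end_vertex_def)
qed

lemma underlying_graph_isomorphic:
  assumes f: "bij_betw f (darts S) (darts T)"
    and hom: "\<And>d. d \<in> darts S \<Longrightarrow> f (oinv S d) = oinv T (f d)" "\<And>d. d \<in> darts S \<Longrightarrow> f (rot S d) = rot T (f d)"
    and closed: "\<And>d. d \<in> darts S \<Longrightarrow> oinv S d \<in> darts S" "\<And>d. d \<in> darts S \<Longrightarrow> rot S d \<in> darts S"
    and types: "\<And>d. d \<in> darts S \<Longrightarrow> start_type T (f d) = start_type S d"
      "\<And>d. d \<in> darts S \<Longrightarrow> end_type T (f d) = end_type S d"
  shows "emb_isomorphic (underlying_graph S) (underlying_graph T)"
  unfolding emb_isomorphic_def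
proof (intro exI[of _ f] conjI ballI)
  show "bij_betw f (darts (underlying_graph S)) (darts (underlying_graph T))"
    unfolding bij_betw_def
  proof
    show "inj_on f (darts (underlying_graph S))"
      using f by (rule bij_betw_imp_inj_on[THEN inj_on_subset]) (auto simp: underlying_graph_def)
    show "f ` darts (underlying_graph S) = darts (underlying_graph T)"
    proof (intro equalityI subsetI)
      fix y assume "y \<in> f ` darts (underlying_graph S)"
      then obtain d where d: "d \<in> darts (underlying_graph S)" "y = f d" by (rule imageE)
      have dS: "d \<in> darts S" using d(1) by (simp add: underlying_graph_def)
      have "f d \<in> darts T" using bij_betw_apply[OF f dS] .
      then show "y \<in> darts (underlying_graph T)"
        using d types[OF dS] by (simp add: underlying_graph_def)
    next
      fix y assume y: "y \<in> darts (underlying_graph T)"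
      then have "y \<in> f ` darts S" using f by (simp add: underlying_graph_def bij_betw_def)
      then obtain d where d: "d \<in> darts S" "y = f d" by blast
      then have "d \<in> darts (underlying_graph S)"
        using y types[OF d(1)] by (simp add: underlying_graph_def)
      then show "y \<in> f ` darts (underlying_graph S)" using d(2) by blast
    qed
  qed
  fix d assume "d \<in> darts (underlying_graph S)"
  then have d: "d \<in> darts S" by (simp add: underlying_graph_def)
  show "f (oinv (underlying_graph S) d) = oinv (underlying_graph T) (f d)"
    using d by (simp add: underlying_graph_def hom closed)
  show "f (rot (underlying_graph S) d) = rot (underlying_graph T) (f d)"
    using d by (simp add: underlying_graph_def hom closed)
qed

section \<open>The action of words on the chambers of a graph\<close>

context emap
begin

text \<open>The letters above 2 act like 0, so that every letter reverses the orientation.\<close>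

definition reflect :: "nat \<Rightarrow> ('d \<times> nat \<times> nat) set \<Rightarrow> ('d \<times> nat \<times> nat) set" where
  "reflect i C = chamber_adj B (faces B) (if i < 3 then i else 0) C"

definition reflect_word :: "('d \<times> nat \<times> nat) set \<Rightarrow> invol_word \<Rightarrow> ('d \<times> nat \<times> nat) set" where
  "reflect_word C w = foldl (\<lambda>A i. reflect i A) C (letters w)"

lemma faces_B_cases:
  assumes "C \<in> faces B"
  obtains e where "e \<in> darts M" "C = pos_chamber e" | e where "e \<in> darts M" "C = neg_chamber e"
  using assms unfolding faces_B by blast

lemma pos_in: "e \<in> darts M \<Longrightarrow> pos_chamber e \<in> faces B"
  and neg_in: "e \<in> darts M \<Longrightarrow> neg_chamber e \<in> faces B"
  unfolding faces_B by blast+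

lemma reflect_props:
  assumes C: "C \<in> faces B"
  shows "reflect i C \<in> faces B" "reflect i (reflect i C) = C"
    "chamber_orientation B (reflect i C) \<longleftrightarrow> \<not> chamber_orientation B C"
proof -
  define k where "k = (if i < 3 then i else 0)"
  have k: "k = 0 \<or> k = 1 \<or> k = 2" by (auto simp: k_def)
  have r: "reflect i = chamber_adj B (faces B) k" by (simp add: reflect_def[abs_def] k_def)
  from C have "reflect i C \<in> faces B \<and> reflect i (reflect i C) = C \<and>
      (chamber_orientation B (reflect i C) \<longleftrightarrow> \<not> chamber_orientation B C)"
  proof (cases rule: faces_B_cases)
    case (1 e)
    note o = oinv_in[OF 1(1)] and p = prev_simps(1)[OF 1(1)]
    note s = chamber_adj_pos[OF 1(1)] chamber_adj_neg[OF o] chamber_adj_neg[OF p] chamber_adj_neg[OF 1(1)]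
      oinv_oinv[OF 1(1)] prev_simps(2)[OF 1(1)] chamber_orientation_pos chamber_orientation_neg
      neg_in[OF o] neg_in[OF p] neg_in[OF 1(1)]
    show ?thesis unfolding r 1(2) using k
      by (elim disjE) (simp_all only: s not_False_eq_True not_True_eq_False simp_thms)
  next
    case (2 e)
    note o = oinv_in[OF 2(1)] and p = rot.f_in[OF 2(1)]
    note s = chamber_adj_neg[OF 2(1)] chamber_adj_pos[OF o] chamber_adj_pos[OF p] chamber_adj_pos[OF 2(1)]
      oinv_oinv[OF 2(1)] prev_simps(3)[OF 2(1)] chamber_orientation_pos chamber_orientation_neg
      pos_in[OF o] pos_in[OF p] pos_in[OF 2(1)]
    show ?thesis unfolding r 2(2) using k
      by (elim disjE) (simp_all only: s not_False_eq_True not_True_eq_False simp_thms)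
  qed
  then show "reflect i C \<in> faces B" "reflect i (reflect i C) = C"
    "chamber_orientation B (reflect i C) \<longleftrightarrow> \<not> chamber_orientation B C" by simp_all
qed

lemma foldl_reflect_in: "C \<in> faces B \<Longrightarrow> foldl (\<lambda>A i. reflect i A) C w \<in> faces B"
  by (induction w arbitrary: C) (simp_all add: reflect_props(1))

lemma reflect_word_in: "C \<in> faces B \<Longrightarrow> reflect_word C w \<in> faces B"
  unfolding reflect_word_def by (rule foldl_reflect_in)

lemma reflect_word_orientation:
  "C \<in> faces B \<Longrightarrow> chamber_orientation B (reflect_word C w) \<longleftrightarrow> (chamber_orientation B C \<longleftrightarrow> even_word w)"
proof -
  have "C \<in> faces B \<Longrightarrow> chamber_orientation B (foldl (\<lambda>A i. reflect i A) C w) \<longleftrightarrow>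
      (chamber_orientation B C \<longleftrightarrow> even (length w))" for w
    by (induction w arbitrary: C) (auto simp: reflect_props(1,3))
  then show "C \<in> faces B \<Longrightarrow> ?thesis" by (simp add: reflect_word_def even_word_def)
qed

text \<open>Cancelling two equal letters does not change the action, since each reflection is an
  involution.\<close>

lemma reflect_word_plus:
  assumes "C \<in> faces B"
  shows "reflect_word C (u + v) = reflect_word (reflect_word C u) v"
proof -
  let ?f = "foldl (\<lambda>A i. reflect i A)"
  have cons: "?f C (sigma_cons i w) = ?f (reflect i C) w" if "C \<in> faces B" for C i w
    using that by (cases w) (simp_all add: reflect_props(2))
  have "?f C (foldr sigma_cons u v) = ?f (?f C u) v" if "C \<in> faces B" for C u v
    using that
  proof (induction u arbitrary: C)
    case (Cons i u)
    then show ?case using cons[OF Cons.prems] reflect_props(1)[OF Cons.prems] by simp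
  qed simp
  then show ?thesis using assms by (simp add: reflect_word_def letters_plus)
qed

lemma reflect_word_zero: "reflect_word C 0 = C"
  by (simp add: reflect_word_def letters_zero)

lemma reflect_word_gen: "i < 3 \<Longrightarrow> reflect_word C (gen i) = chamber_adj B (faces B) i C"
  by (simp add: reflect_word_def reflect_def)

text \<open>The letter 0 exchanges the positive and the negative half of a double chamber. It comes
  first if the edge to be crossed belongs to the negative half, and last if that edge belongs to the
  positive half.\<close>

lemma reflect_word_rotations:
  assumes e: "e \<in> darts M"
  shows "reflect_word (pos_chamber e) (gen 0 + gen 2) = pos_chamber (oinv M e)"
    "reflect_word (pos_chamber e) (gen 2 + gen 0) = pos_chamber (oinv M e)"
    "reflect_word (pos_chamber e) (gen 0 + gen 1) = pos_chamber (face_next M e)"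
    "reflect_word (pos_chamber e) (gen 1 + gen 0) = pos_chamber (inv_into (darts M) (face_next M) e)"
proof -
  have lt: "0 < (3 :: nat)" "1 < (3 :: nat)" "2 < (3 :: nat)" by simp_all
  note o = oinv_in[OF e] and p = prev_simps(1)[OF e]
  note s = reflect_word_plus[OF pos_in[OF e]] reflect_word_gen[OF lt(1)] reflect_word_gen[OF lt(2)] reflect_word_gen[OF lt(3)]
    chamber_adj_pos[OF e] chamber_adj_neg[OF e] chamber_adj_neg[OF o] chamber_adj_neg[OF p]
  show "reflect_word (pos_chamber e) (gen 0 + gen 2) = pos_chamber (oinv M e)" by (simp only: s)
  show "reflect_word (pos_chamber e) (gen 2 + gen 0) = pos_chamber (oinv M e)" by (simp only: s)
  show "reflect_word (pos_chamber e) (gen 0 + gen 1) = pos_chamber (face_next M e)"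
    by (simp only: s face_next_def)
  have "inv_into (darts M) (face_next M) e = oinv M (prev e)"
    using face_prev_eq[OF p] prev_simps(2)[OF e] by simp
  then show "reflect_word (pos_chamber e) (gen 1 + gen 0) = pos_chamber (inv_into (darts M) (face_next M) e)"
    by (simp only: s)
qed

lemma orientation_pos:
  assumes "C \<in> faces B" "chamber_orientation B C"
  obtains e where "e \<in> darts M" "C = pos_chamber e"
  using assms(1)
proof (cases rule: faces_B_cases)
  case (2 e)
  then show ?thesis using assms(2) chamber_orientation_neg by simp
qed (rule that)

text \<open>Each double chamber contains one positive chamber, so this is a bijection on positive
  chambers.\<close>

definition double_of :: "('d \<times> nat \<times> nat) set \<Rightarrow> ('d \<times> nat \<times> nat) set" where
  "double_of C = double_chamber (THE e. C = pos_chamber e)"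

lemma double_of_pos: "double_of (pos_chamber e) = double_chamber e"
  by (simp add: double_of_def pos_chamber_eq_iff)

end

section \<open>The isomorphism between the two gluings\<close>

locale lsp_application = lsp_cut Q P + G: emap G
  for Q :: "'a lsp" and P :: "(bool \<times> 'a) list" and G :: "'b emb"
begin

text \<open>This brings the gluing along the cut-path into the form of an action of words, as
  \<open>mirror\<close> does for the lsp-gluing.\<close>

lemma lopsp_neighbour_cut_word:
  assumes e: "e \<in> darts G"
  shows "lopsp_neighbour M P G (G.double_chamber e) m = G.double_of (G.reflect_word (G.pos_chamber e) (cut_word m))"
proof -
  consider k where "k < len" "m = P ! k" | k where "k < len" "m = oinv M (P ! k)" | "m \<notin> path_darts" by blast
  then show ?thesis
  proof cases
    case 1
    note r = G.reflect_word_rotations[OF e] G.double_of_pos cut_word_simps(1)[OF 1(1)] 1(2)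
    show ?thesis
    proof (cases "k < k0")
      case True
      have "m \<in> cut_segment M P a b \<longleftrightarrow> a = 1 \<and> b = 0" for a b
        unfolding 1(2) cut_segment_P[OF 1(1)] using True by simp
      from G.lopsp_neighbour_eq(2)[OF e this refl refl] show ?thesis using True by (simp add: r)
    next
      case False
      have "m \<in> cut_segment M P a b \<longleftrightarrow> a = 0 \<and> b = 2" for a b
        unfolding 1(2) cut_segment_P[OF 1(1)] using False by simp
      from G.lopsp_neighbour_eq(3)[OF e this refl refl] show ?thesis using False by (simp add: r del: One_nat_def)
    qed
  next
    case 2
    note r = G.reflect_word_rotations[OF e] G.double_of_pos cut_word_simps(2)[OF 2(1)] 2(2)
    show ?thesis
    proof (cases "k < k0")
      case True
      have "m \<in> cut_segment M P a b \<longleftrightarrow> a = 0 \<and> b = 1" for a b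
        unfolding 2(2) cut_segment_oinv_P[OF 2(1)] using True by simp
      from G.lopsp_neighbour_eq(1)[OF e this refl refl] show ?thesis using True by (simp add: r)
    next
      case False
      have "m \<in> cut_segment M P a b \<longleftrightarrow> a = 2 \<and> b = 0" for a b
        unfolding 2(2) cut_segment_oinv_P[OF 2(1)] using False by simp
      from G.lopsp_neighbour_eq(4)[OF e this refl refl] show ?thesis using False by (simp add: r del: One_nat_def)
    qed
  next
    case 3
    then show ?thesis
      using G.lopsp_neighbour_off[of m M P, OF cut_segment_off] cut_word_simps(3)
      by (simp add: G.reflect_word_zero G.double_of_pos)
  qed
qed

abbreviation "S1 \<equiv> lsp_subdivision Q G"
abbreviation "S2 \<equiv> lopsp_subdivision M P G"

text \<open>The copy of \<open>O\<close> glued into \<open>C\<close>, direct or mirrored, is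
  identified with one half of the double.\<close>

definition copy_of :: "('b \<times> nat \<times> nat) set \<Rightarrow> bool" where
  "copy_of C \<longleftrightarrow> (chamber_orientation G.B C \<longleftrightarrow> orient)"

lemma lsp_neighbour_eq:
  assumes "d \<in> darts Q"
  shows "lsp_neighbour Q G C d = G.reflect_word C (mirror (x, d))"
proof (cases "boundary d")
  case True
  have ex: "\<exists>i<3. d \<in> boundary_side Q i"
    using boundary_side_eq[OF assms side_less[of d]] True side_less[of d] by blast
  have "(THE i. i < 3 \<and> d \<in> boundary_side Q i) = side d"
  proof (rule the_equality)
    show "side d < 3 \<and> d \<in> boundary_side Q (side d)"
      using boundary_side_eq[OF assms side_less[of d]] True side_less[of d] by simp
    show "i = side d" if "i < 3 \<and> d \<in> boundary_side Q i" for i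
      using that boundary_side_eq[OF assms, of i] by simp
  qed
  then show ?thesis
    using ex True G.reflect_word_gen[OF side_less[of d]] by (simp add: lsp_neighbour_def mirror_def)
next
  case False
  have "\<not> (\<exists>i<3. d \<in> boundary_side Q i)" using boundary_side_eq[OF assms] False by blast
  then have "lsp_neighbour Q G C d = C" unfolding lsp_neighbour_def by (rule if_not_P)
  then show ?thesis using False by (simp add: mirror_def G.reflect_word_zero)
qed

lemma darts_S1: "(C, d) \<in> darts S1 \<longleftrightarrow> C \<in> faces G.B \<and> (copy_of C, d) \<in> darts M"
  using oinv_in[of d]
  by (auto simp: lsp_subdivision_def glue_copies_def copy_of_def lsp_orientation_iff darts_M inner_darts_def)

lemma copy_of_reflect:
  assumes "C \<in> faces G.B"
  shows "copy_of (G.reflect_word C (mirror (copy_of C, d))) = fst (oinv M (copy_of C, d))"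
  using G.reflect_word_orientation[OF assms, of "mirror (copy_of C, d)"]
  by (auto simp: copy_of_def fst_oinv_M even_word_mirror)

lemma oinv_S1:
  assumes "(C, d) \<in> darts S1"
  shows "oinv S1 (C, d) = (G.reflect_word C (mirror (copy_of C, d)), oinv Q d)"
proof -
  have "d \<in> darts Q" using assms by (simp add: darts_S1 darts_M)
  then show ?thesis
    using lsp_neighbour_eq[of d C "copy_of C"] by (simp add: lsp_subdivision_def glue_copies_def)
qed

lemma rot_S1:
  assumes "(C, d) \<in> darts S1"
  shows "rot S1 (C, d) = (G.reflect_word C (mirror (copy_of C, d)), snd (rot M (copy_of C, d)))"
proof -
  have d: "d \<in> darts Q" and C: "C \<in> faces G.B" using assms by (simp_all add: darts_S1 darts_M)
  have "rot S1 (C, d) = (lsp_neighbour Q G C d,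
      if copy_of (lsp_neighbour Q G C d) then rot Q d else rprev d)"
    by (simp add: lsp_subdivision_def glue_copies_def copy_of_def lsp_orientation_iff)
  then show ?thesis
    using lsp_neighbour_eq[OF d, of C "copy_of C"] copy_of_reflect[OF C, of d]
    by (simp add: rot_M fst_oinv_M Let_def)
qed

lemma fst_rot_M: "fst (rot M m) = fst (oinv M m)"
  by (cases m) (simp add: rot_M oinv_M Let_def)

lemma S1_closed:
  assumes "m \<in> darts S1"
  shows "oinv S1 m \<in> darts S1" "rot S1 m \<in> darts S1"
proof -
  obtain C d where m: "m = (C, d)" by (cases m)
  have C: "C \<in> faces G.B" and cd: "(copy_of C, d) \<in> darts M" using assms m by (simp_all add: darts_S1)
  let ?C = "G.reflect_word C (mirror (copy_of C, d))"
  have C': "?C \<in> faces G.B" using G.reflect_word_in[OF C] .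
  have "(copy_of ?C, oinv Q d) = oinv M (copy_of C, d)"
    using copy_of_reflect[OF C, of d] snd_oinv_M[of "(copy_of C, d)"] by (intro prod_eqI) simp_all
  then show "oinv S1 m \<in> darts S1"
    using C' D.oinv_in[OF cd] oinv_S1[of C d] assms m by (simp add: darts_S1)
  have "(copy_of ?C, snd (rot M (copy_of C, d))) = rot M (copy_of C, d)"
    using copy_of_reflect[OF C, of d] fst_rot_M[of "(copy_of C, d)"] by (intro prod_eqI) simp_all
  then show "rot S1 m \<in> darts S1"
    using C' D.rot.f_in[OF cd] rot_S1[of C d] assms m by (simp add: darts_S1)
qed

lemma darts_S2: "(E, m) \<in> darts S2 \<longleftrightarrow> E \<in> faces G.DS \<and> m \<in> darts M"
  by (auto simp: lopsp_subdivision_def glue_copies_def)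

lemma oinv_S2: "oinv S2 (E, m) = (lopsp_neighbour M P G E m, oinv M m)"
  by (simp add: lopsp_subdivision_def glue_copies_def)

lemma rot_S2: "rot S2 (E, m) = (lopsp_neighbour M P G E m, rot M m)"
  by (simp add: lopsp_subdivision_def glue_copies_def)

theorem apply_isomorphic: "emb_isomorphic (apply_lsp Q G) (apply_lopsp M P G)"
proof -
  obtain h where tw: "\<And>m. m \<in> darts M \<Longrightarrow> twist h m = cut_word m"
    and par: "\<And>m. m \<in> darts M \<Longrightarrow> even_word (h (face M m)) \<longleftrightarrow> fst m = orient"
    using exists_straightening by blast
  \<comment> \<open>The cohomology relation read as a commutation: crossing in the lsp-gluing and
    then applying \<open>h\<close> is applying \<open>h\<close> and then crossing in the other
    gluing.\<close>
  have shift: "mirror m + h (face M (oinv M m)) = h (face M m) + cut_word m" if m: "m \<in> darts M" for m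
  proof -
    have "- h (face M m) + (mirror m + h (face M (oinv M m))) = cut_word m"
      using tw[OF m] unfolding twist_def by (simp only: add.assoc)
    then show ?thesis by (metis add_minus_cancel)
  qed
  \<comment> \<open>The dart over the double is kept; only the chamber is moved by the word of the
    face to the left.\<close>
  define f where "f = (\<lambda>(C, d). (G.double_of (G.reflect_word C (h (face M (copy_of C, d)))), (copy_of C, d)))"
  define g where "g = (\<lambda>(E, m). (G.reflect_word (G.pos_chamber (THE e. E = G.double_chamber e)) (- h (face M m)), snd (m :: bool \<times> 'a)))"
  \<comment> \<open>This is what the parity condition on \<open>h\<close> is for: the moved chamber
    is positive and so names a double chamber.\<close>
  have pos: "\<exists>e\<in>darts G. G.reflect_word C (h (face M (copy_of C, d))) = G.pos_chamber e"
    if "(C, d) \<in> darts S1" for C d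
  proof -
    have C: "C \<in> faces G.B" and cd: "(copy_of C, d) \<in> darts M" using that by (simp_all add: darts_S1)
    have "chamber_orientation G.B (G.reflect_word C (h (face M (copy_of C, d))))"
      using G.reflect_word_orientation[OF C] par[OF cd] by (auto simp: copy_of_def)
    then show ?thesis using G.orientation_pos[OF G.reflect_word_in[OF C]] by blast
  qed
  have bij: "bij_betw f (darts S1) (darts S2)"
  proof (rule bij_betwI[where g = g])
    show "f \<in> darts S1 \<rightarrow> darts S2"
    proof
      fix m assume m: "m \<in> darts S1"
      obtain C d where cd: "m = (C, d)" by (cases m)
      obtain e where "e \<in> darts G" "G.reflect_word C (h (face M (copy_of C, d))) = G.pos_chamber e"
        using pos[of C d] m cd by blast
      then show "f m \<in> darts S2"
        using m unfolding cd by (simp add: f_def G.double_of_pos darts_S2 G.faces_DS darts_S1)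
    qed
    have gC: "G.reflect_word (G.pos_chamber e) (- h (face M m)) \<in> faces G.B \<and>
        copy_of (G.reflect_word (G.pos_chamber e) (- h (face M m))) = fst m"
      if e: "e \<in> darts G" and m: "m \<in> darts M" for e m
      using G.reflect_word_in[OF G.pos_in[OF e]] G.reflect_word_orientation[OF G.pos_in[OF e], of "- h (face M m)"]
        par[OF m] G.chamber_orientation_pos[of e] by (auto simp: copy_of_def)
    have the: "(THE e'. G.double_chamber e = G.double_chamber e') = e" for e
      by (simp add: G.double_chamber_eq_iff)
    show "g \<in> darts S2 \<rightarrow> darts S1"
    proof
      fix z assume z: "z \<in> darts S2"
      obtain E m where em: "z = (E, m)" by (cases z)
      obtain e where e: "e \<in> darts G" "E = G.double_chamber e" and m: "m \<in> darts M"
        using z unfolding em darts_S2 G.faces_DS by blast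
      show "g z \<in> darts S1"
        using gC[OF e(1) m] m unfolding em e(2) by (simp add: g_def the darts_S1)
    qed
    show "g (f m) = m" if m: "m \<in> darts S1" for m
    proof -
      obtain C d where cd: "m = (C, d)" by (cases m)
      have C: "C \<in> faces G.B" using m cd by (simp add: darts_S1)
      obtain e where e: "e \<in> darts G" "G.reflect_word C (h (face M (copy_of C, d))) = G.pos_chamber e"
        using pos[of C d] m cd by blast
      have "G.reflect_word (G.pos_chamber e) (- h (face M (copy_of C, d))) = C"
        unfolding e(2)[symmetric] G.reflect_word_plus[OF C, symmetric] by (simp add: G.reflect_word_zero)
      then show ?thesis unfolding cd by (simp add: f_def g_def e(2) G.double_of_pos the)
    qed
    show "f (g z) = z" if z: "z \<in> darts S2" for z
    proof -
      obtain E m where em: "z = (E, m)" by (cases z)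
      obtain e where e: "e \<in> darts G" "E = G.double_chamber e" and m: "m \<in> darts M"
        using z unfolding em darts_S2 G.faces_DS by blast
      have "G.reflect_word (G.reflect_word (G.pos_chamber e) (- h (face M m))) (h (face M m)) = G.pos_chamber e"
        unfolding G.reflect_word_plus[OF G.pos_in[OF e(1)], symmetric] by (simp add: G.reflect_word_zero)
      then show ?thesis
        using gC[OF e(1) m] unfolding em e(2) by (simp add: f_def g_def the G.double_of_pos)
    qed
  qed
  have step: "G.double_of (G.reflect_word (G.reflect_word C (mirror (copy_of C, d))) (h (face M (oinv M (copy_of C, d))))) =
      lopsp_neighbour M P G (G.double_of (G.reflect_word C (h (face M (copy_of C, d))))) (copy_of C, d)"
    if cd: "(C, d) \<in> darts S1" for C d
  proof -
    have C: "C \<in> faces G.B" and m: "(copy_of C, d) \<in> darts M" using cd by (simp_all add: darts_S1)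
    obtain e where e: "e \<in> darts G" "G.reflect_word C (h (face M (copy_of C, d))) = G.pos_chamber e"
      using pos[OF cd] by blast
    show ?thesis
      unfolding e(2) G.double_of_pos lopsp_neighbour_cut_word[OF e(1)]
      unfolding e(2)[symmetric] G.reflect_word_plus[OF C, symmetric] shift[OF m] ..
  qed
  have f_oinv: "f (oinv S1 m) = oinv S2 (f m)" and f_rot: "f (rot S1 m) = rot S2 (f m)"
    if m: "m \<in> darts S1" for m
  proof -
    obtain C d where cd: "m = (C, d)" by (cases m)
    have CD: "(C, d) \<in> darts S1" using m cd by simp
    then have C: "C \<in> faces G.B" and mM: "(copy_of C, d) \<in> darts M" by (simp_all add: darts_S1)
    let ?C = "G.reflect_word C (mirror (copy_of C, d))"
    have o: "(copy_of ?C, oinv Q d) = oinv M (copy_of C, d)"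
      using copy_of_reflect[OF C, of d] snd_oinv_M[of "(copy_of C, d)"] by (intro prod_eqI) simp_all
    have r: "(copy_of ?C, snd (rot M (copy_of C, d))) = rot M (copy_of C, d)"
      using copy_of_reflect[OF C, of d] fst_rot_M[of "(copy_of C, d)"] by (intro prod_eqI) simp_all
    show "f (oinv S1 m) = oinv S2 (f m)"
      unfolding cd oinv_S1[OF CD] by (simp only: f_def prod.case o oinv_S2 step[OF CD])
    show "f (rot S1 m) = rot S2 (f m)"
      unfolding cd rot_S1[OF CD]
      by (simp only: f_def prod.case r rot_S2 D.face_rot[OF mM] step[OF CD])
  qed
  \<comment> \<open>Transported from the lsp-gluing along the bijection.\<close>
  have S2_closed: "oinv S2 z \<in> darts S2" "rot S2 z \<in> darts S2" if "z \<in> darts S2" for z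
  proof -
    have "z \<in> f ` darts S1" unfolding bij_betw_imp_surj_on[OF bij] by (rule that)
    then obtain m where m: "z = f m" "m \<in> darts S1" by (rule imageE)
    show "oinv S2 z \<in> darts S2" "rot S2 z \<in> darts S2"
      unfolding m(1) f_oinv[OF m(2), symmetric] f_rot[OF m(2), symmetric]
      using bij_betw_apply[OF bij S1_closed(1)[OF m(2)]] bij_betw_apply[OF bij S1_closed(2)[OF m(2)]] by simp_all
  qed
  have types: "start_type S2 (f m) = start_type S1 m" "end_type S2 (f m) = end_type S1 m" if m: "m \<in> darts S1" for m
  proof -
    obtain C d where cd: "m = (C, d)" by (cases m)
    have CD: "(C, d) \<in> darts S1" using m cd by simp
    then have mM: "(copy_of C, d) \<in> darts M" by (simp add: darts_S1)
    obtain E where E: "f m = (E, (copy_of C, d))" unfolding cd f_def by simp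
    have fm: "(E, (copy_of C, d)) \<in> darts S2" using bij_betw_apply[OF bij m] E by simp
    have "start_type S1 m = start_type Q d"
      unfolding cd lsp_subdivision_def
      by (rule start_type_glue[OF emap_Q]) (use S1_closed(2) CD in \<open>simp_all only: lsp_subdivision_def\<close>)
    moreover have "start_type S2 (f m) = start_type M (copy_of C, d)"
      unfolding E lopsp_subdivision_def
      by (rule start_type_glue[OF emap_M]) (use S2_closed(2) fm in \<open>simp_all only: lopsp_subdivision_def\<close>)
    ultimately show "start_type S2 (f m) = start_type S1 m" using start_type_M[OF mM] by simp
    have "end_type S1 m = end_type Q d"
      unfolding cd lsp_subdivision_def
      by (rule end_type_glue[OF emap_Q]) (use S1_closed CD in \<open>simp_all only: lsp_subdivision_def\<close>)
    moreover have "end_type S2 (f m) = end_type M (copy_of C, d)"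
      unfolding E lopsp_subdivision_def
      by (rule end_type_glue[OF emap_M]) (use S2_closed fm in \<open>simp_all only: lopsp_subdivision_def\<close>)
    ultimately show "end_type S2 (f m) = end_type S1 m" using end_type_M[OF mM] by simp
  qed
  show ?thesis
    unfolding apply_lsp_def apply_lopsp_def
    by (rule underlying_graph_isomorphic[OF bij f_oinv f_rot S1_closed types])
qed

end

text \<open>The existence of a cut-path is included so that the claim for every \<open>P\<close> is
  not empty; as \<open>P\<close> is arbitrary, the result does not depend on it up to isomorphism.
  The base chambers of the two tilings are arbitrary as well, since the encoding lets any chamber be
  fixed.\<close>

theorem lemma5:
  fixes Q :: "'a lsp"
  assumes "lsp_operation Q"
  shows "lopsp_operation (lopsp_of_lsp Q) \<and>
    (\<exists>P. cut_path (lopsp_of_lsp Q) P) \<and>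
    (\<forall>(G :: 'b emb) P. embedded_graph G \<and> cut_path (lopsp_of_lsp Q) P \<longrightarrow>
       emb_isomorphic (apply_lsp Q G) (apply_lopsp (lopsp_of_lsp Q) P G)) \<and>
    (\<forall>C\<in>chambers (dd_lsp Q). \<forall>C'\<in>chambers (dd_lopsp (lopsp_of_lsp Q)).
       isomorphic_tilings (tiling_chambers (dd_lsp Q) C)
         (tiling_chambers (dd_lopsp (lopsp_of_lsp Q)) C'))"
proof -
  interpret lsp Q by unfold_locales (rule assms)
  have "emb_isomorphic (apply_lsp Q G) (apply_lopsp (lopsp_of_lsp Q) P G)"
    if G: "embedded_graph G" and P: "cut_path (lopsp_of_lsp Q) P" for G :: "'b emb" and P
  proof -
    have "emap G"
      using G unfolding embedded_graph_def by unfold_locales blast+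
    then interpret lsp_application Q P G
      by (intro lsp_application.intro lsp_cut.intro lsp_cut_axioms.intro lsp_axioms P)
    show ?thesis by (rule apply_isomorphic)
  qed
  then show ?thesis
    using lopsp_operation_M cut_path_exists tilings_isomorphic by blast
qed

end
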